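(* Let $\mathbb{G}$ be a compact quantum group, let $\alpha:\mathrm{Pol}(\mathbb{G})\to\mathrm{Pol}(\mathbb{G})$ be an admissible bijection, and put $S_\alpha:=S\circ\alpha$. Then every quantum Lévy process on $\mathbb{G}$ whose generating functional $L:\mathrm{Pol}(\mathbb{G})\to\mathbb{C}$ is $S_\alpha$-invariant (i.e. $L\circ S_\alpha=L$) admits a decomposition into a maximal Gaussian part and a purely non-Gaussian part; that is, $L=L_G+L_R$, where $L_G,L_R:\mathrm{Pol}(\mathbb{G})\to\mathbb{C}$ are generating functionals whose associated cocycles are, respectively, Gaussian and purely non-Gaussian.
   Context: Inner products are linear in the second variable. $\mathrm{Pol}(\mathbb{G})$ is the Hopf $^*$-algebra spanned by the coefficients of finite-dimensional unitary representations of the compact quantum group $\mathbb{G}$ (in the sense of Woronowicz), with coproduct $\Delta$, counit $\epsilon$, antipode $S$; $K_1=\ker\epsilon$. Admissible bijection of a Hopf $^*$-algebra $\mathcal{A}$: a map $\alpha:\mathcal{A}\to\mathcal{A}$ such that (i) $\alpha$ is an algebra homomorphism; (ii) $\alpha\circ{}^*\circ\alpha\circ{}^*=\mathrm{id}$; (iii) $(\alpha\otimes\alpha)\circ\Delta=\Delta\circ\alpha$; (iv) the linear map $\mathrm{id}+\alpha$ is a bijection of $\mathcal{A}$; (v) the linear map $\mathrm{id}\otimes\mathrm{id}+\alpha\otimes\alpha$ is a bijection of $\mathcal{A}\otimes\mathcal{A}$. Generating functional: a linear functional $L:\mathrm{Pol}(\mathbb{G})\to\mathbb{C}$ with $L(a^*a)\ge0$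 for $a\in K_1$, $L(b^* )=\overline{L(b)}$ for all $b$, and $L(1)=0$. Stochastic equivalence classes of quantum Lévy processes on $\mathbb{G}$ are in one-to-one correspondence with generating functionals on $\mathrm{Pol}(\mathbb{G})$; the decomposition property in the claim is by definition a property of the generating functional. Cocycle: a linear map $\eta:\mathrm{Pol}(\mathbb{G})\to\mathsf{H}$ into a Hilbert space, with dense range, for which there is a unital $^*$-homomorphism $\pi:\mathrm{Pol}(\mathbb{G})\to B(\mathsf{H})$ with $\eta(ab)=\pi(a)\eta(b)+\eta(a)\epsilon(b)$ for all $a,b$. The cocycle associated to a generating functional $L$ is the cocycle $\eta$, unique up to unitary equivalence (it always exists, by a GNS-type construction of Schürmann), which satisfies $L(ab)=\epsilon(a)L(b)+L(a)\epsilon(b)+\langle\eta(a^* ),\eta(b)\rangle$ for all $a,b\in\mathrm{Pol}(\mathbb{G})$. A cocycle $\eta$ is Gaussian if $\eta(ab)=\epsilon(a)\eta(b)+\eta(a)\epsilon(b)$ for all $a,b$. A cocycle $\eta$ with associated representation $\pi$ on $\mathsf{H}$ is purely non-Gaussian if $\bigcap_{a\in\mathrm{Pol}(\mathbb{G})}\ker(\pi(a)-\epsilon(a)I_{\mathsf{H}})=\{0\}$. *)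

theory Defs
  imports "HOL-Analysis.Analysis" "HOL-Library.Function_Algebras" "HOL-Library.Nonpos_Ints"
begin

text \<open>The real structure comes from the library classes; \<open>scaleR_scaleC\<close> makes it the restriction
  of the complex one. The class \<open>real_normed_algebra_1\<close> excludes the zero algebra.\<close>

class cstar_algebra = banach + real_normed_algebra_1 +
  fixes scaleC :: "complex \<Rightarrow> 'a \<Rightarrow> 'a" (infixr "*\<^sub>C" 75)
    and adj :: "'a \<Rightarrow> 'a"
  assumes scaleC_add_right: "c *\<^sub>C (x + y) = c *\<^sub>C x + c *\<^sub>C y"
    and scaleC_add_left: "(c + d) *\<^sub>C x = c *\<^sub>C x + d *\<^sub>C x"
    and scaleC_scaleC: "c *\<^sub>C (d *\<^sub>C x) = (c * d) *\<^sub>C x"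
    and scaleR_scaleC: "r *\<^sub>R x = complex_of_real r *\<^sub>C x"
    and scaleC_mult_left: "(c *\<^sub>C x) * y = c *\<^sub>C (x * y)"
    and scaleC_mult_right: "x * (c *\<^sub>C y) = c *\<^sub>C (x * y)"
    and norm_scaleC: "norm (c *\<^sub>C x) = cmod c * norm x"
    and adj_adj: "adj (adj x) = x"
    and adj_add: "adj (x + y) = adj x + adj y"
    and adj_scaleC: "adj (c *\<^sub>C x) = cnj c *\<^sub>C adj x"
    and adj_mult: "adj (x * y) = adj y * adj x"
    and cstar_identity: "norm (adj x * x) = (norm x)\<^sup>2"

lemma vector_space_scaleC: "vector_space (scaleC :: complex \<Rightarrow> 'a \<Rightarrow> 'a::cstar_algebra)"
proof
  fix c d :: complex and x y :: 'a
  show "c *\<^sub>C (x + y) = c *\<^sub>C x + c *\<^sub>C y" by (rule scaleC_add_right)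
  show "(c + d) *\<^sub>C x = c *\<^sub>C x + d *\<^sub>C x" by (rule scaleC_add_left)
  show "c *\<^sub>C d *\<^sub>C x = (c * d) *\<^sub>C x" by (rule scaleC_scaleC)
  show "1 *\<^sub>C x = x" using scaleR_scaleC[of 1 x] by simp
qed

abbreviation cspan :: "'a::cstar_algebra set \<Rightarrow> 'a set" where
  "cspan \<equiv> module.span scaleC"

abbreviation cindependent :: "'a::cstar_algebra set \<Rightarrow> bool" where
  "cindependent B \<equiv> \<not> module.dependent scaleC B"

definition clinear_on ::
  "'v set \<Rightarrow> (complex \<Rightarrow> 'v \<Rightarrow> 'v) \<Rightarrow> (complex \<Rightarrow> 'w \<Rightarrow> 'w) \<Rightarrow> ('v::plus \<Rightarrow> 'w::plus) \<Rightarrow> bool" where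
  "clinear_on V sv sw f \<longleftrightarrow>
     (\<forall>x\<in>V. \<forall>y\<in>V. f (x + y) = f x + f y) \<and> (\<forall>c. \<forall>x\<in>V. f (sv c x) = sw c (f x))"

definition star_hom :: "('a::cstar_algebra \<Rightarrow> 'b::cstar_algebra) \<Rightarrow> bool" where
  "star_hom f \<longleftrightarrow> clinear_on UNIV scaleC scaleC f \<and>
     (\<forall>x y. f (x * y) = f x * f y) \<and> (\<forall>x. f (adj x) = adj (f x)) \<and> f 1 = 1"

text \<open>In a vector space containing an algebraic tensor product \<open>A \<odot> B\<close> with canonical map \<open>t\<close>, the
  subspace \<open>P \<odot> Q\<close> is \<open>alg_tensor t P Q\<close>, and \<open>tensor_lift t P Q f\<close> is the linear map on it induced
  by the bilinear map \<open>f\<close> on \<open>P \<times> Q\<close>, i.e. \<open>\<Sum> u\<^sub>i \<otimes> v\<^sub>i \<mapsto> \<Sum> f u\<^sub>i v\<^sub>i\<close>.\<close>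

definition alg_tensor :: "('a \<Rightarrow> 'b \<Rightarrow> 'c::cstar_algebra) \<Rightarrow> 'a set \<Rightarrow> 'b set \<Rightarrow> 'c set" where
  "alg_tensor t P Q = cspan {t a b | a b. a \<in> P \<and> b \<in> Q}"

definition tensor_lift ::
  "('a \<Rightarrow> 'b \<Rightarrow> 'c::comm_monoid_add) \<Rightarrow> 'a set \<Rightarrow> 'b set \<Rightarrow> ('a \<Rightarrow> 'b \<Rightarrow> 'd::comm_monoid_add) \<Rightarrow> 'c \<Rightarrow> 'd" where
  "tensor_lift t P Q f x = (THE y. \<exists>(n::nat) u v. (\<forall>i<n. u i \<in> P \<and> v i \<in> Q) \<and>
     x = (\<Sum>i<n. t (u i) (v i)) \<and> y = (\<Sum>i<n. f (u i) (v i)))"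

definition cstar_norm_on :: "'c::cstar_algebra set \<Rightarrow> ('c \<Rightarrow> real) \<Rightarrow> bool" where
  "cstar_norm_on T N \<longleftrightarrow>
     (\<forall>x\<in>T. 0 \<le> N x \<and> (N x = 0 \<longrightarrow> x = 0)) \<and>
     (\<forall>c. \<forall>x\<in>T. N (c *\<^sub>C x) = cmod c * N x) \<and>
     (\<forall>x\<in>T. \<forall>y\<in>T. N (x + y) \<le> N x + N y \<and> N (x * y) \<le> N x * N y) \<and>
     (\<forall>x\<in>T. N (adj x * x) = (N x)\<^sup>2)"

text \<open>The whole type \<open>'c\<close> is the minimal C*-tensor product of \<open>'a\<close> and \<open>'b\<close>: the completion of the
  algebraic tensor product (condition \<open>faithful\<close> says that \<open>t\<close> induces an injective map on it) in its
  least C*-norm, which by a theorem of Takesaki is the spatial norm.\<close>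

locale minimal_tensor_product =
  fixes t :: "'a::cstar_algebra \<Rightarrow> 'b::cstar_algebra \<Rightarrow> 'c::cstar_algebra"
  assumes linear_left: "clinear_on UNIV scaleC scaleC (\<lambda>a. t a b)"
    and linear_right: "clinear_on UNIV scaleC scaleC (t a)"
    and faithful: "\<lbrakk>finite B; cindependent B; (\<Sum>b\<in>B. t (g b) b) = 0; b \<in> B\<rbrakk> \<Longrightarrow> g b = 0"
    and tensor_one: "t 1 1 = 1"
    and tensor_mult: "t a b * t a' b' = t (a * a') (b * b')"
    and tensor_adj: "adj (t a b) = t (adj a) (adj b)"
    and dense: "closure (alg_tensor t UNIV UNIV) = UNIV"
    and minimal: "\<lbrakk>cstar_norm_on (alg_tensor t UNIV UNIV) N; x \<in> alg_tensor t UNIV UNIV\<rbrakk> \<Longrightarrow> norm x \<le> N x"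

text \<open>Woronowicz's definition. The type \<open>'a\<close> is the C*-algebra \<open>A\<close>, \<open>'b\<close> is \<open>A \<otimes> A\<close> and \<open>'c\<close> is
  \<open>A \<otimes> A \<otimes> A\<close>, the latter given with both bracketings. In \<open>coassoc\<close> the maps \<open>\<Phi>\<close> and \<open>\<Psi>\<close> are
  \<open>\<Delta> \<otimes> id\<close> and \<open>id \<otimes> \<Delta>\<close>; they are unique because *-homomorphisms are continuous.\<close>

locale compact_quantum_group =
  t: minimal_tensor_product t + tl: minimal_tensor_product tl + tr: minimal_tensor_product tr
  for t :: "'a::cstar_algebra \<Rightarrow> 'a \<Rightarrow> 'b::cstar_algebra"
    and tl :: "'b \<Rightarrow> 'a \<Rightarrow> 'c::cstar_algebra"
    and tr :: "'a \<Rightarrow> 'b \<Rightarrow> 'c" +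
  fixes \<Delta> :: "'a \<Rightarrow> 'b"
  assumes tensor_assoc: "tl (t a b) c = tr a (t b c)"
    and star_hom_comult: "star_hom \<Delta>"
    and coassoc: "\<exists>\<Phi> \<Psi>. star_hom \<Phi> \<and> star_hom \<Psi> \<and>
      (\<forall>a b. \<Phi> (t a b) = tl (\<Delta> a) b) \<and> (\<forall>a b. \<Psi> (t a b) = tr a (\<Delta> b)) \<and>
      (\<forall>a. \<Phi> (\<Delta> a) = \<Psi> (\<Delta> a))"
    and cancel_left: "closure (cspan {\<Delta> a * t b 1 | a b. True}) = UNIV"
    and cancel_right: "closure (cspan {\<Delta> a * t 1 b | a b. True}) = UNIV"

text \<open>An \<open>n\<close>-dimensional unitary representation is a unitary matrix \<open>(u\<^sub>i\<^sub>j)\<close> over \<open>A\<close> with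
  \<open>\<Delta>(u\<^sub>i\<^sub>j) = \<Sum>\<^sub>k u\<^sub>i\<^sub>k \<otimes> u\<^sub>k\<^sub>j\<close>; only entries with indices below \<open>n\<close> matter.\<close>

definition unitary_rep ::
  "('a::cstar_algebra \<Rightarrow> 'a \<Rightarrow> 'b::cstar_algebra) \<Rightarrow> ('a \<Rightarrow> 'b) \<Rightarrow> nat \<Rightarrow> (nat \<Rightarrow> nat \<Rightarrow> 'a) \<Rightarrow> bool" where
  "unitary_rep t \<Delta> n u \<longleftrightarrow> (\<forall>i<n. \<forall>j<n.
     \<Delta> (u i j) = (\<Sum>k<n. t (u i k) (u k j)) \<and>
     (\<Sum>k<n. u i k * adj (u j k)) = of_bool (i = j) \<and>
     (\<Sum>k<n. adj (u k i) * u k j) = of_bool (i = j))"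

definition Pol ::
  "('a::cstar_algebra \<Rightarrow> 'a \<Rightarrow> 'b::cstar_algebra) \<Rightarrow> ('a \<Rightarrow> 'b) \<Rightarrow> 'a set" where
  "Pol t \<Delta> = cspan {u i j | u i j n. unitary_rep t \<Delta> n u \<and> i < n \<and> j < n}"

text \<open>Hopf *-algebra structure on a subspace \<open>P\<close> of the C*-algebra of a compact quantum group, with
  the restricted operations. That \<open>\<Delta>\<close> is a coassociative unital *-homomorphism is part of
  \<open>compact_quantum_group\<close>.\<close>

definition counit_on ::
  "('a::cstar_algebra \<Rightarrow> 'a \<Rightarrow> 'b::cstar_algebra) \<Rightarrow> ('a \<Rightarrow> 'b) \<Rightarrow> 'a set \<Rightarrow> ('a \<Rightarrow> complex) \<Rightarrow> bool" where
  "counit_on t \<Delta> P \<epsilon> \<longleftrightarrow> clinear_on P scaleC (*) \<epsilon> \<and>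
     \<epsilon> 1 = 1 \<and> (\<forall>a\<in>P. \<forall>b\<in>P. \<epsilon> (a * b) = \<epsilon> a * \<epsilon> b) \<and> (\<forall>a\<in>P. \<epsilon> (adj a) = cnj (\<epsilon> a)) \<and>
     (\<forall>a\<in>P. tensor_lift t P P (\<lambda>x y. \<epsilon> x *\<^sub>C y) (\<Delta> a) = a \<and>
            tensor_lift t P P (\<lambda>x y. \<epsilon> y *\<^sub>C x) (\<Delta> a) = a)"

definition antipode_on ::
  "('a::cstar_algebra \<Rightarrow> 'a \<Rightarrow> 'b::cstar_algebra) \<Rightarrow> ('a \<Rightarrow> 'b) \<Rightarrow> 'a set \<Rightarrow> ('a \<Rightarrow> complex) \<Rightarrow> ('a \<Rightarrow> 'a) \<Rightarrow> bool" where
  "antipode_on t \<Delta> P \<epsilon> S \<longleftrightarrow> S ` P \<subseteq> P \<and> clinear_on P scaleC scaleC S \<and>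
     (\<forall>a\<in>P. tensor_lift t P P (\<lambda>x y. S x * y) (\<Delta> a) = \<epsilon> a *\<^sub>C 1 \<and>
            tensor_lift t P P (\<lambda>x y. x * S y) (\<Delta> a) = \<epsilon> a *\<^sub>C 1)"

definition hopf_star_algebra_on ::
  "('a::cstar_algebra \<Rightarrow> 'a \<Rightarrow> 'b::cstar_algebra) \<Rightarrow> ('a \<Rightarrow> 'b) \<Rightarrow> 'a set \<Rightarrow> ('a \<Rightarrow> complex) \<Rightarrow> ('a \<Rightarrow> 'a) \<Rightarrow> bool" where
  "hopf_star_algebra_on t \<Delta> P \<epsilon> S \<longleftrightarrow> module.subspace scaleC P \<and>
     1 \<in> P \<and> (\<forall>a\<in>P. \<forall>b\<in>P. a * b \<in> P) \<and> (\<forall>a\<in>P. adj a \<in> P) \<and>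
     \<Delta> ` P \<subseteq> alg_tensor t P P \<and> counit_on t \<Delta> P \<epsilon> \<and> antipode_on t \<Delta> P \<epsilon> S"

definition admissible_bijection ::
  "('a::cstar_algebra \<Rightarrow> 'a \<Rightarrow> 'b::cstar_algebra) \<Rightarrow> ('a \<Rightarrow> 'b) \<Rightarrow> 'a set \<Rightarrow> ('a \<Rightarrow> 'a) \<Rightarrow> bool" where
  "admissible_bijection t \<Delta> P \<alpha> \<longleftrightarrow>
     \<alpha> ` P \<subseteq> P \<and> clinear_on P scaleC scaleC \<alpha> \<and> (\<forall>a\<in>P. \<forall>b\<in>P. \<alpha> (a * b) = \<alpha> a * \<alpha> b) \<and>
     (\<forall>a\<in>P. \<alpha> (adj (\<alpha> (adj a))) = a) \<and>
     (\<forall>a\<in>P. tensor_lift t P P (\<lambda>x y. t (\<alpha> x) (\<alpha> y)) (\<Delta> a) = \<Delta> (\<alpha> a)) \<and>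
     bij_betw (\<lambda>a. a + \<alpha> a) P P \<and>
     bij_betw (\<lambda>x. x + tensor_lift t P P (\<lambda>x y. t (\<alpha> x) (\<alpha> y)) x) (alg_tensor t P P) (alg_tensor t P P)"

definition generating_functional ::
  "'a::cstar_algebra set \<Rightarrow> ('a \<Rightarrow> complex) \<Rightarrow> ('a \<Rightarrow> complex) \<Rightarrow> bool" where
  "generating_functional P \<epsilon> L \<longleftrightarrow> clinear_on P scaleC (*) L \<and>
     (\<forall>a\<in>P. \<epsilon> a = 0 \<longrightarrow> L (adj a * a) \<in> \<real>\<^sub>\<ge>\<^sub>0) \<and>
     (\<forall>b\<in>P. L (adj b) = cnj (L b)) \<and> L 1 = 0"

text \<open>A complex Hilbert space carried by a subspace \<open>H\<close> of an ambient vector space, with inner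
  product linear in the second variable.\<close>

locale complex_hilbert_space = vector_space sc
  for sc :: "complex \<Rightarrow> 'h::ab_group_add \<Rightarrow> 'h" +
  fixes H :: "'h set" and ip :: "'h \<Rightarrow> 'h \<Rightarrow> complex"
  assumes subspace_carrier: "subspace H"
    and ip_add_right: "\<lbrakk>x \<in> H; y \<in> H; z \<in> H\<rbrakk> \<Longrightarrow> ip x (y + z) = ip x y + ip x z"
    and ip_scale_right: "\<lbrakk>x \<in> H; y \<in> H\<rbrakk> \<Longrightarrow> ip x (sc c y) = c * ip x y"
    and ip_commute: "\<lbrakk>x \<in> H; y \<in> H\<rbrakk> \<Longrightarrow> ip y x = cnj (ip x y)"
    and ip_pos: "\<lbrakk>x \<in> H; x \<noteq> 0\<rbrakk> \<Longrightarrow> 0 < Re (ip x x)"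
    and complete: "\<lbrakk>\<And>n. X n \<in> H; \<forall>e>0. \<exists>M. \<forall>m\<ge>M. \<forall>n\<ge>M. sqrt (Re (ip (X m - X n) (X m - X n))) < e\<rbrakk>
      \<Longrightarrow> \<exists>x\<in>H. (\<lambda>n. sqrt (Re (ip (X n - x) (X n - x)))) \<longlonglongrightarrow> 0"

definition bounded_operator_on ::
  "(complex \<Rightarrow> 'h::ab_group_add \<Rightarrow> 'h) \<Rightarrow> 'h set \<Rightarrow> ('h \<Rightarrow> 'h \<Rightarrow> complex) \<Rightarrow> ('h \<Rightarrow> 'h) \<Rightarrow> bool" where
  "bounded_operator_on sc H ip T \<longleftrightarrow> T ` H \<subseteq> H \<and> clinear_on H sc sc T \<and>
     (\<exists>K. \<forall>x\<in>H. sqrt (Re (ip (T x) (T x))) \<le> K * sqrt (Re (ip x x)))"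

text \<open>Operators are identified when they agree on \<open>H\<close>.\<close>

definition star_rep_on ::
  "'a::cstar_algebra set \<Rightarrow> (complex \<Rightarrow> 'h::ab_group_add \<Rightarrow> 'h) \<Rightarrow> 'h set \<Rightarrow> ('h \<Rightarrow> 'h \<Rightarrow> complex) \<Rightarrow>
   ('a \<Rightarrow> 'h \<Rightarrow> 'h) \<Rightarrow> bool" where
  "star_rep_on P sc H ip \<pi> \<longleftrightarrow>
     (\<forall>a\<in>P. bounded_operator_on sc H ip (\<pi> a)) \<and>
     (\<forall>x\<in>H. clinear_on P scaleC sc (\<lambda>a. \<pi> a x)) \<and>
     (\<forall>a\<in>P. \<forall>b\<in>P. \<forall>x\<in>H. \<pi> (a * b) x = \<pi> a (\<pi> b x)) \<and>
     (\<forall>x\<in>H. \<pi> 1 x = x) \<and>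
     (\<forall>a\<in>P. \<forall>x\<in>H. \<forall>y\<in>H. ip (\<pi> (adj a) x) y = ip x (\<pi> a y))"

text \<open>Since \<open>\<eta>\<close> has dense range, \<open>\<pi>\<close> is determined on \<open>H\<close> by \<open>\<eta>\<close>.\<close>

definition cocycle ::
  "'a::cstar_algebra set \<Rightarrow> ('a \<Rightarrow> complex) \<Rightarrow> (complex \<Rightarrow> 'h::ab_group_add \<Rightarrow> 'h) \<Rightarrow> 'h set \<Rightarrow>
   ('h \<Rightarrow> 'h \<Rightarrow> complex) \<Rightarrow> ('a \<Rightarrow> 'h \<Rightarrow> 'h) \<Rightarrow> ('a \<Rightarrow> 'h) \<Rightarrow> bool" where
  "cocycle P \<epsilon> sc H ip \<pi> \<eta> \<longleftrightarrow>
     complex_hilbert_space sc H ip \<and> star_rep_on P sc H ip \<pi> \<and>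
     \<eta> ` P \<subseteq> H \<and> clinear_on P scaleC sc \<eta> \<and>
     (\<forall>x\<in>H. \<forall>e>0. \<exists>a\<in>P. sqrt (Re (ip (x - \<eta> a) (x - \<eta> a))) < e) \<and>
     (\<forall>a\<in>P. \<forall>b\<in>P. \<eta> (a * b) = \<pi> a (\<eta> b) + sc (\<epsilon> b) (\<eta> a))"

definition associated_cocycle ::
  "'a::cstar_algebra set \<Rightarrow> ('a \<Rightarrow> complex) \<Rightarrow> ('a \<Rightarrow> complex) \<Rightarrow> (complex \<Rightarrow> 'h::ab_group_add \<Rightarrow> 'h) \<Rightarrow>
   'h set \<Rightarrow> ('h \<Rightarrow> 'h \<Rightarrow> complex) \<Rightarrow> ('a \<Rightarrow> 'h \<Rightarrow> 'h) \<Rightarrow> ('a \<Rightarrow> 'h) \<Rightarrow> bool" where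
  "associated_cocycle P \<epsilon> L sc H ip \<pi> \<eta> \<longleftrightarrow> cocycle P \<epsilon> sc H ip \<pi> \<eta> \<and>
     (\<forall>a\<in>P. \<forall>b\<in>P. L (a * b) = \<epsilon> a * L b + L a * \<epsilon> b + ip (\<eta> (adj a)) (\<eta> b))"

definition gaussian ::
  "'a::cstar_algebra set \<Rightarrow> ('a \<Rightarrow> complex) \<Rightarrow> (complex \<Rightarrow> 'h::ab_group_add \<Rightarrow> 'h) \<Rightarrow> ('a \<Rightarrow> 'h) \<Rightarrow> bool" where
  "gaussian P \<epsilon> sc \<eta> \<longleftrightarrow>
     (\<forall>a\<in>P. \<forall>b\<in>P. \<eta> (a * b) = sc (\<epsilon> a) (\<eta> b) + sc (\<epsilon> b) (\<eta> a))"

definition purely_non_gaussian ::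
  "'a::cstar_algebra set \<Rightarrow> ('a \<Rightarrow> complex) \<Rightarrow> (complex \<Rightarrow> 'h::ab_group_add \<Rightarrow> 'h) \<Rightarrow> 'h set \<Rightarrow>
   ('a \<Rightarrow> 'h \<Rightarrow> 'h) \<Rightarrow> bool" where
  "purely_non_gaussian P \<epsilon> sc H \<pi> \<longleftrightarrow>
     {x \<in> H. \<forall>a\<in>P. \<pi> a x - sc (\<epsilon> a) x = 0} = {0}"

text \<open>The associated cocycle is unique up to unitary equivalence and always exists, so its properties
  are expressed through one realization. HOL cannot quantify over the type of the Hilbert space;
  realizing it inside the functions \<open>'a \<Rightarrow> complex\<close> (with pointwise operations, but arbitrary inner
  product) loses nothing, since \<open>x \<mapsto> (a \<mapsto> \<langle>\<eta> a, x\<rangle>)\<close> embeds \<open>H\<close> linearly there when \<open>\<eta>\<close> has dense range.\<close>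

definition fun_scale :: "complex \<Rightarrow> ('a \<Rightarrow> complex) \<Rightarrow> 'a \<Rightarrow> complex" where
  "fun_scale c f = (\<lambda>x. c * f x)"

definition has_gaussian_cocycle ::
  "'a::cstar_algebra set \<Rightarrow> ('a \<Rightarrow> complex) \<Rightarrow> ('a \<Rightarrow> complex) \<Rightarrow> bool" where
  "has_gaussian_cocycle P \<epsilon> L \<longleftrightarrow>
     (\<exists>(H :: ('a \<Rightarrow> complex) set) ip \<pi> \<eta>.
        associated_cocycle P \<epsilon> L fun_scale H ip \<pi> \<eta> \<and> gaussian P \<epsilon> fun_scale \<eta>)"

definition has_purely_non_gaussian_cocycle ::
  "'a::cstar_algebra set \<Rightarrow> ('a \<Rightarrow> complex) \<Rightarrow> ('a \<Rightarrow> complex) \<Rightarrow> bool" where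
  "has_purely_non_gaussian_cocycle P \<epsilon> L \<longleftrightarrow>
     (\<exists>(H :: ('a \<Rightarrow> complex) set) ip \<pi> \<eta>.
        associated_cocycle P \<epsilon> L fun_scale H ip \<pi> \<eta> \<and> purely_non_gaussian P \<epsilon> fun_scale H \<pi>)"

end

theory Submission
  imports Defs
begin

text \<open>The cocycle \<open>\<eta>\<close> of \<open>L\<close> splits along \<open>H = G \<oplus> R\<close>, where \<open>G\<close> is the space of vectors on which the
  representation is given by the counit and \<open>R\<close> is the closure of \<open>\<eta>(K\<^sub>1 K\<^sub>1)\<close>. The difficulty is to find
  \<open>L\<^sub>G\<close>, i.e. to show that \<open>c\<^sub>G(a, b) = \<langle>\<eta>\<^sub>G(a\<^sup>*), \<eta>\<^sub>G(b)\<rangle>\<close> is a 2-coboundary. Since \<open>c\<^sub>G\<close> is a derivation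
  at the counit in each variable, \<open>L\<^sub>G = c\<^sub>G \<circ> \<Delta> / 2\<close> does it as soon as \<open>c\<^sub>G\<close> is symmetric.

  Let \<open>\<sigma> = S \<circ> \<alpha>\<close>. Invariance of \<open>L\<close> says \<open>c(\<sigma> b, \<sigma> a) = c(a, b)\<close> for the full cocycle. If this passes to the
  Gaussian part, then \<open>c\<^sub>G(\<alpha> b, \<alpha> a) = c\<^sub>G(a, b)\<close>, because \<open>\<eta>\<^sub>G \<circ> S = - \<eta>\<^sub>G\<close>; the antisymmetric part of \<open>c\<^sub>G\<close>
  then changes sign under \<open>\<alpha> \<otimes> \<alpha>\<close>, so it vanishes on the range of \<open>id \<otimes> id + \<alpha> \<otimes> \<alpha>\<close>, which is everything.

  On \<open>\<eta>(K\<^sub>1)\<close> the map \<open>\<sigma>\<^sup>2\<close> induces a positive, in general unbounded, operator preserving \<open>\<eta>(K\<^sub>1 K\<^sub>1)\<close>, and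
  passing to the Gaussian part amounts to its commuting with the projection onto \<open>R\<close>. This holds because
  \<open>\<sigma>\<^sup>2\<close> maps the coefficient space of every unitary representation into itself, so that \<open>1 + \<sigma>\<^sup>2\<close> is onto on
  \<open>\<eta>(K\<^sub>1 K\<^sub>1)\<close>.\<close>

text \<open>On K_1 put J a = adj (\<sigma> a), an antilinear involution. Invariance becomes
  <\<eta>(J b), \<eta>(J a)> = <\<eta>(\<sigma>(\<sigma> a)), \<eta>(b)>: the square of \<sigma>
  acts like J* J, hence its positivity. The obstacle is that J may be discontinuous. If \<eta>(w),
  with w in the span of K_1 K_1, is close to the R-part of \<eta>(b), nothing follows for \<eta>(J
  w); and an unbounded symmetric operator that preserves a subspace need not commute with the
  projection onto its closure. The way out is to approximate T b instead of b, where T is the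
  identity plus the square of \<sigma>, and to pull the approximants back through T: the norm of
  \<eta>(T w) dominates those of \<eta>(w) and of \<eta>(J w). The pull-back has to stay in the span
  of K_1 K_1, so T is inverted, modulo null vectors, on finite-dimensional invariant subspaces of
  it.

  The factor 1/2 comes from c_G applied to \<Delta>(a b), which contains, besides two terms with the
  counit, the cross terms c_G(a, b) and c_G(b, a); for symmetric c_G they add up to 2 c_G(a,
  b).\<close>

interpretation cs: vector_space "scaleC :: complex \<Rightarrow> 'a \<Rightarrow> 'a::cstar_algebra"
  by (rule vector_space_scaleC)

interpretation fs: vector_space "fun_scale :: complex \<Rightarrow> ('i \<Rightarrow> complex) \<Rightarrow> 'i \<Rightarrow> complex"
  by unfold_locales (auto simp: fun_scale_def fun_eq_iff algebra_simps)

lemma vector_space_times: "vector_space ((*) :: complex \<Rightarrow> complex \<Rightarrow> complex)"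
  by unfold_locales (auto simp: algebra_simps)

lemma sum_function_apply: "(\<Sum>i\<in>I. f i) x = (\<Sum>i\<in>I. f i x :: 'b::comm_monoid_add)"
  by (induction I rule: infinite_finite_induct) auto

lemma adj_zero [simp]: "adj (0::'a::cstar_algebra) = 0"
  using adj_add[of "0::'a" 0] by simp

lemma adj_one [simp]: "adj (1::'a::cstar_algebra) = 1"
  by (metis adj_adj adj_mult mult.right_neutral mult_1)

lemma adj_diff: "adj (x - y) = adj x - adj (y::'a::cstar_algebra)"
  by (metis adj_add diff_add_cancel eq_diff_eq)

lemma adj_sum: "adj (\<Sum>i\<in>I. f i) = (\<Sum>i\<in>I. adj (f i :: 'a::cstar_algebra))"
  by (induction I rule: infinite_finite_induct) (auto simp: adj_add)

section \<open>Linear maps on subspaces\<close>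

lemma clinear_onI:
  assumes "\<And>x y. x \<in> V \<Longrightarrow> y \<in> V \<Longrightarrow> f (x + y) = f x + f y"
    and "\<And>c x. x \<in> V \<Longrightarrow> f (sv c x) = sw c (f x)"
  shows "clinear_on V sv sw f"
  using assms by (auto simp: clinear_on_def)

lemma clinear_on_add: "clinear_on V sv sw f \<Longrightarrow> x \<in> V \<Longrightarrow> y \<in> V \<Longrightarrow> f (x + y) = f x + f y"
  by (auto simp: clinear_on_def)

lemma clinear_on_scale: "clinear_on V sv sw f \<Longrightarrow> x \<in> V \<Longrightarrow> f (sv c x) = sw c (f x)"
  by (auto simp: clinear_on_def)

lemma clinear_on_subset: "clinear_on V sv sw f \<Longrightarrow> W \<subseteq> V \<Longrightarrow> clinear_on W sv sw f"
  unfolding clinear_on_def by blast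

text \<open>The counit, the antipode, \<open>\<alpha>\<close>, the functionals and the cocycles are
  constrained only on Pol and arbitrary elsewhere, so linearity is always taken relative to a
  subspace.\<close>

locale clinear_map_on = v: vector_space sv + w: vector_space sw
  for sv :: "complex \<Rightarrow> 'v::ab_group_add \<Rightarrow> 'v" and sw :: "complex \<Rightarrow> 'w::ab_group_add \<Rightarrow> 'w" +
  fixes V f
  assumes sub: "v.subspace V" and lin: "clinear_on V sv sw f"
begin

lemma zero: "f 0 = 0"
  using clinear_on_scale[OF lin v.subspace_0[OF sub], of 0] by simp

lemma minus: "x \<in> V \<Longrightarrow> f (- x) = - f x"
  using clinear_on_scale[OF lin, of x "-1"] by simp

lemma diff: "x \<in> V \<Longrightarrow> y \<in> V \<Longrightarrow> f (x - y) = f x - f y"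
  using clinear_on_add[OF lin, of x "- y"] minus v.subspace_neg[OF sub] by simp

lemma sum: "(\<And>i. i \<in> I \<Longrightarrow> g i \<in> V) \<Longrightarrow> f (\<Sum>i\<in>I. g i) = (\<Sum>i\<in>I. f (g i))"
  by (induction I rule: infinite_finite_induct)
    (auto simp: zero clinear_on_add[OF lin] v.subspace_sum[OF sub])

lemma image_subspace:
  assumes "v.subspace W" "W \<subseteq> V" shows "w.subspace (f ` W)"
  unfolding w.subspace_def
proof (intro conjI ballI allI)
  show "0 \<in> f ` W" using zero v.subspace_0[OF assms(1)] by (metis imageI)
  show "x + y \<in> f ` W" if "x \<in> f ` W" "y \<in> f ` W" for x y
    using that assms(2) clinear_on_add[OF lin] v.subspace_add[OF assms(1)]
    by (auto simp: image_iff subset_iff) metis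
  show "sw c x \<in> f ` W" if "x \<in> f ` W" for c x
    using that assms(2) clinear_on_scale[OF lin] v.subspace_scale[OF assms(1)]
    by (auto simp: image_iff subset_iff) metis
qed

lemma span_eq:
  assumes "clinear_on V sv sw g" "B \<subseteq> V" "\<And>x. x \<in> B \<Longrightarrow> f x = g x" "x \<in> v.span B"
  shows "f x = g x"
proof -
  interpret g: clinear_map_on sv sw V g by unfold_locales (use sub assms(1) in auto)
  have "v.span B \<subseteq> {x \<in> V. f x = g x}"
  proof (rule v.span_minimal)
    show "B \<subseteq> {x \<in> V. f x = g x}" using assms by auto
    show "v.subspace {x \<in> V. f x = g x}"
      unfolding v.subspace_def using sub v.subspace_add[OF sub] v.subspace_scale[OF sub]
      by (auto simp: zero g.zero v.subspace_0 clinear_on_add[OF lin] clinear_on_add[OF g.lin]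
          clinear_on_scale[OF lin] clinear_on_scale[OF g.lin])
  qed
  then show ?thesis using assms(4) by auto
qed

end

section \<open>Bilinear maps and the algebraic tensor product\<close>

definition cbilinear_on ::
  "(complex \<Rightarrow> 'd::plus \<Rightarrow> 'd) \<Rightarrow> 'a::cstar_algebra set \<Rightarrow> ('a \<Rightarrow> 'a \<Rightarrow> 'd) \<Rightarrow> bool" where
  "cbilinear_on sd V f \<longleftrightarrow>
     (\<forall>y\<in>V. clinear_on V scaleC sd (\<lambda>x. f x y)) \<and> (\<forall>x\<in>V. clinear_on V scaleC sd (f x))"

locale tensor_square = minimal_tensor_product t
  for t :: "'a::cstar_algebra \<Rightarrow> 'a \<Rightarrow> 'b::cstar_algebra" +
  fixes P :: "'a set"
  assumes subP: "cs.subspace P"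
begin

text \<open>Expanding the second legs in an independent subset of them regroups every bilinear sum
  over that subset, with first legs \<open>g v\<close> that do not depend on the bilinear map;
  \<open>faithful\<close> makes these zero. This is the well-definedness of
  \<open>tensor_lift\<close>.\<close>

lemma tensor_sum_zero:
  fixes sd :: "complex \<Rightarrow> 'd::ab_group_add \<Rightarrow> 'd"
  assumes "vector_space sd" and f: "cbilinear_on sd P f"
    and I: "finite I" "\<And>i. i \<in> I \<Longrightarrow> a i \<in> P" "\<And>i. i \<in> I \<Longrightarrow> b i \<in> P"
    and 0: "(\<Sum>i\<in>I. t (a i) (b i)) = 0"
  shows "(\<Sum>i\<in>I. f (a i) (b i)) = 0"
proof -
  interpret d: vector_space sd by fact
  obtain B where B: "B \<subseteq> b ` I" "cindependent B" "b ` I \<subseteq> cs.span B"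
    using cs.maximal_independent_subset[of "b ` I"] by blast
  have finB: "finite B" using B(1) I(1) finite_surj by blast
  have BP: "B \<subseteq> P" using B(1) I by auto
  have "\<exists>r. b i = (\<Sum>v\<in>B. r v *\<^sub>C v)" if "i \<in> I" for i
    using B(3) that unfolding cs.span_finite[OF finB] by (auto simp: image_subset_iff)
  then obtain r where r: "\<And>i. i \<in> I \<Longrightarrow> b i = (\<Sum>v\<in>B. r i v *\<^sub>C v)" by metis
  define g where "g v = (\<Sum>i\<in>I. r i v *\<^sub>C a i)" for v
  \<comment> \<open>An arbitrary target, so that the regrouping applies to \<open>t\<close> and to
    \<open>f\<close> with the same \<open>g\<close>.\<close>
  have gen: "(\<Sum>i\<in>I. h (a i) (b i)) = (\<Sum>v\<in>B. h (g v) v)"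
    if "vector_space se" "cbilinear_on se P h" for se :: "complex \<Rightarrow> 'e::ab_group_add \<Rightarrow> 'e" and h
  proof -
    interpret e: vector_space se by fact
    have l: "clinear_map_on scaleC se P (\<lambda>x. h x y)" if "y \<in> P" for y
      by unfold_locales (use subP that \<open>cbilinear_on se P h\<close> in \<open>auto simp: cbilinear_on_def\<close>)
    have rr: "clinear_map_on scaleC se P (h x)" if "x \<in> P" for x
      by unfold_locales (use subP that \<open>cbilinear_on se P h\<close> in \<open>auto simp: cbilinear_on_def\<close>)
    have "(\<Sum>i\<in>I. h (a i) (b i)) = (\<Sum>i\<in>I. \<Sum>v\<in>B. se (r i v) (h (a i) v))"
    proof (rule sum.cong[OF refl])
      fix i assume i: "i \<in> I"
      interpret r: clinear_map_on scaleC se P "h (a i)" using rr I i by blast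
      have "h (a i) (b i) = (\<Sum>v\<in>B. h (a i) (r i v *\<^sub>C v))"
        unfolding r[OF i] by (rule r.sum) (use BP subP cs.subspace_scale in blast)
      also have "\<dots> = (\<Sum>v\<in>B. se (r i v) (h (a i) v))"
        using BP by (intro sum.cong refl clinear_on_scale[OF r.lin]) auto
      finally show "h (a i) (b i) = (\<Sum>v\<in>B. se (r i v) (h (a i) v))" .
    qed
    also have "\<dots> = (\<Sum>v\<in>B. \<Sum>i\<in>I. se (r i v) (h (a i) v))" by (rule sum.swap)
    also have "\<dots> = (\<Sum>v\<in>B. h (g v) v)"
    proof (rule sum.cong[OF refl])
      fix v assume v: "v \<in> B"
      interpret l: clinear_map_on scaleC se P "\<lambda>x. h x v" using l BP v by blast
      have "h (g v) v = (\<Sum>i\<in>I. h (r i v *\<^sub>C a i) v)"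
        unfolding g_def by (rule l.sum) (use I subP cs.subspace_scale in blast)
      also have "\<dots> = (\<Sum>i\<in>I. se (r i v) (h (a i) v))"
        using I by (intro sum.cong refl clinear_on_scale[OF l.lin]) auto
      finally show "(\<Sum>i\<in>I. se (r i v) (h (a i) v)) = h (g v) v" ..
    qed
    finally show ?thesis .
  qed
  have bt: "cbilinear_on scaleC P t"
    unfolding cbilinear_on_def using clinear_on_subset[OF linear_left] clinear_on_subset[OF linear_right]
    by auto
  have "(\<Sum>v\<in>B. t (g v) v) = 0" using gen[OF vector_space_scaleC bt] 0 by simp
  then have g0: "g v = 0" if "v \<in> B" for v using faithful[OF finB B(2)] that by blast
  have "f 0 v = 0" if "v \<in> B" for v
  proof -
    interpret l: clinear_map_on scaleC sd P "\<lambda>x. f x v"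
      by unfold_locales (use subP f that BP in \<open>auto simp: cbilinear_on_def\<close>)
    show ?thesis by (rule l.zero)
  qed
  then show ?thesis using gen[OF assms(1) f] g0 by simp
qed

context
  fixes sd :: "complex \<Rightarrow> 'd::ab_group_add \<Rightarrow> 'd" and f
  assumes sd: "vector_space sd" and f: "cbilinear_on sd P f"
begin

lemma tensor_lift_sum_nat:
  assumes uv: "\<And>i. i < (n::nat) \<Longrightarrow> u i \<in> P" "\<And>i. i < n \<Longrightarrow> v i \<in> P"
  shows "tensor_lift t P P f (\<Sum>i<n. t (u i) (v i)) = (\<Sum>i<n. f (u i) (v i))"
  unfolding tensor_lift_def
proof (rule the_equality)
  show "\<exists>n' u' v'. (\<forall>i<n'. u' i \<in> P \<and> v' i \<in> P) \<and>
     (\<Sum>i<n. t (u i) (v i)) = (\<Sum>i<n'::nat. t (u' i) (v' i)) \<and>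
     (\<Sum>i<n. f (u i) (v i)) = (\<Sum>i<n'. f (u' i) (v' i))"
    using uv by blast
next
  fix y
  assume "\<exists>n' u' v'. (\<forall>i<n'. u' i \<in> P \<and> v' i \<in> P) \<and>
     (\<Sum>i<n. t (u i) (v i)) = (\<Sum>i<n'::nat. t (u' i) (v' i)) \<and> y = (\<Sum>i<n'. f (u' i) (v' i))"
  then obtain m u' v' where uv': "\<And>i. i < (m::nat) \<Longrightarrow> u' i \<in> P \<and> v' i \<in> P"
    and eq: "(\<Sum>i<n. t (u i) (v i)) = (\<Sum>i<m. t (u' i) (v' i))"
    and y: "y = (\<Sum>i<m. f (u' i) (v' i))" by blast
  interpret d: vector_space sd by (rule sd)
  \<comment> \<open>Two representations of one tensor are compared through a single vanishing sum
    over the disjoint union of their index sets, with the first legs of the second representation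
    negated.\<close>
  define a where "a = case_sum u (\<lambda>i. - u' i)"
  define b where "b = case_sum v v'"
  have tneg: "t (- x) y = - t x y" for x y
    using clinear_on_scale[OF linear_left, where c="-1" and x=x] by simp
  have fneg: "f (- x) y = - f x y" if "x \<in> P" "y \<in> P" for x y
    using f that clinear_on_scale[where f="\<lambda>x. f x y" and V=P and sv=scaleC and sw=sd and x=x and c="-1"]
    by (auto simp: cbilinear_on_def)
  have "(\<Sum>i\<in>{..<n} <+> {..<m}. f (a i) (b i)) = 0"
  proof (rule tensor_sum_zero[OF sd f])
    show "a i \<in> P" if "i \<in> {..<n} <+> {..<m}" for i
      using that uv uv' cs.subspace_neg[OF subP] by (auto simp: a_def)
    show "b i \<in> P" if "i \<in> {..<n} <+> {..<m}" for i
      using that uv uv' by (auto simp: b_def)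
    show "(\<Sum>i\<in>{..<n} <+> {..<m}. t (a i) (b i)) = 0"
      by (subst sum.Plus) (auto simp: a_def b_def tneg eq sum_negf)
  qed auto
  then show "y = (\<Sum>i<n. f (u i) (v i))"
    using uv' by (subst (asm) sum.Plus) (auto simp: a_def b_def fneg y sum_negf)
qed

lemma tensor_lift_sum:
  assumes I: "finite I" and uv: "\<And>i. i \<in> I \<Longrightarrow> u i \<in> P" "\<And>i. i \<in> I \<Longrightarrow> v i \<in> P"
  shows "tensor_lift t P P f (\<Sum>i\<in>I. t (u i) (v i)) = (\<Sum>i\<in>I. f (u i) (v i))"
proof -
  obtain h where h: "bij_betw h {..<card I} I"
    using ex_bij_betw_nat_finite[OF I] by (auto simp: atLeast0LessThan)
  have eq: "(\<Sum>i\<in>I. g i) = (\<Sum>i<card I. g (h i))" for g :: "_ \<Rightarrow> 'z::comm_monoid_add"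
    using sum.reindex_bij_betw[OF h, of g] by simp
  show ?thesis unfolding eq
    by (rule tensor_lift_sum_nat) (use h uv in \<open>auto simp: bij_betw_def\<close>)
qed

lemma tensor_lift_simple: "a \<in> P \<Longrightarrow> b \<in> P \<Longrightarrow> tensor_lift t P P f (t a b) = f a b"
  using tensor_lift_sum[of "{()}" "\<lambda>_. a" "\<lambda>_. b"] by simp

end

lemma alg_tensorE:
  assumes "x \<in> alg_tensor t P P"
  obtains n :: nat and u v where "\<And>i. i < n \<Longrightarrow> u i \<in> P" "\<And>i. i < n \<Longrightarrow> v i \<in> P"
    "x = (\<Sum>i<n. t (u i) (v i))"
proof -
  have tscale: "t (c *\<^sub>C a) b = c *\<^sub>C t a b" for c a b
    using clinear_on_scale[OF linear_left] by simp
  have "\<exists>(n::nat) u v. (\<forall>i<n. u i \<in> P \<and> v i \<in> P) \<and> x = (\<Sum>i<n. t (u i) (v i))"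
    using assms unfolding alg_tensor_def
  proof (induction rule: cs.span_induct_alt)
    case base
    then show ?case by (intro exI[of _ 0]) auto
  next
    case (step c x y)
    from step obtain a b where x: "x = t a b" "a \<in> P" "b \<in> P" by blast
    from step obtain n u v where *: "\<forall>i<n. u i \<in> P \<and> v i \<in> P" "y = (\<Sum>i<(n::nat). t (u i) (v i))"
      by blast
    have "(\<Sum>i<Suc n. t ((u(n := c *\<^sub>C a)) i) ((v(n := b)) i)) = y + c *\<^sub>C t a b"
      using tscale[of c a b] by (simp add: *)
    then show ?case using * x cs.subspace_scale[OF subP]
      by (intro exI[of _ "Suc n"] exI[of _ "u(n := c *\<^sub>C a)"] exI[of _ "v(n := b)"])
        (auto simp: add.commute)
  qed
  then show ?thesis using that by blast
qed

lemma tensor_lift_linear: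
  fixes sd :: "complex \<Rightarrow> 'd::ab_group_add \<Rightarrow> 'd"
  assumes sd: "vector_space sd" and f: "cbilinear_on sd P f"
  shows "clinear_on (alg_tensor t P P) scaleC sd (tensor_lift t P P f)"
proof (rule clinear_onI)
  interpret d: vector_space sd by (rule sd)
  fix x y assume xy: "x \<in> alg_tensor t P P" "y \<in> alg_tensor t P P"
  obtain n u v where 
    x: "\<And>i. i < (n::nat) \<Longrightarrow> u i \<in> P" "\<And>i. i < n \<Longrightarrow> v i \<in> P" "x = (\<Sum>i<n. t (u i) (v i))"
    using alg_tensorE[OF xy(1)] by blast
  obtain m u' v' where
    y: "\<And>i. i < (m::nat) \<Longrightarrow> u' i \<in> P" "\<And>i. i < m \<Longrightarrow> v' i \<in> P" "y = (\<Sum>i<m. t (u' i) (v' i))"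
    using alg_tensorE[OF xy(2)] by blast
  define a where "a = case_sum u u'"
  define b where "b = case_sum v v'"
  have "x + y = (\<Sum>i\<in>{..<n} <+> {..<m}. t (a i) (b i))"
    by (subst sum.Plus) (auto simp: a_def b_def x(3) y(3))
  then have "tensor_lift t P P f (x + y) = (\<Sum>i\<in>{..<n} <+> {..<m}. f (a i) (b i))"
    by (simp only:) (rule tensor_lift_sum[OF sd f], use x y in \<open>auto simp: a_def b_def\<close>)
  also have "\<dots> = tensor_lift t P P f x + tensor_lift t P P f y"
  proof -
    have "tensor_lift t P P f x = (\<Sum>i<n. f (u i) (v i))"
      unfolding x(3) by (rule tensor_lift_sum[OF sd f]) (use x in auto)
    moreover have "tensor_lift t P P f y = (\<Sum>i<m. f (u' i) (v' i))"
      unfolding y(3) by (rule tensor_lift_sum[OF sd f]) (use y in auto)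
    ultimately show ?thesis by (subst sum.Plus) (auto simp: a_def b_def)
  qed
  finally show "tensor_lift t P P f (x + y) = tensor_lift t P P f x + tensor_lift t P P f y" .
next
  interpret d: vector_space sd by (rule sd)
  fix c x assume cx: "x \<in> alg_tensor t P P"
  obtain n u v where 
    x: "\<And>i. i < (n::nat) \<Longrightarrow> u i \<in> P" "\<And>i. i < n \<Longrightarrow> v i \<in> P" "x = (\<Sum>i<n. t (u i) (v i))"
    using alg_tensorE[OF cx] by blast
  have "c *\<^sub>C x = (\<Sum>i<n. t (c *\<^sub>C u i) (v i))"
    unfolding x(3) cs.scale_sum_right using clinear_on_scale[OF linear_left] by simp
  then have "tensor_lift t P P f (c *\<^sub>C x) = (\<Sum>i<n. f (c *\<^sub>C u i) (v i))"
    by (simp only:) (rule tensor_lift_sum[OF sd f], use x cs.subspace_scale[OF subP] in auto)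
  also have "\<dots> = (\<Sum>i<n. sd c (f (u i) (v i)))"
    using f x by (intro sum.cong refl) (auto simp: cbilinear_on_def clinear_on_def)
  also have "\<dots> = sd c (tensor_lift t P P f x)"
  proof -
    have "tensor_lift t P P f x = (\<Sum>i<n. f (u i) (v i))"
      unfolding x(3) by (rule tensor_lift_sum[OF sd f]) (use x in auto)
    then show ?thesis by (simp add: d.scale_sum_right)
  qed
  finally show "tensor_lift t P P f (c *\<^sub>C x) = sd c (tensor_lift t P P f x)" .
qed

end

section \<open>Representation coefficients and the antipode\<close>

lemma scaleC_one_inject: "c *\<^sub>C (1::'a::cstar_algebra) = d *\<^sub>C 1 \<longleftrightarrow> c = d"
  using cs.scale_right_imp_eq[of "1::'a" c d] by auto

lemma sum_of_bool_right:
  fixes f :: "'i \<Rightarrow> 'a::semiring_1"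
  assumes "finite I" "j \<in> I"
  shows "(\<Sum>k\<in>I. f k * of_bool (k = j)) = f j"
    and "(\<Sum>k\<in>I. f k * of_bool (j = k)) = f j"
    and "(\<Sum>k\<in>I. of_bool (k = j) * f k) = f j"
    and "(\<Sum>k\<in>I. of_bool (j = k) * f k) = f j"
  using assms by (auto simp: of_bool_def if_distrib if_distribR cong: if_cong)

locale hopf_pol = tensor_square t P
  for t :: "'a::cstar_algebra \<Rightarrow> 'a \<Rightarrow> 'b::cstar_algebra" and P +
  fixes \<Delta> :: "'a \<Rightarrow> 'b" and \<epsilon> :: "'a \<Rightarrow> complex" and S :: "'a \<Rightarrow> 'a"
  assumes P_eq: "P = Pol t \<Delta>"
    and star_hom_comult: "star_hom \<Delta>"
    and hopf: "hopf_star_algebra_on t \<Delta> P \<epsilon> S"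
begin

lemma one_P: "1 \<in> P"
  and mult_P: "a \<in> P \<Longrightarrow> b \<in> P \<Longrightarrow> a * b \<in> P"
  and adj_P: "a \<in> P \<Longrightarrow> adj a \<in> P"
  and comult_P: "a \<in> P \<Longrightarrow> \<Delta> a \<in> alg_tensor t P P"
  using hopf unfolding hopf_star_algebra_on_def by blast+

lemmas zero_P = cs.subspace_0[OF subP]
  and add_P = cs.subspace_add[OF subP]
  and diff_P = cs.subspace_diff[OF subP]
  and scale_P = cs.subspace_scale[OF subP]
  and sum_P = cs.subspace_sum[OF subP]

lemma counit: "counit_on t \<Delta> P \<epsilon>" and antipode: "antipode_on t \<Delta> P \<epsilon> S"
  using hopf unfolding hopf_star_algebra_on_def by blast+

lemma counit_lin: "clinear_on P scaleC (*) \<epsilon>"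
  and counit_one: "\<epsilon> 1 = 1"
  and counit_mult: "a \<in> P \<Longrightarrow> b \<in> P \<Longrightarrow> \<epsilon> (a * b) = \<epsilon> a * \<epsilon> b"
  and counit_adj: "a \<in> P \<Longrightarrow> \<epsilon> (adj a) = cnj (\<epsilon> a)"
  and counit_left: "a \<in> P \<Longrightarrow> tensor_lift t P P (\<lambda>x y. \<epsilon> x *\<^sub>C y) (\<Delta> a) = a"
  and counit_right: "a \<in> P \<Longrightarrow> tensor_lift t P P (\<lambda>x y. \<epsilon> y *\<^sub>C x) (\<Delta> a) = a"
  using counit unfolding counit_on_def by blast+

lemma antipode_P: "a \<in> P \<Longrightarrow> S a \<in> P"
  and antipode_lin: "clinear_on P scaleC scaleC S"
  and antipode_left: "a \<in> P \<Longrightarrow> tensor_lift t P P (\<lambda>x y. S x * y) (\<Delta> a) = \<epsilon> a *\<^sub>C 1"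
  using antipode unfolding antipode_on_def by blast+

sublocale counit: clinear_map_on scaleC "(*)" P \<epsilon>
  by unfold_locales (use subP counit_lin in auto)

sublocale antipode: clinear_map_on scaleC scaleC P S
  by unfold_locales (use subP antipode_lin in auto)

lemmas counit_add = clinear_on_add[OF counit_lin]
  and counit_scale = clinear_on_scale[OF counit_lin]
  and antipode_add = clinear_on_add[OF antipode_lin]
  and antipode_scale = clinear_on_scale[OF antipode_lin]

lemma comult_lin: "clinear_on UNIV scaleC scaleC \<Delta>"
  and comult_mult: "\<Delta> (a * b) = \<Delta> a * \<Delta> b"
  and comult_adj: "\<Delta> (adj a) = adj (\<Delta> a)"
  using star_hom_comult unfolding star_hom_def by blast+

lemma comult_linP: "clinear_on P scaleC scaleC \<Delta>"
  using clinear_on_subset[OF comult_lin] by blast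

text \<open>Matrix corepresentations without unitarity: the entrywise adjoint of a unitary one and
  its image under \<open>\<alpha>\<close> are in general no more than this. The index type is free
  so that products can be indexed by pairs.\<close>

definition corep :: "'i set \<Rightarrow> ('i \<Rightarrow> 'i \<Rightarrow> 'a) \<Rightarrow> bool" where
  "corep I v \<longleftrightarrow> finite I \<and> (\<forall>i\<in>I. \<forall>j\<in>I. v i j \<in> P \<and> \<Delta> (v i j) = (\<Sum>k\<in>I. t (v i k) (v k j)))"

lemma corepD:
  assumes "corep I v" "i \<in> I" "j \<in> I"
  shows "v i j \<in> P" "\<Delta> (v i j) = (\<Sum>k\<in>I. t (v i k) (v k j))"
  using assms unfolding corep_def by blast+

lemma tensor_lift_corep:
  fixes sd :: "complex \<Rightarrow> 'd::ab_group_add \<Rightarrow> 'd"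
  assumes "vector_space sd" "cbilinear_on sd P f" "corep I v" "i \<in> I" "j \<in> I"
  shows "tensor_lift t P P f (\<Delta> (v i j)) = (\<Sum>k\<in>I. f (v i k) (v k j))"
  unfolding corepD(2)[OF assms(3-5)]
  by (rule tensor_lift_sum[OF assms(1,2)]) (use assms(3-5) in \<open>auto simp: corep_def\<close>)

lemma bilinear_counit: "cbilinear_on scaleC P (\<lambda>x y. \<epsilon> x *\<^sub>C y)"
  unfolding cbilinear_on_def clinear_on_def
  by (auto simp: counit_add counit_scale scaleC_add_left scaleC_add_right scaleC_scaleC mult.commute)

lemma bilinear_antipode: "cbilinear_on scaleC P (\<lambda>x y. S x * y)"
  unfolding cbilinear_on_def clinear_on_def
  by (auto simp: antipode_add antipode_scale scaleC_mult_left scaleC_mult_right algebra_simps)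

text \<open>A right inverse w determines both maps: the counit law \<epsilon>(v) v = v, multiplied
  by w, gives \<epsilon>(v) = 1, and then S(v) v = \<epsilon>(v) = 1, multiplied by w, gives S(v) =
  w.\<close>

lemma corep_inverse:
  assumes v: "corep I v" and ij: "i \<in> I" "j \<in> I"
    and inv: "\<And>i j. i \<in> I \<Longrightarrow> j \<in> I \<Longrightarrow> (\<Sum>k\<in>I. v i k * w k j) = of_bool (i = j)"
  shows "\<epsilon> (v i j) = of_bool (i = j)" and "S (v i j) = w i j"
proof -
  have fin: "finite I" using v by (simp add: corep_def)
  have eps: "\<epsilon> (v i j) = of_bool (i = j)" if "i \<in> I" "j \<in> I" for i j
  proof -
    have "\<epsilon> (v i j) *\<^sub>C 1 = (\<Sum>k\<in>I. \<epsilon> (v i k) *\<^sub>C 1 * of_bool (k = j))"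
      by (rule sum_of_bool_right(1)[OF fin that(2), symmetric])
    also have "\<dots> = (\<Sum>k\<in>I. \<epsilon> (v i k) *\<^sub>C (\<Sum>l\<in>I. v k l * w l j))"
      using that by (intro sum.cong refl) (simp add: scaleC_mult_left inv)
    also have "\<dots> = (\<Sum>k\<in>I. \<Sum>l\<in>I. \<epsilon> (v i k) *\<^sub>C v k l * w l j)"
      by (simp add: cs.scale_sum_right scaleC_mult_left)
    also have "\<dots> = (\<Sum>l\<in>I. (\<Sum>k\<in>I. \<epsilon> (v i k) *\<^sub>C v k l) * w l j)"
      by (subst sum.swap) (simp add: sum_distrib_right)
    also have "\<dots> = (\<Sum>l\<in>I. v i l * w l j)"
    proof (intro sum.cong refl arg_cong2[where f="(*)"])
      fix l assume l: "l \<in> I"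
      show "(\<Sum>k\<in>I. \<epsilon> (v i k) *\<^sub>C v k l) = v i l"
        using tensor_lift_corep[OF vector_space_scaleC bilinear_counit v that(1) l]
          counit_left[OF corepD(1)[OF v that(1) l]] by simp
    qed
    also have "\<dots> = of_bool (i = j) *\<^sub>C 1" using inv[OF that] by simp
    finally show ?thesis by (simp add: scaleC_one_inject)
  qed
  show "\<epsilon> (v i j) = of_bool (i = j)" using eps ij .
  have "S (v i j) = (\<Sum>k\<in>I. S (v i k) * of_bool (k = j))"
    by (rule sum_of_bool_right(1)[OF fin ij(2), symmetric])
  also have "\<dots> = (\<Sum>k\<in>I. S (v i k) * (\<Sum>l\<in>I. v k l * w l j))"
    using ij by (intro sum.cong refl) (simp add: inv)
  also have "\<dots> = (\<Sum>l\<in>I. (\<Sum>k\<in>I. S (v i k) * v k l) * w l j)"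
    unfolding sum_distrib_left sum_distrib_right by (subst sum.swap) (simp add: mult.assoc)
  also have "\<dots> = (\<Sum>l\<in>I. of_bool (i = l) * w l j)"
  proof (intro sum.cong refl arg_cong2[where f="(*)"])
    fix l assume l: "l \<in> I"
    show "(\<Sum>k\<in>I. S (v i k) * v k l) = of_bool (i = l)"
      using tensor_lift_corep[OF vector_space_scaleC bilinear_antipode v ij(1) l]
        antipode_left[OF corepD(1)[OF v ij(1) l]] eps[OF ij(1) l]
      by (cases "i = l") simp_all
  qed
  also have "\<dots> = w i j" by (rule sum_of_bool_right(4)[OF fin ij(1)])
  finally show "S (v i j) = w i j" .
qed

abbreviation urep where "urep \<equiv> unitary_rep t \<Delta>"

definition coefs :: "nat \<Rightarrow> (nat \<Rightarrow> nat \<Rightarrow> 'a) \<Rightarrow> 'a set" where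
  "coefs n u = {u i j | i j. i < n \<and> j < n}"

lemma coefsI: "i < n \<Longrightarrow> j < n \<Longrightarrow> u i j \<in> coefs n u"
  by (auto simp: coefs_def)

lemma finite_coefs: "finite (coefs n u)"
proof -
  have "coefs n u = (\<lambda>(i, j). u i j) ` ({..<n} \<times> {..<n})" by (auto simp: coefs_def)
  then show ?thesis by simp
qed

lemma urep_coef_P: "urep n u \<Longrightarrow> i < n \<Longrightarrow> j < n \<Longrightarrow> u i j \<in> P"
  unfolding P_eq Pol_def by (rule cs.span_base) blast

lemma coefs_P: "urep n u \<Longrightarrow> coefs n u \<subseteq> P"
  by (auto simp: coefs_def urep_coef_P)

lemma urep_corep: "urep n u \<Longrightarrow> corep {..<n} u"
  using urep_coef_P by (auto simp: corep_def unitary_rep_def)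

lemma urep_unitary:
  assumes "urep n u" "i < n" "j < n"
  shows "(\<Sum>k<n. u i k * adj (u j k)) = of_bool (i = j)"
    and "(\<Sum>k<n. adj (u k i) * u k j) = of_bool (i = j)"
  using assms by (auto simp: unitary_rep_def)

lemma counit_coef: "urep n u \<Longrightarrow> i < n \<Longrightarrow> j < n \<Longrightarrow> \<epsilon> (u i j) = of_bool (i = j)"
  by (rule corep_inverse(1)[OF urep_corep, where w="\<lambda>i j. adj (u j i)"]) (auto simp: urep_unitary)

lemma antipode_coef: "urep n u \<Longrightarrow> i < n \<Longrightarrow> j < n \<Longrightarrow> S (u i j) = adj (u j i)"
  by (rule corep_inverse(2)[OF urep_corep, where w="\<lambda>i j. adj (u j i)"]) (auto simp: urep_unitary)

lemma P_induct [consumes 1, case_names zero add scale coef]: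
  assumes "a \<in> P" and "Q 0" and "\<And>x y. x \<in> P \<Longrightarrow> y \<in> P \<Longrightarrow> Q x \<Longrightarrow> Q y \<Longrightarrow> Q (x + y)"
    and "\<And>c x. x \<in> P \<Longrightarrow> Q x \<Longrightarrow> Q (c *\<^sub>C x)"
    and "\<And>n u i j. urep n u \<Longrightarrow> i < n \<Longrightarrow> j < n \<Longrightarrow> Q (u i j)"
  shows "Q a"
proof -
  have "cspan {u i j | u i j n. urep n u \<and> i < n \<and> j < n} \<subseteq> {x \<in> P. Q x}"
    by (rule cs.span_minimal)
      (use assms urep_coef_P in \<open>auto simp: cs.subspace_def zero_P add_P scale_P\<close>)
  then show ?thesis using assms(1) unfolding P_eq Pol_def by blast
qed

text \<open>The products of coefficients form a corepresentation indexed by pairs, and its right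
  inverse is the matrix of adjoints in reversed order, so the antipode can be read off from
  \<open>corep_inverse\<close>.\<close>

lemma antipode_mult_coef:
  assumes u: "urep n u" "i < n" "j < n" and v: "urep m v" "k < m" "l < m"
  shows "S (u i j * v k l) = S (v k l) * S (u i j)"
proof -
  let ?I = "{..<n} \<times> {..<m}"
  define V where "V = (\<lambda>(i, k) (j, l). u i j * v k l)"
  define W where "W = (\<lambda>(i, k) (j, l). adj (v l k) * adj (u j i))"
  have VP: "V p q \<in> P" if "p \<in> ?I" "q \<in> ?I" for p q
    using that u(1) v(1) by (auto simp: V_def split: prod.splits intro!: mult_P urep_coef_P)
  have "corep ?I V"
    unfolding corep_def
  proof (intro conjI ballI)
    fix p q assume pq: "p \<in> ?I" "q \<in> ?I"
    show "V p q \<in> P" using VP pq .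
    obtain i k j l where p: "p = (i, k)" "q = (j, l)" by (metis surj_pair)
    show "\<Delta> (V p q) = (\<Sum>r\<in>?I. t (V p r) (V r q))"
      using pq corepD(2)[OF urep_corep[OF u(1)], of i j] corepD(2)[OF urep_corep[OF v(1)], of k l]
      by (simp add: p V_def comult_mult sum_product tensor_mult sum.cartesian_product case_prod_beta)
  qed simp
  moreover have "(\<Sum>r\<in>?I. V p r * W r q) = of_bool (p = q)" if pq: "p \<in> ?I" "q \<in> ?I" for p q
  proof -
    obtain i k j l where p: "p = (i, k)" "q = (j, l)" by (metis surj_pair)
    have "(\<Sum>r\<in>?I. V p r * W r q) = (\<Sum>a<n. u i a * (\<Sum>b<m. v k b * adj (v l b)) * adj (u j a))"
      by (simp add: p V_def W_def sum.cartesian_product case_prod_beta sum_distrib_left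
          sum_distrib_right mult.assoc)
    also have "\<dots> = of_bool (p = q)"
      using pq urep_unitary(1)[OF u(1), of i j] urep_unitary(1)[OF v(1), of k l]
      by (cases "k = l") (auto simp: p)
    finally show ?thesis .
  qed
  ultimately have "S (V (i, k) (j, l)) = W (i, k) (j, l)"
    using u v by (intro corep_inverse(2)) auto
  then show ?thesis using u v by (simp add: V_def W_def antipode_coef)
qed

lemma antipode_mult:
  assumes "a \<in> P" "b \<in> P"
  shows "S (a * b) = S b * S a"
  using assms(1)
proof (induction rule: P_induct)
  case (coef n u i j)
  note u = this
  show ?case using assms(2)
  proof (induction rule: P_induct)
    case (coef m v k l)
    then show ?case using antipode_mult_coef[OF u] by blast
  qed (use u in \<open>auto simp: antipode.zero antipode_add antipode_scale algebra_simps mult_P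
    urep_coef_P scaleC_mult_left scaleC_mult_right\<close>)
qed (use assms(2) in \<open>auto simp: antipode.zero antipode_add antipode_scale algebra_simps mult_P
    scaleC_mult_left scaleC_mult_right\<close>)

lemma counit_antipode:
  assumes "a \<in> P" shows "\<epsilon> (S a) = \<epsilon> a"
  using assms
proof (induction rule: P_induct)
  case (coef n u i j)
  then show ?case by (auto simp: antipode_coef counit_adj urep_coef_P counit_coef)
qed (auto simp: antipode.zero antipode_add antipode_scale counit_add counit_scale antipode_P)

lemma antipode_adj_antipode:
  assumes "a \<in> P" shows "S (adj (S a)) = adj a"
  using assms
proof (induction rule: P_induct)
  case (coef n u i j)
  then show ?case by (auto simp: antipode_coef adj_adj)
qed (auto simp: antipode.zero antipode_add antipode_scale adj_add adj_scaleC antipode_P adj_P)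

end

section \<open>Subcoalgebras and finite-dimensional *-algebras\<close>

text \<open>Serves for a space of matrices and for the operator induced by \<open>\<tau>\<close>.
  Both lie in large function spaces, so finite dimension enters through the spanning set F.\<close>

lemma (in vector_space) injective_imp_surjective_on_subspace:
  assumes V: "subspace V" "V \<subseteq> span F" "finite F"
    and f: "Vector_Spaces.linear scale scale f" "f ` V \<subseteq> V"
    and inj: "\<And>x. x \<in> V \<Longrightarrow> f x = 0 \<Longrightarrow> x = 0"
  shows "V \<subseteq> f ` V"
proof
  interpret f: Vector_Spaces.linear scale scale f by fact
  obtain B where B: "B \<subseteq> V" "independent B" "V \<subseteq> span B"
    by (rule maximal_independent_subset)
  have finB: "finite B" using independent_span_bound[OF V(3) B(2)] B(1) V(2) by blast
  have sB: "span B = V" using B V(1) by (simp add: span_minimal subset_antisym)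
  have injV: "inj_on f V" using f.inj_on_iff_eq_0[OF V(1)] inj by blast
  have ind: "independent (f ` B)"
    by (rule f.independent_injective_image[OF B(2)]) (simp add: sB injV)
  have card: "card (f ` B) = card B"
    by (rule card_image, rule inj_on_subset[OF injV B(1)])
  fix y assume y: "y \<in> V"
  have "y \<in> span (f ` B)"
  proof (rule ccontr)
    assume *: "y \<notin> span (f ` B)"
    then have "y \<notin> f ` B" using span_superset[of "f ` B"] by auto
    then have "card (insert y (f ` B)) = Suc (card B)" using card finB by simp
    moreover have "insert y (f ` B) \<subseteq> span B" using y f(2) B(1) sB by auto
    ultimately show False
      using independent_span_bound[OF finB independent_insertI[OF * ind]] by auto
  qed
  then show "y \<in> f ` V" by (simp add: f.span_image sB)
qed

lemma separating_functional:
  fixes V :: "'a::cstar_algebra set"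
  assumes "cs.subspace V" "x \<notin> V"
  obtains \<phi> :: "'a \<Rightarrow> complex"
  where "clinear_on UNIV scaleC (*) \<phi>" "\<And>v. v \<in> V \<Longrightarrow> \<phi> v = 0" "\<phi> x \<noteq> 0"
proof -
  interpret vector_space_pair "scaleC :: complex \<Rightarrow> 'a \<Rightarrow> 'a" "(*) :: complex \<Rightarrow> complex \<Rightarrow> complex" ..
  obtain B where B: "B \<subseteq> V" "cindependent B" "V \<subseteq> cspan B"
    by (rule cs.maximal_independent_subset)
  have xB: "x \<notin> cspan B" using assms cs.span_minimal[OF B(1) assms(1)] by blast
  have ind: "cindependent (insert x B)" by (rule cs.independent_insertI[OF xB B(2)])
  define \<phi> where "\<phi> = construct (insert x B) (\<lambda>y. if y = x then 1 else (0::complex))"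
  have lin: "Vector_Spaces.linear scaleC (*) \<phi>" unfolding \<phi>_def by (rule linear_construct[OF ind])
  have \<phi>b: "\<phi> b = (if b = x then 1 else 0)" if "b \<in> insert x B" for b
    unfolding \<phi>_def by (rule construct_basis[OF ind that])
  interpret \<phi>: Vector_Spaces.linear scaleC "(*)" \<phi> by fact
  have "\<phi> v = 0" if "v \<in> V" for v
  proof (rule \<phi>.eq_0_on_span[of B])
    show "v \<in> cspan B" using that B(3) by blast
    show "\<phi> b = 0" if "b \<in> B" for b using \<phi>b[of b] that xB cs.span_base[of x B] by auto
  qed
  moreover have "\<phi> x \<noteq> 0" using \<phi>b[of x] by simp
  moreover have "clinear_on UNIV scaleC (*) \<phi>"
    by (rule clinear_onI) (auto simp: \<phi>.add \<phi>.scale)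
  ultimately show ?thesis using that by blast
qed

text \<open>The size n depends on a representation and cannot be a type. Matrices are therefore
  functions on index pairs, with 0 outside the n by n block, and inherit the vector space structure
  \<open>fun_scale\<close>.\<close>

definition mat_mult :: "nat \<Rightarrow> (nat \<times> nat \<Rightarrow> complex) \<Rightarrow> (nat \<times> nat \<Rightarrow> complex) \<Rightarrow> nat \<times> nat \<Rightarrow> complex"
  where "mat_mult n X Y = (\<lambda>(i, j). if i < n \<and> j < n then \<Sum>k<n. X (i, k) * Y (k, j) else 0)"

lemma mat_mult_nth [simp]: "i < n \<Longrightarrow> j < n \<Longrightarrow> mat_mult n X Y (i, j) = (\<Sum>k<n. X (i, k) * Y (k, j))"
  by (simp add: mat_mult_def)

lemma mat_mult_linear: "Vector_Spaces.linear fun_scale fun_scale (mat_mult n X)"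
  unfolding Vector_Spaces.linear_iff
  by (auto simp: fs.vector_space_axioms mat_mult_def fun_scale_def fun_eq_iff algebra_simps
      sum.distrib sum_distrib_left)

text \<open>The trace of Z* X* X Z is the squared Hilbert-Schmidt norm of X Z.\<close>

lemma mat_star_mult_cancel:
  assumes "\<And>i k. i < n \<Longrightarrow> k < n \<Longrightarrow> X' (i, k) = cnj (X (k, i))"
    and 0: "mat_mult n X' (mat_mult n X Z) = 0"
  shows "mat_mult n X Z = 0"
proof -
  define Y where "Y = mat_mult n X Z"
  have "(\<Sum>k<n. \<Sum>j<n. cnj (Y (k, j)) * Y (k, j)) = (\<Sum>k<n. \<Sum>j<n. \<Sum>i<n. cnj (Z (i, j)) * (X' (i, k) * Y (k, j)))"
    using assms(1) by (intro sum.cong refl) (simp add: Y_def sum_distrib_left sum_distrib_right mult_ac)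
  also have "\<dots> = (\<Sum>j<n. \<Sum>i<n. \<Sum>k<n. cnj (Z (i, j)) * (X' (i, k) * Y (k, j)))"
  proof -
    have "(\<Sum>k<n. \<Sum>j<n. \<Sum>i<n. F k j i) = (\<Sum>j<n. \<Sum>i<n. \<Sum>k<n. F k j i)" for F :: "nat \<Rightarrow> nat \<Rightarrow> nat \<Rightarrow> complex"
    proof -
      have "(\<Sum>k<n. \<Sum>j<n. \<Sum>i<n. F k j i) = (\<Sum>j<n. \<Sum>k<n. \<Sum>i<n. F k j i)" by (rule sum.swap)
      also have "\<dots> = (\<Sum>j<n. \<Sum>i<n. \<Sum>k<n. F k j i)" by (intro sum.cong refl sum.swap)
      finally show ?thesis .
    qed
    then show ?thesis .
  qed
  also have "\<dots> = (\<Sum>j<n. \<Sum>i<n. cnj (Z (i, j)) * mat_mult n X' Y (i, j))"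
    by (simp add: sum_distrib_left)
  also have "\<dots> = 0" using 0 by (simp add: Y_def del: mat_mult_nth)
  finally have "(\<Sum>k<n. \<Sum>j<n. complex_of_real ((cmod (Y (k, j)))\<^sup>2)) = 0"
    by (simp add: complex_norm_square mult.commute del: of_real_power)
  then have "complex_of_real (\<Sum>k<n. \<Sum>j<n. (cmod (Y (k, j)))\<^sup>2) = 0" by simp
  then have "(\<Sum>k<n. \<Sum>j<n. (cmod (Y (k, j)))\<^sup>2) = 0" by (simp only: of_real_eq_0_iff)
  then have "\<forall>k<n. (\<Sum>j<n. (cmod (Y (k, j)))\<^sup>2) = 0"
    by (subst (asm) sum_nonneg_eq_0_iff) (auto simp: sum_nonneg)
  then have *: "\<forall>k<n. \<forall>j<n. Y (k, j) = 0"
    by (auto simp: sum_nonneg_eq_0_iff)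
  show ?thesis
    unfolding Y_def[symmetric]
  proof (rule ext, clarify)
    fix i j show "Y (i, j) = 0 (i, j)"
      using * by (cases "i < n \<and> j < n") (auto simp: Y_def mat_mult_def)
  qed
qed

lemma finite_dim_matrices:
  fixes X :: "nat \<times> nat \<Rightarrow> complex"
  assumes "\<And>i j. i \<ge> n \<or> j \<ge> n \<Longrightarrow> X (i, j) = 0"
  shows "X \<in> fs.span ((\<lambda>p q. of_bool (q = p)) ` ({..<n} \<times> {..<n}))"
proof -
  have "X = (\<Sum>p\<in>{..<n} \<times> {..<n}. fun_scale (X p) (\<lambda>q. of_bool (q = p)))"
  proof (rule ext)
    fix q
    have "(\<Sum>p\<in>{..<n} \<times> {..<n}. fun_scale (X p) (\<lambda>q. of_bool (q = p))) q =
        (\<Sum>p\<in>{..<n} \<times> {..<n}. X p * of_bool (q = p))"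
      by (simp add: fun_scale_def sum_function_apply)
    also have "\<dots> = X q"
    proof (cases "q \<in> {..<n} \<times> {..<n}")
      case True
      show ?thesis by (rule sum_of_bool_right(2)[OF _ True]) (intro finite_cartesian_product finite_lessThan)
    next
      case False
      then have "(\<Sum>p\<in>{..<n} \<times> {..<n}. X p * of_bool (q = p)) = 0" by (intro sum.neutral) auto
      then show ?thesis using False assms[of "fst q" "snd q"] by (cases q) auto
    qed
    finally show "X q = (\<Sum>p\<in>{..<n} \<times> {..<n}. fun_scale (X p) (\<lambda>q. of_bool (q = p))) q" ..
  qed
  also have "\<dots> \<in> fs.span ((\<lambda>p q. of_bool (q = p)) ` ({..<n} \<times> {..<n}))"
    by (intro fs.span_sum fs.span_scale fs.span_base) auto
  finally show ?thesis .
qed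

definition dsum :: "nat \<Rightarrow> (nat \<Rightarrow> nat \<Rightarrow> 'a) \<Rightarrow> (nat \<Rightarrow> nat \<Rightarrow> 'a) \<Rightarrow> nat \<Rightarrow> nat \<Rightarrow> 'a::zero" where
  "dsum n u v = (\<lambda>i j. if i < n \<and> j < n then u i j else if i < n \<or> j < n then 0 else v (i - n) (j - n))"

lemma sum_lessThan_add:
  "(\<Sum>k<n+m. f k) = (\<Sum>k<n. f k) + (\<Sum>k<m. f (n + k) :: 'a::comm_monoid_add)" for n m :: nat
  by (induction m) (auto simp: add.assoc)

section \<open>Coefficient spaces of direct sums, and convolution of functionals\<close>

context hopf_pol
begin

lemma urep_dsum:
  assumes u: "urep n u" and v: "urep m v"
  shows "urep (n + m) (dsum n u v)"
proof -
  have t0: "t x 0 = 0" "t 0 x = 0" for x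
    using clinear_on_scale[OF linear_right, where x=0 and c=0] clinear_on_scale[OF linear_left, where x=0 and c=0]
    by simp_all
  have D0: "\<Delta> 0 = 0" using clinear_on_scale[OF comult_lin, of 0 0] by simp
  show ?thesis
    unfolding unitary_rep_def
  proof (intro allI impI)
    fix i j assume ij: "i < n + m" "j < n + m"
    have c: "(i < n \<or> (\<exists>i'<m. i = n + i')) \<and> (j < n \<or> (\<exists>j'<m. j = n + j'))"
    proof -
      have "k < n \<or> (\<exists>k'<m. k = n + k')" if "k < n + m" for k
        using that by (cases "k < n") (auto intro!: exI[of _ "k - n"])
      then show ?thesis using ij by blast
    qed
    show "\<Delta> (dsum n u v i j) = (\<Sum>k<n + m. t (dsum n u v i k) (dsum n u v k j)) \<and>
     (\<Sum>k<n + m. dsum n u v i k * adj (dsum n u v j k)) = of_bool (i = j) \<and>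
     (\<Sum>k<n + m. adj (dsum n u v k i) * dsum n u v k j) = of_bool (i = j)"
      using c u v unfolding sum_lessThan_add unitary_rep_def
      by (elim conjE disjE exE) (auto simp: dsum_def t0 D0)
  qed
qed

lemma coefs_dsum: "coefs n u \<subseteq> coefs (n + m) (dsum n u v)" "coefs m v \<subseteq> coefs (n + m) (dsum n u v)"
proof -
  show "coefs n u \<subseteq> coefs (n + m) (dsum n u v)"
    unfolding coefs_def dsum_def by (clarify, rule_tac x=i in exI, rule_tac x=j in exI) auto
  show "coefs m v \<subseteq> coefs (n + m) (dsum n u v)"
    unfolding coefs_def dsum_def by (clarify, rule_tac x="n+i" in exI, rule_tac x="n+j" in exI) auto
qed

text \<open>Direct sums make the coefficient spaces a directed family, so a linear combination over
  several representations already lies in the space of one.\<close>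

lemma P_in_coefs:
  assumes "a \<in> P" obtains n u where "urep n u" "a \<in> cspan (coefs n u)"
proof -
  have "\<exists>n u. urep n u \<and> a \<in> cspan (coefs n u)"
    using assms
  proof (induction rule: P_induct)
    case zero
    \<comment> \<open>Dimension 0: unitarity is vacuous and the coefficients span the zero
      space.\<close>
    show ?case by (intro exI[of _ 0]) (auto simp: unitary_rep_def cs.span_zero)
  next
    case (add x y)
    then obtain n u m v where *: "urep n u" "x \<in> cspan (coefs n u)" "urep m v" "y \<in> cspan (coefs m v)"
      by blast
    have "x \<in> cspan (coefs (n + m) (dsum n u v))" "y \<in> cspan (coefs (n + m) (dsum n u v))"
      using *(2,4) cs.span_mono[OF coefs_dsum(1)[of n u m v]] cs.span_mono[OF coefs_dsum(2)[of m v n u]]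
      by auto
    then have "x + y \<in> cspan (coefs (n + m) (dsum n u v))" by (rule cs.span_add)
    then show ?case using urep_dsum[OF *(1,3)] by blast
  next
    case (scale c x)
    then show ?case using cs.span_scale by blast
  next
    case (coef n u i j)
    then show ?case by (blast intro: cs.span_base coefsI)
  qed
  then show ?thesis using that by blast
qed

lemma finite_subset_in_coefs:
  assumes "finite F" "F \<subseteq> P" obtains n u where "urep n u" "F \<subseteq> cspan (coefs n u)"
proof -
  have "\<exists>n u. urep n u \<and> F \<subseteq> cspan (coefs n u)"
    using assms
  proof (induction rule: finite_induct)
    case empty
    show ?case by (intro exI[of _ 0]) (auto simp: unitary_rep_def)
  next
    case (insert x F)
    then obtain n u where 1: "urep n u" "F \<subseteq> cspan (coefs n u)" by blast
    obtain m v where 2: "urep m v" "x \<in> cspan (coefs m v)" using P_in_coefs insert.prems by blast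
    then have "insert x F \<subseteq> cspan (coefs (n + m) (dsum n u v))"
      using 1(2) cs.span_mono[OF coefs_dsum(1)[of n u m v]] cs.span_mono[OF coefs_dsum(2)[of m v n u]]
      by auto
    then show ?case using urep_dsum[OF 1(1) 2(1)] by blast
  qed
  then show ?thesis using that by blast
qed

definition conv :: "('a \<Rightarrow> complex) \<Rightarrow> ('a \<Rightarrow> complex) \<Rightarrow> 'a \<Rightarrow> complex" where
  "conv \<phi> \<psi> a = tensor_lift t P P (\<lambda>x y. \<phi> x * \<psi> y) (\<Delta> a)"

lemma bilinear_conv:
  assumes "clinear_on P scaleC (*) \<phi>" "clinear_on P scaleC (*) \<psi>"
  shows "cbilinear_on (*) P (\<lambda>x y. \<phi> x * \<psi> y)"
  unfolding cbilinear_on_def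
  by (intro conjI ballI clinear_onI)
    (simp_all add: clinear_on_add[OF assms(1)] clinear_on_add[OF assms(2)]
      clinear_on_scale[OF assms(1)] clinear_on_scale[OF assms(2)] distrib_left distrib_right)

lemma tensor_lift_comult_linear:
  assumes "vector_space sd" "cbilinear_on sd P f"
  shows "clinear_on P scaleC sd (\<lambda>a. tensor_lift t P P f (\<Delta> a))"
  using tensor_lift_linear[OF assms] comult_linP comult_P unfolding clinear_on_def by auto

lemma conv_linear:
  assumes "clinear_on P scaleC (*) \<phi>" "clinear_on P scaleC (*) \<psi>"
  shows "clinear_on P scaleC (*) (conv \<phi> \<psi>)"
  unfolding conv_def
  by (rule tensor_lift_comult_linear[OF vector_space_times bilinear_conv[OF assms]])

lemma conv_corep:
  assumes "clinear_on P scaleC (*) \<phi>" "clinear_on P scaleC (*) \<psi>" "corep I v" "i \<in> I" "j \<in> I"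
  shows "conv \<phi> \<psi> (v i j) = (\<Sum>k\<in>I. \<phi> (v i k) * \<psi> (v k j))"
  unfolding conv_def
  by (rule tensor_lift_corep[OF vector_space_times bilinear_conv[OF assms(1,2)] assms(3-5)])

text \<open>On coefficients of a unitary representation \<open>u\<close> the functional \<open>\<phi>'\<close> below has the matrix
  adjoint to the matrix \<open>X\<close> of \<open>\<phi>\<close>. The functionals vanishing on the coefficients of \<open>v\<close> form an
  ideal for convolution, and ideals of finite-dimensional *-algebras of matrices are self-adjoint:
  since \<open>Z \<mapsto> X\<^sup>* X Z\<close> is injective, hence surjective, on \<open>X\<^sup>* B\<close>, we have \<open>X\<^sup>* \<in> X\<^sup>* X X\<^sup>* B\<close>.\<close>

lemma adj_antipode_corep_span:
  assumes v: "corep I v" and ij: "i \<in> I" "j \<in> I"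
  shows "adj (S (v i j)) \<in> cspan {v k l | k l. k \<in> I \<and> l \<in> I}"
proof (rule ccontr)
  let ?V = "cspan {v k l | k l. k \<in> I \<and> l \<in> I}"
  assume "adj (S (v i j)) \<notin> ?V"
  then obtain \<phi> :: "'a \<Rightarrow> complex" where \<phi>: "clinear_on UNIV scaleC (*) \<phi>" "\<And>x. x \<in> ?V \<Longrightarrow> \<phi> x = 0"
    "\<phi> (adj (S (v i j))) \<noteq> 0"
    using separating_functional[OF cs.subspace_span] by blast
  have \<phi>v: "\<phi> (v k l) = 0" if "k \<in> I" "l \<in> I" for k l
    by (rule \<phi>(2)) (rule cs.span_base, use that in blast)
  have \<phi>P: "clinear_on P scaleC (*) \<phi>" using clinear_on_subset[OF \<phi>(1)] by blast
  define \<phi>' where "\<phi>' a = cnj (\<phi> (adj (S a)))" for a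
  have \<phi>'P: "clinear_on P scaleC (*) \<phi>'"
    using \<phi>(1) by (auto simp: clinear_on_def \<phi>'_def antipode_add antipode_scale adj_add adj_scaleC)
  have "(\<lambda>(i, j). v i j) ` (I \<times> I) \<subseteq> P" "finite ((\<lambda>(i, j). v i j) ` (I \<times> I))"
    using v by (auto simp: corep_def)
  \<comment> \<open>The matrices of functionals on v carry no suitable adjoint, as v need not be
    unitary. The computation takes place on a unitary u whose coefficient space contains the entries
    of v.\<close>
  then obtain n u where u: "urep n u" and vu: "(\<lambda>(i, j). v i j) ` (I \<times> I) \<subseteq> cspan (coefs n u)"
    using finite_subset_in_coefs by blast
  note cu = urep_corep[OF u]
  define M where "M \<psi> = (\<lambda>(i, j). if i < n \<and> j < n then \<psi> (u i j) else 0)" for \<psi> :: "'a \<Rightarrow> complex"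
  have M_conv: "M (conv \<psi> \<omega>) = mat_mult n (M \<psi>) (M \<omega>)"
    if "clinear_on P scaleC (*) \<psi>" "clinear_on P scaleC (*) \<omega>" for \<psi> \<omega>
    using conv_corep[OF that cu] by (auto simp: M_def mat_mult_def fun_eq_iff)
  define B where "B = M ` {\<psi>. clinear_on P scaleC (*) \<psi>}"
  define W where "W = mat_mult n (M \<phi>') ` B"
  have subB: "fs.subspace B"
    unfolding fs.subspace_def
  proof (intro conjI ballI allI)
    have "M (\<lambda>_. 0) = 0" by (auto simp: M_def fun_eq_iff)
    moreover have "clinear_on P scaleC (*) (\<lambda>_. 0 :: complex)" by (auto simp: clinear_on_def)
    ultimately show "0 \<in> B" unfolding B_def by force
  next
    fix x y assume "x \<in> B" "y \<in> B"
    then obtain \<psi> \<omega> where *: "clinear_on P scaleC (*) \<psi>" "clinear_on P scaleC (*) \<omega>" "x = M \<psi>" "y = M \<omega>"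
      unfolding B_def by blast
    then have "x + y = M (\<lambda>a. \<psi> a + \<omega> a)" "clinear_on P scaleC (*) (\<lambda>a. \<psi> a + \<omega> a)"
      by (auto simp: M_def fun_eq_iff clinear_on_def algebra_simps)
    then show "x + y \<in> B" unfolding B_def by blast
  next
    fix c x assume "x \<in> B"
    then obtain \<psi> where *: "clinear_on P scaleC (*) \<psi>" "x = M \<psi>"
      unfolding B_def by blast
    then have "fun_scale c x = M (\<lambda>a. c * \<psi> a)" "clinear_on P scaleC (*) (\<lambda>a. c * \<psi> a)"
      by (auto simp: M_def fun_eq_iff fun_scale_def intro!: clinear_onI)
        (auto simp: clinear_on_add clinear_on_scale distrib_left)
    then show "fun_scale c x \<in> B" unfolding B_def by blast
  qed
  interpret m': Vector_Spaces.linear fun_scale fun_scale "mat_mult n (M \<phi>')" by (rule mat_mult_linear)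
  interpret m: Vector_Spaces.linear fun_scale fun_scale "mat_mult n (M \<phi>)" by (rule mat_mult_linear)
  have star: "M \<phi>' (i, k) = cnj (M \<phi> (k, i))" if "i < n" "k < n" for i k
    using that by (simp add: M_def \<phi>'_def antipode_coef[OF u] adj_adj)
  have "W \<subseteq> (\<lambda>Z. mat_mult n (M \<phi>') (mat_mult n (M \<phi>) Z)) ` W"
  proof (rule fs.injective_imp_surjective_on_subspace)
    show "fs.subspace W" unfolding W_def by (rule m'.subspace_image[OF subB])
    show "W \<subseteq> fs.span ((\<lambda>p q. of_bool (q = p)) ` ({..<n} \<times> {..<n}))"
      unfolding W_def by (auto intro!: finite_dim_matrices simp: mat_mult_def split: if_splits)
    show "Vector_Spaces.linear fun_scale fun_scale (\<lambda>Z. mat_mult n (M \<phi>') (mat_mult n (M \<phi>) Z))"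
      using Vector_Spaces.linear_compose[OF mat_mult_linear mat_mult_linear] by (simp add: o_def)
    show "(\<lambda>Z. mat_mult n (M \<phi>') (mat_mult n (M \<phi>) Z)) ` W \<subseteq> W"
    proof (clarsimp simp: W_def B_def)
      fix \<psi> assume \<psi>: "clinear_on P scaleC (*) \<psi>"
      have "mat_mult n (M \<phi>) (mat_mult n (M \<phi>') (M \<psi>)) = M (conv \<phi> (conv \<phi>' \<psi>))"
        using \<psi> by (simp add: M_conv conv_linear \<phi>P \<phi>'P)
      then show "mat_mult n (M \<phi>') (mat_mult n (M \<phi>) (mat_mult n (M \<phi>') (M \<psi>)))
          \<in> mat_mult n (M \<phi>') ` M ` {\<psi>. clinear_on P scaleC (*) \<psi>}"
        using \<psi> conv_linear \<phi>P \<phi>'P by auto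
    qed
    \<comment> \<open>For x = X* Y the cancellation is used twice: on X* X x = 0, and then, with X
      and X* exchanged, on X X* Y = 0.\<close>
    show "x = 0" if "x \<in> W" "mat_mult n (M \<phi>') (mat_mult n (M \<phi>) x) = 0" for x
    proof -
      obtain Y where x: "x = mat_mult n (M \<phi>') Y" using \<open>x \<in> W\<close> unfolding W_def by blast
      have "mat_mult n (M \<phi>) x = 0"
        by (rule mat_star_mult_cancel[OF _ that(2)]) (rule star)
      then show ?thesis unfolding x
        by (intro mat_star_mult_cancel[where X'="M \<phi>" and X="M \<phi>'"]) (simp_all add: star)
    qed
  qed auto
  \<comment> \<open>The counit has the identity matrix, so X* is itself of the form X* times an
    element of B.\<close>
  moreover have "M \<phi>' \<in> W"
  proof -
    have "mat_mult n (M \<phi>') (M \<epsilon>) (i, j) = M \<phi>' (i, j)" for i j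
      using sum_of_bool_right(1)[of "{..<n}" j "\<lambda>k. M \<phi>' (i, k)"]
      by (simp add: mat_mult_def M_def counit_coef[OF u] cong: if_cong)
    then have "M \<phi>' = mat_mult n (M \<phi>') (M \<epsilon>)" by (auto simp: fun_eq_iff)
    then show ?thesis unfolding W_def B_def using counit_lin by blast
  qed
  ultimately obtain \<omega> where \<omega>: "clinear_on P scaleC (*) \<omega>"
    "M \<phi>' = mat_mult n (M \<phi>') (mat_mult n (M \<phi>) (mat_mult n (M \<phi>') (M \<omega>)))"
    unfolding W_def B_def by auto
  define \<psi> where "\<psi> = conv \<phi>' \<omega>"
  have \<psi>P: "clinear_on P scaleC (*) \<psi>" unfolding \<psi>_def by (rule conv_linear[OF \<phi>'P \<omega>(1)])
  have M\<phi>': "M \<phi>' = M (conv \<phi>' (conv \<phi> \<psi>))"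
    using \<omega> by (simp add: \<psi>_def M_conv conv_linear \<phi>P \<phi>'P)
  then have eq: "\<phi>' (u k l) = conv \<phi>' (conv \<phi> \<psi>) (u k l)" if "k < n" "l < n" for k l
  proof -
    have "M \<phi>' (k, l) = M (conv \<phi>' (conv \<phi> \<psi>)) (k, l)" by (simp only: M\<phi>')
    then show ?thesis unfolding M_def using that by simp
  qed
  interpret \<phi>': clinear_map_on scaleC "(*)" P \<phi>' by unfold_locales (use subP \<phi>'P in auto)
  \<comment> \<open>The factorization of \<open>\<phi>'\<close> through \<open>\<phi>\<close> holds
    on the coefficients of u, hence on their span, which contains \<open>v i j\<close>.\<close>
  have "\<phi>' (v i j) = conv \<phi>' (conv \<phi> \<psi>) (v i j)"
  proof (rule \<phi>'.span_eq)
    show "clinear_on P scaleC (*) (conv \<phi>' (conv \<phi> \<psi>))"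
      by (intro conv_linear \<phi>P \<phi>'P \<psi>P)
    show "v i j \<in> cspan (coefs n u)" using vu ij by auto
  qed (use eq coefs_P[OF u] in \<open>auto simp: coefs_def\<close>)
  \<comment> \<open>Expanded over v instead of u, every term contains some
    \<open>\<phi> (v k l)\<close>, which is zero.\<close>
  also have "\<dots> = 0"
    using conv_corep[OF \<phi>'P conv_linear[OF \<phi>P \<psi>P] v] conv_corep[OF \<phi>P \<psi>P v] ij \<phi>v by simp
  finally show False using \<phi>(3) by (simp add: \<phi>'_def)
qed

end

section \<open>Admissible bijections\<close>

lemma (in clinear_map_on) span_mem:
  assumes "x \<in> v.span B" "B \<subseteq> V" "w.subspace W" "\<And>b. b \<in> B \<Longrightarrow> f b \<in> W"
  shows "f x \<in> W"
proof -
  have "v.span B \<subseteq> {x \<in> V. f x \<in> W}"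
  proof (rule v.span_minimal)
    show "v.subspace {x \<in> V. f x \<in> W}"
      unfolding v.subspace_def
      using v.subspace_0[OF sub] v.subspace_add[OF sub] v.subspace_scale[OF sub]
        w.subspace_0[OF assms(3)] w.subspace_add[OF assms(3)] w.subspace_scale[OF assms(3)]
      by (auto simp: zero clinear_on_add[OF lin] clinear_on_scale[OF lin])
  qed (use assms in auto)
  then show ?thesis using assms(1) by auto
qed

lemma adj_span:
  assumes "x \<in> cspan B" shows "adj x \<in> cspan (adj ` B)"
proof -
  have "cspan B \<subseteq> {x. adj x \<in> cspan (adj ` B)}"
    by (rule cs.span_minimal)
      (auto simp: cs.subspace_def adj_add adj_scaleC intro: cs.span_zero cs.span_add cs.span_scale cs.span_base)
  then show ?thesis using assms by auto
qed

locale admissible_hopf = hopf_pol +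
  fixes \<alpha>
  assumes admissible: "admissible_bijection t \<Delta> P \<alpha>"
begin

lemma alpha_P: "a \<in> P \<Longrightarrow> \<alpha> a \<in> P"
  and alpha_lin: "clinear_on P scaleC scaleC \<alpha>"
  and alpha_mult: "a \<in> P \<Longrightarrow> b \<in> P \<Longrightarrow> \<alpha> (a * b) = \<alpha> a * \<alpha> b"
  and alpha_comult: "a \<in> P \<Longrightarrow> tensor_lift t P P (\<lambda>x y. t (\<alpha> x) (\<alpha> y)) (\<Delta> a) = \<Delta> (\<alpha> a)"
  and alpha_bij2: "bij_betw (\<lambda>x. x + tensor_lift t P P (\<lambda>x y. t (\<alpha> x) (\<alpha> y)) x)
    (alg_tensor t P P) (alg_tensor t P P)"
  using admissible unfolding admissible_bijection_def by blast+

lemma alpha_adj_alpha: "a \<in> P \<Longrightarrow> \<alpha> (adj (\<alpha> a)) = adj a"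
  using admissible adj_P[of a] adj_adj[of a] unfolding admissible_bijection_def by metis

sublocale alpha: clinear_map_on scaleC scaleC P \<alpha>
  by unfold_locales (use subP alpha_lin in auto)

lemmas alpha_add = clinear_on_add[OF alpha_lin]
  and alpha_scale = clinear_on_scale[OF alpha_lin]

text \<open>Condition (ii) gives the element adj (\<alpha> 1) the image 1, while \<alpha> 1 is a
  left unit for the range of \<alpha>.\<close>

lemma alpha_one: "\<alpha> 1 = 1"
proof -
  have "adj (\<alpha> 1) \<in> P" by (intro adj_P alpha_P one_P)
  then have "\<alpha> (1 * adj (\<alpha> 1)) = \<alpha> 1 * \<alpha> (adj (\<alpha> 1))" by (intro alpha_mult one_P)
  then show ?thesis by (simp add: alpha_adj_alpha[OF one_P])
qed

lemma bilinear_alpha: "cbilinear_on scaleC P (\<lambda>x y. t (\<alpha> x) (\<alpha> y))"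
  unfolding cbilinear_on_def
  by (intro conjI ballI clinear_onI)
    (simp_all add: alpha_add alpha_scale clinear_on_add[OF linear_left] clinear_on_add[OF linear_right]
      clinear_on_scale[OF linear_left] clinear_on_scale[OF linear_right])

lemma corep_alpha:
  assumes v: "corep I v" shows "corep I (\<lambda>i j. \<alpha> (v i j))"
  unfolding corep_def
proof (intro conjI ballI)
  show "finite I" using v by (simp add: corep_def)
  fix i j assume ij: "i \<in> I" "j \<in> I"
  show "\<alpha> (v i j) \<in> P" using corepD(1)[OF v ij] by (rule alpha_P)
  show "\<Delta> (\<alpha> (v i j)) = (\<Sum>k\<in>I. t (\<alpha> (v i k)) (\<alpha> (v k j)))"
    using tensor_lift_corep[OF vector_space_scaleC bilinear_alpha v ij] alpha_comult[OF corepD(1)[OF v ij]]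
    by simp
qed

text \<open>Since \<alpha> need not respect the involution, \<alpha>(u) need not be unitary. The
  image of the adjoint matrix is still a right inverse, and through \<open>corep_inverse\<close>
  this makes \<alpha> compatible with the counit and the antipode.\<close>

lemma alpha_coef_inverse:
  assumes "urep n u" "i < n" "j < n"
  shows "(\<Sum>k<n. \<alpha> (u i k) * \<alpha> (adj (u j k))) = of_bool (i = j)"
proof -
  have "(\<Sum>k<n. \<alpha> (u i k) * \<alpha> (adj (u j k))) = (\<Sum>k<n. \<alpha> (u i k * adj (u j k)))"
    using assms by (intro sum.cong refl) (simp add: alpha_mult urep_coef_P adj_P)
  also have "\<dots> = \<alpha> (\<Sum>k<n. u i k * adj (u j k))"
    using assms by (intro alpha.sum[symmetric]) (simp add: mult_P urep_coef_P adj_P)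
  also have "\<dots> = of_bool (i = j)"
    using urep_unitary(1)[OF assms] by (cases "i = j") (simp_all add: alpha_one alpha.zero)
  finally show ?thesis .
qed

lemma counit_alpha: "a \<in> P \<Longrightarrow> \<epsilon> (\<alpha> a) = \<epsilon> a"
proof (induction rule: P_induct)
  case (coef n u i j)
  have "\<epsilon> (\<alpha> (u i j)) = of_bool (i = j)"
    by (rule corep_inverse(1)[OF corep_alpha[OF urep_corep[OF coef(1)]], where w="\<lambda>i j. \<alpha> (adj (u j i))"])
      (use coef alpha_coef_inverse in auto)
  then show ?case using counit_coef[OF coef] by simp
qed (auto simp: alpha.zero alpha_add alpha_scale counit_add counit_scale alpha_P)

lemma antipode_alpha: "a \<in> P \<Longrightarrow> S (\<alpha> a) = \<alpha> (S a)"
proof (induction rule: P_induct)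
  case (coef n u i j)
  have "S (\<alpha> (u i j)) = \<alpha> (adj (u j i))"
    by (rule corep_inverse(2)[OF corep_alpha[OF urep_corep[OF coef(1)]], where w="\<lambda>i j. \<alpha> (adj (u j i))"])
      (use coef alpha_coef_inverse in auto)
  then show ?case using antipode_coef[OF coef] by simp
qed (auto simp: alpha.zero alpha_add alpha_scale antipode.zero antipode_add antipode_scale alpha_P antipode_P)

definition \<sigma> :: "'a \<Rightarrow> 'a" where "\<sigma> a = S (\<alpha> a)"

lemma sigma_P: "a \<in> P \<Longrightarrow> \<sigma> a \<in> P"
  by (simp add: \<sigma>_def antipode_P alpha_P)

lemma sigma_lin: "clinear_on P scaleC scaleC \<sigma>"
  by (rule clinear_onI) (simp_all add: \<sigma>_def alpha_add alpha_scale antipode_add antipode_scale alpha_P)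

sublocale sigma: clinear_map_on scaleC scaleC P \<sigma>
  by unfold_locales (use subP sigma_lin in auto)

lemmas sigma_add = clinear_on_add[OF sigma_lin]
  and sigma_scale = clinear_on_scale[OF sigma_lin]

lemma sigma_mult: "a \<in> P \<Longrightarrow> b \<in> P \<Longrightarrow> \<sigma> (a * b) = \<sigma> b * \<sigma> a"
  by (simp add: \<sigma>_def alpha_mult antipode_mult alpha_P)

lemma counit_sigma: "a \<in> P \<Longrightarrow> \<epsilon> (\<sigma> a) = \<epsilon> a"
  by (simp add: \<sigma>_def counit_antipode counit_alpha alpha_P)

text \<open>After commuting S with \<alpha>, condition (ii) cancels the two copies of \<alpha> and
  \<open>antipode_adj_antipode\<close> the two copies of S. In other words, a \<mapsto> adj
  (\<sigma> a) is an involution.\<close>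

lemma sigma_adj_sigma: "a \<in> P \<Longrightarrow> \<sigma> (adj (\<sigma> a)) = adj a"
  by (metis \<sigma>_def alpha_adj_alpha antipode_adj_antipode antipode_alpha antipode_P)

text \<open>The entrywise adjoint of u is again a corepresentation, in general not unitary; this is
  one reason for treating arbitrary corepresentations in
  \<open>adj_antipode_corep_span\<close>.\<close>

lemma antipode_adj_coef_span:
  assumes u: "urep n u" "i < n" "j < n"
  shows "S (adj (u i j)) \<in> cspan (coefs n u)"
proof -
  have "corep {..<n} (\<lambda>i j. adj (u i j))"
    using urep_corep[OF u(1)] by (auto simp: corep_def comult_adj adj_sum tensor_adj adj_P)
  then have "adj (S (adj (u i j))) \<in> cspan {adj (u k l) | k l. k \<in> {..<n} \<and> l \<in> {..<n}}"
    by (rule adj_antipode_corep_span) (use u in auto)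
  from adj_span[OF this] have "S (adj (u i j)) \<in> cspan (adj ` {adj (u k l) | k l. k < n \<and> l < n})"
    by (simp add: adj_adj)
  also have "adj ` {adj (u k l) | k l. k < n \<and> l < n} = coefs n u"
    by (force simp: coefs_def adj_adj image_def)
  finally show ?thesis .
qed

text \<open>One application of \<sigma> may leave the coefficient space of u: it leads into the span
  \<open>?B\<close> of the adjoints of the entries of \<alpha>(u). The second one returns, because
  \<alpha> maps the adjoint of \<alpha>(u k l) to the adjoint of u k l.\<close>

lemma sigma_sigma_coef_span:
  assumes u: "urep n u" and a: "a \<in> cspan (coefs n u)"
  shows "\<sigma> (\<sigma> a) \<in> cspan (coefs n u)"
proof -
  let ?B = "adj ` {\<alpha> (u k l) | k l. k \<in> {..<n} \<and> l \<in> {..<n}}"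
  have B: "?B \<subseteq> P" using u by (auto simp: adj_P alpha_P urep_coef_P)
  have 1: "\<sigma> b \<in> cspan (coefs n u)" if "b \<in> cspan ?B" for b
  proof (rule sigma.span_mem[OF that B cs.subspace_span])
    fix b assume "b \<in> ?B"
    then obtain k l where b: "b = adj (\<alpha> (u k l))" "k < n" "l < n" by auto
    then have "\<sigma> b = S (adj (u k l))" by (simp add: \<sigma>_def alpha_adj_alpha urep_coef_P[OF u])
    then show "\<sigma> b \<in> cspan (coefs n u)" using antipode_adj_coef_span[OF u b(2,3)] by simp
  qed
  have 2: "\<sigma> a \<in> cspan ?B"
  proof (rule sigma.span_mem[OF a coefs_P[OF u] cs.subspace_span])
    fix b assume "b \<in> coefs n u"
    then obtain k l where b: "b = u k l" "k < n" "l < n" by (auto simp: coefs_def)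
    have "adj (S (\<alpha> (u k l))) \<in> cspan {\<alpha> (u k l) | k l. k \<in> {..<n} \<and> l \<in> {..<n}}"
      using b adj_antipode_corep_span[OF corep_alpha[OF urep_corep[OF u]]] by auto
    from adj_span[OF this] show "\<sigma> b \<in> cspan ?B" by (simp add: adj_adj \<sigma>_def b)
  qed
  show ?thesis by (rule 1[OF 2])
qed

end

section \<open>Semi-inner products and completion\<close>

locale semi_inner_space = vector_space sc
  for sc :: "complex \<Rightarrow> 'v::ab_group_add \<Rightarrow> 'v" +
  fixes V :: "'v set" and q :: "'v \<Rightarrow> 'v \<Rightarrow> complex"
  assumes subV: "subspace V"
    and q_add_right: "\<lbrakk>x \<in> V; y \<in> V; z \<in> V\<rbrakk> \<Longrightarrow> q x (y + z) = q x y + q x z"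
    and q_scale_right: "\<lbrakk>x \<in> V; y \<in> V\<rbrakk> \<Longrightarrow> q x (sc c y) = c * q x y"
    and q_commute: "\<lbrakk>x \<in> V; y \<in> V\<rbrakk> \<Longrightarrow> q y x = cnj (q x y)"
    and q_nonneg: "x \<in> V \<Longrightarrow> 0 \<le> Re (q x x)"
begin

lemmas V_zero = subspace_0[OF subV]
  and V_add = subspace_add[OF subV]
  and V_diff = subspace_diff[OF subV]
  and V_scale = subspace_scale[OF subV]

definition nrm :: "'v \<Rightarrow> real" where "nrm x = sqrt (Re (q x x))"

lemma q_right: "x \<in> V \<Longrightarrow> clinear_on V sc (*) (q x)"
  by (rule clinear_onI) (simp_all add: q_add_right q_scale_right)

lemma clinear_map_q: "x \<in> V \<Longrightarrow> clinear_map_on sc (*) V (q x)"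
  by (intro clinear_map_on.intro clinear_map_on_axioms.intro q_right subV vector_space_axioms
      vector_space_times)

lemma q_zero_right: "x \<in> V \<Longrightarrow> q x 0 = 0"
  and q_diff_right: "\<lbrakk>x \<in> V; y \<in> V; z \<in> V\<rbrakk> \<Longrightarrow> q x (y - z) = q x y - q x z"
  using clinear_map_on.zero[OF clinear_map_q] clinear_map_on.diff[OF clinear_map_q] by blast+

lemma q_add_left: "\<lbrakk>x \<in> V; y \<in> V; z \<in> V\<rbrakk> \<Longrightarrow> q (x + y) z = q x z + q y z"
  using q_commute[of z "x + y"] q_commute[of z x] q_commute[of z y] by (simp add: V_add q_add_right)

lemma q_diff_left: "\<lbrakk>x \<in> V; y \<in> V; z \<in> V\<rbrakk> \<Longrightarrow> q (x - y) z = q x z - q y z"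
  using q_commute[of z "x - y"] q_commute[of z x] q_commute[of z y] by (simp add: V_diff q_diff_right)

lemma q_scale_left: "\<lbrakk>x \<in> V; y \<in> V\<rbrakk> \<Longrightarrow> q (sc c x) y = cnj c * q x y"
  using q_commute[of y "sc c x"] q_commute[of y x] by (simp add: V_scale q_scale_right)

lemma nrm_ge_0: "0 \<le> nrm x" if "x \<in> V"
  using q_nonneg[OF that] by (simp add: nrm_def)

lemma nrm_sq: "x \<in> V \<Longrightarrow> (nrm x)\<^sup>2 = Re (q x x)"
  using q_nonneg by (simp add: nrm_def)

lemma q_self: "x \<in> V \<Longrightarrow> q x x = complex_of_real ((nrm x)\<^sup>2)"
  using q_commute[of x x] by (simp add: nrm_sq complex_eq_iff)

lemma nrm_scale: "x \<in> V \<Longrightarrow> nrm (sc c x) = cmod c * nrm x"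
proof -
  assume x: "x \<in> V"
  have "q (sc c x) (sc c x) = (c * cnj c) * complex_of_real ((nrm x)\<^sup>2)"
    using x by (simp add: q_scale_left q_scale_right V_scale) (simp add: q_self)
  also have "\<dots> = complex_of_real ((cmod c * nrm x)\<^sup>2)"
    by (simp add: complex_norm_square[symmetric] power_mult_distrib)
  finally have "Re (q (sc c x) (sc c x)) = (cmod c * nrm x)\<^sup>2" by simp
  then show ?thesis using nrm_ge_0[OF x] by (simp add: nrm_def)
qed

lemma nrm_zero: "nrm 0 = 0"
  using q_zero_right[OF V_zero] by (simp add: nrm_def)

lemma nrm_minus_commute: "x \<in> V \<Longrightarrow> y \<in> V \<Longrightarrow> nrm (x - y) = nrm (y - x)"
  using nrm_scale[of "x - y" "-1"] by (simp add: V_diff)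

lemma nrm_add_sq: "x \<in> V \<Longrightarrow> y \<in> V \<Longrightarrow> (nrm (x + y))\<^sup>2 = (nrm x)\<^sup>2 + 2 * Re (q x y) + (nrm y)\<^sup>2"
  using q_commute[of x y] by (simp add: nrm_sq V_add q_add_left q_add_right)

lemma nrm_diff_sq: "x \<in> V \<Longrightarrow> y \<in> V \<Longrightarrow> (nrm (x - y))\<^sup>2 = (nrm x)\<^sup>2 - 2 * Re (q x y) + (nrm y)\<^sup>2"
  using q_commute[of x y] by (simp add: nrm_sq V_diff q_diff_left q_diff_right)

text \<open>For \<open>\<delta> = 0\<close> this is the Cauchy--Schwarz inequality; a positive \<open>\<delta>\<close> serves for minimizing sequences.\<close>

lemma cauchy_schwarz_deficit:
  assumes V: "z \<in> V" "d \<in> V" and \<delta>: "\<And>c. \<delta> \<le> (nrm (z - sc c d))\<^sup>2"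
  shows "(cmod (q d z))\<^sup>2 \<le> ((nrm z)\<^sup>2 - \<delta>) * (nrm d)\<^sup>2"
proof -
  let ?b = "q d z"
  have *: "\<delta> \<le> (nrm z)\<^sup>2 - 2 * s * (cmod ?b)\<^sup>2 + s\<^sup>2 * (cmod ?b)\<^sup>2 * (nrm d)\<^sup>2" for s :: real
  proof -
    have "q z (sc (s * ?b) d) = complex_of_real s * (?b * cnj ?b)"
      using V q_commute[of d z] by (simp add: q_scale_right)
    then have "Re (q z (sc (s * ?b) d)) = s * (cmod ?b)\<^sup>2"
      by (simp add: complex_norm_square[symmetric] del: of_real_power)
    then show ?thesis using V \<delta>[of "s * ?b"]
      by (simp add: nrm_diff_sq V_scale nrm_scale norm_mult power_mult_distrib mult_ac)
  qed
  show ?thesis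
  proof (cases "nrm d = 0")
    case True
    have "cmod ?b = 0"
    proof (rule ccontr)
      assume b: "cmod ?b \<noteq> 0"
      \<comment> \<open>For d of norm zero the bound is affine in s; this s makes its right side
        equal to \<open>\<delta> - 1\<close>.\<close>
      define s where "s = ((nrm z)\<^sup>2 - \<delta> + 1) / (2 * (cmod ?b)\<^sup>2)"
      have "2 * s * (cmod ?b)\<^sup>2 = (nrm z)\<^sup>2 - \<delta> + 1" using b by (simp add: s_def)
      then show False using *[of s] True by simp
    qed
    then show ?thesis using True by simp
  next
    case False
    define A where "A = (nrm d)\<^sup>2"
    have A: "A > 0" using False by (simp add: A_def)
    \<comment> \<open>The value 1 / A minimizes the quadratic polynomial in s.\<close>
    have "\<delta> \<le> (nrm z)\<^sup>2 - 2 * (1 / A) * (cmod ?b)\<^sup>2 + (1 / A)\<^sup>2 * (cmod ?b)\<^sup>2 * A"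
      using *[of "1 / A"] by (simp add: A_def)
    also have "\<dots> = (nrm z)\<^sup>2 - (cmod ?b)\<^sup>2 / A"
      using A by (simp add: field_simps power2_eq_square)
    finally have "(cmod ?b)\<^sup>2 / A \<le> (nrm z)\<^sup>2 - \<delta>" by simp
    then show ?thesis using A by (simp add: A_def[symmetric] field_simps)
  qed
qed

lemma cauchy_schwarz: assumes "x \<in> V" "y \<in> V" shows "cmod (q x y) \<le> nrm x * nrm y"
proof -
  have "(cmod (q x y))\<^sup>2 \<le> ((nrm y)\<^sup>2 - 0) * (nrm x)\<^sup>2"
    by (rule cauchy_schwarz_deficit) (use assms in auto)
  then have "(cmod (q x y))\<^sup>2 \<le> (nrm x * nrm y)\<^sup>2" by (simp add: power_mult_distrib mult.commute)
  then show ?thesis using nrm_ge_0 assms by (auto intro: power2_le_imp_le)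
qed

lemma nrm_triangle: assumes "x \<in> V" "y \<in> V" shows "nrm (x + y) \<le> nrm x + nrm y"
proof -
  have "Re (q x y) \<le> nrm x * nrm y"
    using cauchy_schwarz[OF assms] complex_Re_le_cmod order_trans by blast
  then have "(nrm (x + y))\<^sup>2 \<le> (nrm x + nrm y)\<^sup>2"
    using nrm_add_sq[OF assms] by (simp add: power2_sum)
  then show ?thesis using nrm_ge_0 assms by (auto intro: power2_le_imp_le)
qed

lemma nrm_triangle_diff:
  "x \<in> V \<Longrightarrow> y \<in> V \<Longrightarrow> z \<in> V \<Longrightarrow> nrm (x - z) \<le> nrm (x - y) + nrm (y - z)"
  using nrm_triangle[of "x - y" "y - z"] by (simp add: V_diff)

lemma nrm_reverse_triangle: "x \<in> V \<Longrightarrow> y \<in> V \<Longrightarrow> \<bar>nrm x - nrm y\<bar> \<le> nrm (x - y)"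
  using nrm_triangle[of "x - y" y] nrm_triangle[of "y - x" x] nrm_minus_commute[of x y]
  by (simp add: V_diff)

definition cseq :: "(nat \<Rightarrow> 'v) \<Rightarrow> bool" where
  "cseq X \<longleftrightarrow> (\<forall>n. X n \<in> V) \<and> (\<forall>e>0. \<exists>M. \<forall>m\<ge>M. \<forall>n\<ge>M. nrm (X m - X n) < e)"

lemma cseq_V: "cseq X \<Longrightarrow> X n \<in> V"
  by (simp add: cseq_def)

lemma cseqD: "cseq X \<Longrightarrow> e > 0 \<Longrightarrow> \<exists>M. \<forall>m\<ge>M. \<forall>n\<ge>M. nrm (X m - X n) < e"
  by (simp add: cseq_def)

lemma cseq_const: "v \<in> V \<Longrightarrow> cseq (\<lambda>_. v)"
  by (auto simp: cseq_def nrm_zero)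

lemma cseq_add:
  assumes "cseq X" "cseq Y" shows "cseq (\<lambda>n. X n + Y n)"
  unfolding cseq_def
proof (intro conjI allI impI)
  fix e :: real assume "e > 0"
  then have "e / 2 > 0" by simp
  from cseqD[OF assms(1) this] cseqD[OF assms(2) this] obtain M N
    where M: "\<And>m n. m \<ge> M \<Longrightarrow> n \<ge> M \<Longrightarrow> nrm (X m - X n) < e / 2"
      and N: "\<And>m n. m \<ge> N \<Longrightarrow> n \<ge> N \<Longrightarrow> nrm (Y m - Y n) < e / 2" by blast
  show "\<exists>M. \<forall>m\<ge>M. \<forall>n\<ge>M. nrm (X m + Y m - (X n + Y n)) < e"
  proof (intro exI[of _ "max M N"] allI impI)
    fix m n assume "m \<ge> max M N" "n \<ge> max M N"
    then have "nrm (X m - X n) < e / 2" "nrm (Y m - Y n) < e / 2" using M N by auto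
    moreover have "nrm ((X m - X n) + (Y m - Y n)) \<le> nrm (X m - X n) + nrm (Y m - Y n)"
      by (intro nrm_triangle V_diff cseq_V assms)
    ultimately show "nrm (X m + Y m - (X n + Y n)) < e" by (simp add: algebra_simps)
  qed
qed (intro V_add cseq_V assms)

lemma cseq_lipschitz:
  assumes "cseq X" and "\<And>n. Y n \<in> V"
    and "\<And>m n. nrm (Y m - Y n) \<le> K * nrm (X m - X n)"
  shows "cseq Y"
  unfolding cseq_def
proof (intro conjI allI impI)
  fix e :: real assume "e > 0"
  \<comment> \<open>The constant K may be zero or negative, whence the denominator.\<close>
  then have "e / (\<bar>K\<bar> + 1) > 0" by simp
  from cseqD[OF assms(1) this] obtain M
    where M: "\<And>m n. m \<ge> M \<Longrightarrow> n \<ge> M \<Longrightarrow> nrm (X m - X n) < e / (\<bar>K\<bar> + 1)" by blast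
  show "\<exists>M. \<forall>m\<ge>M. \<forall>n\<ge>M. nrm (Y m - Y n) < e"
  proof (intro exI[of _ M] allI impI)
    fix m n assume mn: "m \<ge> M" "n \<ge> M"
    have "nrm (Y m - Y n) \<le> K * nrm (X m - X n)" by (rule assms(3))
    also have "\<dots> \<le> (\<bar>K\<bar> + 1) * nrm (X m - X n)"
      using nrm_ge_0[OF V_diff] cseq_V[OF assms(1)] by (intro mult_right_mono) auto
    also have "\<dots> < (\<bar>K\<bar> + 1) * (e / (\<bar>K\<bar> + 1))"
      using M[OF mn] by (intro mult_strict_left_mono) auto
    also have "\<dots> = e" by simp
    finally show "nrm (Y m - Y n) < e" .
  qed
qed (use assms in auto)

lemma cseq_scale: "cseq X \<Longrightarrow> cseq (\<lambda>n. sc c (X n))"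
proof (rule cseq_lipschitz[where K="cmod c"])
  show "nrm (sc c (X m) - sc c (X n)) \<le> cmod c * nrm (X m - X n)" if "cseq X" for m n
    using nrm_scale[of "X m - X n" c] V_diff cseq_V[OF that] by (simp add: scale_right_diff_distrib)
qed (auto simp: V_scale cseq_V)

lemma cseq_diff: "cseq X \<Longrightarrow> cseq Y \<Longrightarrow> cseq (\<lambda>n. X n - Y n)"
  using cseq_add[of X "\<lambda>n. sc (-1) (Y n)"] cseq_scale[of Y "-1"] by simp

lemma cseq_bounded:
  assumes "cseq X" obtains K where "K > 0" "\<And>n. nrm (X n) \<le> K"
proof -
  have "Cauchy (\<lambda>n. nrm (X n))"
  proof (rule CauchyI)
    fix e :: real assume "e > 0"
    from cseqD[OF assms this] show "\<exists>M. \<forall>m\<ge>M. \<forall>n\<ge>M. norm (nrm (X m) - nrm (X n)) < e"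
      using order_le_less_trans[OF nrm_reverse_triangle[OF cseq_V[OF assms] cseq_V[OF assms]]]
      unfolding real_norm_def by blast
  qed
  then have "Bseq (\<lambda>n. nrm (X n))" by (rule Cauchy_Bseq)
  then obtain K where "K > 0" "\<And>n. norm (nrm (X n)) \<le> K" by (auto simp: Bseq_def)
  then show ?thesis using that[of K] by (simp add: abs_le_iff)
qed

lemma q_diff_bound:
  assumes "x \<in> V" "y \<in> V" "x' \<in> V" "y' \<in> V"
  shows "cmod (q x y - q x' y') \<le> nrm (x - x') * nrm y + nrm x' * nrm (y - y')"
proof -
  have "q x y - q x' y' = q (x - x') y + q x' (y - y')"
    using assms by (simp add: q_diff_left q_diff_right)
  then show ?thesis
    using assms by (auto intro!: norm_triangle_le add_mono cauchy_schwarz V_diff)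
qed

lemma q_convergent:
  assumes "cseq X" "cseq Y" shows "convergent (\<lambda>n. q (X n) (Y n))"
proof (rule Cauchy_convergent, rule CauchyI)
  fix e :: real assume e: "e > 0"
  obtain K L where K: "K > 0" "\<And>n. nrm (X n) \<le> K" and L: "L > 0" "\<And>n. nrm (Y n) \<le> L"
    using cseq_bounded assms by metis
  have "e / (2 * L) > 0" "e / (2 * K) > 0" using K L e by simp_all
  then obtain M N where M: "\<And>m n. m \<ge> M \<Longrightarrow> n \<ge> M \<Longrightarrow> nrm (X m - X n) < e / (2 * L)"
      and N: "\<And>m n. m \<ge> N \<Longrightarrow> n \<ge> N \<Longrightarrow> nrm (Y m - Y n) < e / (2 * K)"
    using cseqD[OF assms(1)] cseqD[OF assms(2)] by meson
  show "\<exists>M. \<forall>m\<ge>M. \<forall>n\<ge>M. cmod (q (X m) (Y m) - q (X n) (Y n)) < e"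
  proof (intro exI[of _ "max M N"] allI impI)
    fix m n assume mn: "m \<ge> max M N" "n \<ge> max M N"
    have "cmod (q (X m) (Y m) - q (X n) (Y n)) \<le> nrm (X m - X n) * nrm (Y m) + nrm (X n) * nrm (Y m - Y n)"
      by (intro q_diff_bound cseq_V assms)
    also have "\<dots> \<le> nrm (X m - X n) * L + K * nrm (Y m - Y n)"
      using K L cseq_V[OF assms(1)] cseq_V[OF assms(2)]
      by (intro add_mono mult_left_mono mult_right_mono nrm_ge_0 V_diff) auto
    also have "\<dots> < (e / (2 * L)) * L + K * (e / (2 * K))"
      using M N mn K L by (intro add_strict_mono mult_strict_left_mono mult_strict_right_mono) auto
    also have "\<dots> = e" using K L by simp
    finally show "cmod (q (X m) (Y m) - q (X n) (Y n)) < e" .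
  qed
qed

lemma tendsto_q:
  assumes V: "\<And>n. X n \<in> V" "\<And>n. Y n \<in> V" "x \<in> V" "y \<in> V"
    and lim: "(\<lambda>n. nrm (X n - x)) \<longlonglongrightarrow> 0" "(\<lambda>n. nrm (Y n - y)) \<longlonglongrightarrow> 0"
  shows "(\<lambda>n. q (X n) (Y n)) \<longlonglongrightarrow> q x y"
proof (rule Lim_null_comparison[THEN LIM_zero_cancel])
  show "\<forall>\<^sub>F n in sequentially. norm (q (X n) (Y n) - q x y)
      \<le> nrm (X n - x) * (nrm (Y n - y) + nrm y) + nrm x * nrm (Y n - y)"
  proof (intro always_eventually allI)
    fix n
    have "nrm (Y n) \<le> nrm (Y n - y) + nrm y" using nrm_triangle[of "Y n - y" y] V by (simp add: V_diff)
    then have "nrm (X n - x) * nrm (Y n) \<le> nrm (X n - x) * (nrm (Y n - y) + nrm y)"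
      by (intro mult_left_mono nrm_ge_0 V_diff V)
    then show "norm (q (X n) (Y n) - q x y)
      \<le> nrm (X n - x) * (nrm (Y n - y) + nrm y) + nrm x * nrm (Y n - y)"
      using q_diff_bound[of "X n" "Y n" x y] V by simp
  qed
  have "(\<lambda>n. nrm (X n - x) * (nrm (Y n - y) + nrm y) + nrm x * nrm (Y n - y))
      \<longlonglongrightarrow> 0 * (0 + nrm y) + nrm x * 0"
    by (intro tendsto_intros lim)
  then show "(\<lambda>n. nrm (X n - x) * (nrm (Y n - y) + nrm y) + nrm x * nrm (Y n - y)) \<longlonglongrightarrow> 0" by simp
qed

lemma convergent_imp_cseq:
  assumes V: "\<And>n. X n \<in> V" "x \<in> V" and lim: "(\<lambda>n. nrm (X n - x)) \<longlonglongrightarrow> 0"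
  shows "cseq X"
  unfolding cseq_def
proof (intro conjI allI impI)
  fix e :: real assume "e > 0"
  then have "\<exists>M. \<forall>n\<ge>M. norm (nrm (X n - x) - 0) < e / 2"
    using lim by (intro LIMSEQ_D) auto
  then have "\<exists>M. \<forall>n\<ge>M. \<bar>nrm (X n - x)\<bar> < e / 2" by simp
  then obtain M where M: "\<And>n. n \<ge> M \<Longrightarrow> nrm (X n - x) < e / 2"
    using abs_ge_self order_le_less_trans by blast
  show "\<exists>M. \<forall>m\<ge>M. \<forall>n\<ge>M. nrm (X m - X n) < e"
  proof (intro exI[of _ M] allI impI)
    fix m n assume "m \<ge> M" "n \<ge> M"
    then show "nrm (X m - X n) < e"
      using M[of m] M[of n] nrm_triangle_diff[of "X m" x "X n"] nrm_minus_commute[of x "X n"] V by simp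
  qed
qed (use V in auto)

text \<open>Freeze one argument at a large index M: <Z n, Z n> = <Z M, Z n> + <Z n - Z M, Z n>,
  where the first term tends to 0 by hypothesis and the second is small uniformly in large n. This
  is why a Cauchy sequence is determined, up to a null sequence, by its limiting functional.\<close>

lemma weakly_null_cseq:
  assumes Z: "cseq Z" and 0: "\<And>a. a \<in> V \<Longrightarrow> (\<lambda>n. q a (Z n)) \<longlonglongrightarrow> 0"
  shows "(\<lambda>n. nrm (Z n)) \<longlonglongrightarrow> 0"
proof -
  obtain K where K: "K > 0" "\<And>n. nrm (Z n) \<le> K" using cseq_bounded[OF Z] by blast
  have "(\<lambda>n. (nrm (Z n))\<^sup>2) \<longlonglongrightarrow> 0"
  proof (rule LIMSEQ_I)
    fix e :: real assume e: "e > 0"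
    then have "e / (2 * K) > 0" using K by simp
    then obtain M where M: "\<And>m n. m \<ge> M \<Longrightarrow> n \<ge> M \<Longrightarrow> nrm (Z m - Z n) < e / (2 * K)"
      using cseqD[OF Z] by blast
    have "\<exists>N. \<forall>n\<ge>N. norm (q (Z M) (Z n) - 0) < e / 2"
      using 0[OF cseq_V[OF Z]] e by (intro LIMSEQ_D) auto
    then obtain N where N: "\<And>n. n \<ge> N \<Longrightarrow> cmod (q (Z M) (Z n)) < e / 2" by auto
    show "\<exists>no. \<forall>n\<ge>no. norm ((nrm (Z n))\<^sup>2 - 0) < e"
    proof (intro exI[of _ "max M N"] allI impI)
      fix n assume n: "n \<ge> max M N"
      have "(nrm (Z n))\<^sup>2 = cmod (q (Z n) (Z n))"
        using cseq_V[OF Z] by (simp add: q_self norm_power)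
      also have "q (Z n) (Z n) = q (Z M) (Z n) + q (Z n - Z M) (Z n)"
        using cseq_V[OF Z] by (simp add: q_diff_left)
      also have "cmod \<dots> \<le> cmod (q (Z M) (Z n)) + nrm (Z n - Z M) * nrm (Z n)"
        by (intro norm_triangle_le add_mono order_refl cauchy_schwarz V_diff cseq_V[OF Z])
      also have "\<dots> \<le> cmod (q (Z M) (Z n)) + nrm (Z n - Z M) * K"
        by (intro add_mono mult_left_mono order_refl K nrm_ge_0 V_diff cseq_V[OF Z])
      also have "\<dots> < e / 2 + (e / (2 * K)) * K"
        using N[of n] M[of n M] n K by (intro add_strict_mono mult_strict_right_mono) auto
      also have "\<dots> = e" using K by simp
      finally show "norm ((nrm (Z n))\<^sup>2 - 0) < e" by simp
    qed
  qed
  then have "(\<lambda>n. sqrt ((nrm (Z n))\<^sup>2)) \<longlonglongrightarrow> sqrt 0" by (rule tendsto_real_sqrt)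
  then show ?thesis using nrm_ge_0[OF cseq_V[OF Z]] by simp
qed

end

section \<open>Completion of a semi-inner space inside its space of functions\<close>

context semi_inner_space
begin

text \<open>A Cauchy sequence is recorded as the antilinear functional of its limit. Equivalent
  sequences give the same function, so null vectors disappear without forming a quotient; the value
  0 outside V makes equality of functions the right notion. The elements also have the type that the
  cocycle predicates prescribe.\<close>

definition completion_of :: "(nat \<Rightarrow> 'v) \<Rightarrow> 'v \<Rightarrow> complex" where
  "completion_of X = (\<lambda>a. if a \<in> V then lim (\<lambda>n. q a (X n)) else 0)"

definition completion :: "('v \<Rightarrow> complex) set" where
  "completion = completion_of ` {X. cseq X}"

text \<open>The representing sequences are chosen arbitrarily; \<open>completion_ip_tendsto\<close>
  shows that the limit does not depend on the choice.\<close>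

definition completion_ip :: "('v \<Rightarrow> complex) \<Rightarrow> ('v \<Rightarrow> complex) \<Rightarrow> complex" where
  "completion_ip f g = lim (\<lambda>n. q ((SOME X. cseq X \<and> completion_of X = f) n)
     ((SOME X. cseq X \<and> completion_of X = g) n))"

definition embed :: "'v \<Rightarrow> 'v \<Rightarrow> complex" where
  "embed v = completion_of (\<lambda>_. v)"

lemma completion_of_tendsto:
  "cseq X \<Longrightarrow> a \<in> V \<Longrightarrow> (\<lambda>n. q a (X n)) \<longlonglongrightarrow> completion_of X a"
  using q_convergent[of "\<lambda>_. a" X] cseq_const by (simp add: completion_of_def convergent_LIMSEQ_iff)

lemma completion_of_eqI:
  assumes "\<And>a. a \<in> V \<Longrightarrow> (\<lambda>n. q a (X n)) \<longlonglongrightarrow> f a" "\<And>a. a \<notin> V \<Longrightarrow> f a = 0"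
  shows "completion_of X = f"
  using assms by (auto simp: completion_of_def fun_eq_iff intro: limI)

lemma completion_of_outside: "a \<notin> V \<Longrightarrow> completion_of X a = 0"
  by (simp add: completion_of_def)

lemma completion_of_add:
  "cseq X \<Longrightarrow> cseq Y \<Longrightarrow> completion_of (\<lambda>n. X n + Y n) = completion_of X + completion_of Y"
  by (rule completion_of_eqI)
    (simp_all add: q_add_right cseq_V completion_of_outside tendsto_add completion_of_tendsto)

lemma completion_of_scale:
  "cseq X \<Longrightarrow> completion_of (\<lambda>n. sc c (X n)) = fun_scale c (completion_of X)"
  by (rule completion_of_eqI)
    (simp_all add: q_scale_right cseq_V completion_of_outside fun_scale_def tendsto_mult completion_of_tendsto)

lemma completion_of_diff:
  assumes "cseq X" "cseq Y" shows "completion_of (\<lambda>n. X n - Y n) = completion_of X - completion_of Y"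
  by (rule completion_of_eqI)
    (simp_all add: q_diff_right cseq_V assms completion_of_outside tendsto_diff completion_of_tendsto)

lemma completion_of_eq_iff:
  assumes "cseq X" "cseq Y"
  shows "completion_of X = completion_of Y \<longleftrightarrow> (\<lambda>n. nrm (X n - Y n)) \<longlonglongrightarrow> 0"
proof
  assume "completion_of X = completion_of Y"
  then have 0: "completion_of (\<lambda>n. X n - Y n) = 0" by (simp add: completion_of_diff[OF assms])
  show "(\<lambda>n. nrm (X n - Y n)) \<longlonglongrightarrow> 0"
    using completion_of_tendsto[OF cseq_diff[OF assms]] 0
    by (intro weakly_null_cseq cseq_diff assms) simp
next
  assume *: "(\<lambda>n. nrm (X n - Y n)) \<longlonglongrightarrow> 0"
  have "completion_of (\<lambda>n. X n - Y n) = 0"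
  proof (rule completion_of_eqI)
    fix a assume a: "a \<in> V"
    have "(\<lambda>n. q a (X n - Y n)) \<longlonglongrightarrow> q a 0"
      using a * by (intro tendsto_q) (simp_all add: nrm_zero V_zero V_diff cseq_V assms)
    then show "(\<lambda>n. q a (X n - Y n)) \<longlonglongrightarrow> 0 a" using a by (simp add: q_zero_right)
  qed simp
  then show "completion_of X = completion_of Y" by (simp add: completion_of_diff[OF assms])
qed

lemma completion_ip_tendsto:
  assumes X: "cseq X" and Y: "cseq Y"
  shows "(\<lambda>n. q (X n) (Y n)) \<longlonglongrightarrow> completion_ip (completion_of X) (completion_of Y)"
proof -
  define X' where "X' = (SOME Z. cseq Z \<and> completion_of Z = completion_of X)"
  define Y' where "Y' = (SOME Z. cseq Z \<and> completion_of Z = completion_of Y)"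
  have X': "cseq X'" "completion_of X' = completion_of X"
    using someI[of "\<lambda>Z. cseq Z \<and> completion_of Z = completion_of X" X] X unfolding X'_def by auto
  have Y': "cseq Y'" "completion_of Y' = completion_of Y"
    using someI[of "\<lambda>Z. cseq Z \<and> completion_of Z = completion_of Y" Y] Y unfolding Y'_def by auto
  obtain K where K: "\<And>n. nrm (Y n) \<le> K" using cseq_bounded[OF Y] by blast
  obtain L where L: "\<And>n. nrm (X' n) \<le> L" using cseq_bounded[OF X'(1)] by blast
  have "(\<lambda>n. q (X n) (Y n) - q (X' n) (Y' n)) \<longlonglongrightarrow> 0"
  proof (rule Lim_null_comparison)
    show "\<forall>\<^sub>F n in sequentially. norm (q (X n) (Y n) - q (X' n) (Y' n))
        \<le> nrm (X n - X' n) * K + L * nrm (Y n - Y' n)"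
    proof (intro always_eventually allI)
      fix n
      have "norm (q (X n) (Y n) - q (X' n) (Y' n)) \<le> nrm (X n - X' n) * nrm (Y n) + nrm (X' n) * nrm (Y n - Y' n)"
        by (intro q_diff_bound cseq_V X Y X' Y')
      also have "\<dots> \<le> nrm (X n - X' n) * K + L * nrm (Y n - Y' n)"
        by (intro add_mono mult_left_mono mult_right_mono K L nrm_ge_0 V_diff cseq_V X Y X' Y')
      finally show "norm (q (X n) (Y n) - q (X' n) (Y' n)) \<le> nrm (X n - X' n) * K + L * nrm (Y n - Y' n)" .
    qed
    have "(\<lambda>n. nrm (X n - X' n) * K + L * nrm (Y n - Y' n)) \<longlonglongrightarrow> 0 * K + L * 0"
      using X X' Y Y' by (intro tendsto_intros) (simp_all add: completion_of_eq_iff[symmetric])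
    then show "(\<lambda>n. nrm (X n - X' n) * K + L * nrm (Y n - Y' n)) \<longlonglongrightarrow> 0" by simp
  qed
  moreover have "(\<lambda>n. q (X' n) (Y' n)) \<longlonglongrightarrow> completion_ip (completion_of X) (completion_of Y)"
    using q_convergent[OF X'(1) Y'(1)]
    unfolding convergent_LIMSEQ_iff completion_ip_def X'_def[symmetric] Y'_def[symmetric] .
  ultimately have "(\<lambda>n. (q (X n) (Y n) - q (X' n) (Y' n)) + q (X' n) (Y' n))
      \<longlonglongrightarrow> 0 + completion_ip (completion_of X) (completion_of Y)" by (rule tendsto_add)
  then show ?thesis by simp
qed

lemma completion_ip_eqI:
  "cseq X \<Longrightarrow> cseq Y \<Longrightarrow> (\<lambda>n. q (X n) (Y n)) \<longlonglongrightarrow> l \<Longrightarrow> completion_ip (completion_of X) (completion_of Y) = l"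
  using completion_ip_tendsto LIMSEQ_unique by blast

lemma completion_ip_embed: "a \<in> V \<Longrightarrow> cseq X \<Longrightarrow> completion_ip (embed a) (completion_of X) = completion_of X a"
  unfolding embed_def by (intro completion_ip_eqI cseq_const completion_of_tendsto)

lemma embed_apply: "a \<in> V \<Longrightarrow> v \<in> V \<Longrightarrow> embed v a = q a v"
  unfolding embed_def by (simp add: completion_of_def)

lemma embed_outside: "a \<notin> V \<Longrightarrow> embed v a = 0"
  unfolding embed_def by (rule completion_of_outside)

lemma completion_ip_embed_embed: "a \<in> V \<Longrightarrow> b \<in> V \<Longrightarrow> completion_ip (embed a) (embed b) = q a b"
  using completion_ip_embed[of a "\<lambda>_. b"] cseq_const[of b] embed_apply[of a b] by (simp add: embed_def)

lemma embed_completion: "v \<in> V \<Longrightarrow> embed v \<in> completion"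
  unfolding completion_def embed_def using cseq_const by blast

lemma embed_linear: "clinear_on V sc fun_scale embed"
  by (rule clinear_onI)
    (simp_all add: embed_def completion_of_add completion_of_scale cseq_const)

lemma completionE:
  assumes "f \<in> completion" obtains X where "cseq X" "f = completion_of X"
  using assms unfolding completion_def by blast

lemma semi_inner_space_completion: "semi_inner_space fun_scale completion completion_ip"
proof (unfold_locales)
  show "fs.subspace completion"
    unfolding fs.subspace_def
  proof (intro conjI ballI allI)
    have "embed 0 = 0" by (auto simp: fun_eq_iff embed_def completion_of_def q_zero_right)
    then show "0 \<in> completion" using embed_completion[OF V_zero] by simp
    show "x + y \<in> completion" if "x \<in> completion" "y \<in> completion" for x y
      using that by (elim completionE) (auto simp: completion_def completion_of_add[symmetric] cseq_add)
    show "fun_scale c x \<in> completion" if "x \<in> completion" for c x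
      using that by (elim completionE) (auto simp: completion_def completion_of_scale[symmetric] cseq_scale)
  qed
  fix x y assume "x \<in> completion" "y \<in> completion"
  then obtain X Y where X: "cseq X" "x = completion_of X" and Y: "cseq Y" "y = completion_of Y"
    by (elim completionE)
  show "completion_ip x (fun_scale c y) = c * completion_ip x y" for c
  proof -
    have "(\<lambda>n. q (X n) (sc c (Y n))) \<longlonglongrightarrow> c * completion_ip x y"
      unfolding X(2) Y(2) using X Y
      by (simp add: q_scale_right cseq_V tendsto_mult completion_ip_tendsto)
    then show ?thesis
      unfolding X(2) Y(2) completion_of_scale[OF Y(1), symmetric]
      by (intro completion_ip_eqI X Y cseq_scale)
  qed
  show "completion_ip y x = cnj (completion_ip x y)"
  proof -
    have "(\<lambda>n. cnj (q (X n) (Y n))) \<longlonglongrightarrow> cnj (completion_ip x y)"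
      unfolding X(2) Y(2) using X Y by (intro tendsto_cnj completion_ip_tendsto)
    then show ?thesis
      unfolding X(2) Y(2) using X Y
      by (intro completion_ip_eqI) (simp_all add: q_commute[OF cseq_V[OF X(1)] cseq_V[OF Y(1)]])
  qed
next
  fix x y z assume "x \<in> completion" "y \<in> completion" "z \<in> completion"
  then obtain X Y Z where X: "cseq X" "x = completion_of X" and Y: "cseq Y" "y = completion_of Y"
    and Z: "cseq Z" "z = completion_of Z"
    by (elim completionE)
  have "(\<lambda>n. q (X n) (Y n + Z n)) \<longlonglongrightarrow> completion_ip x y + completion_ip x z"
    unfolding X(2) Y(2) Z(2) using X Y Z
    by (simp add: q_add_right cseq_V tendsto_add completion_ip_tendsto)
  then show "completion_ip x (y + z) = completion_ip x y + completion_ip x z"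
    unfolding X(2) Y(2) Z(2) completion_of_add[OF Y(1) Z(1), symmetric]
    by (intro completion_ip_eqI X Y Z cseq_add)
next
  fix x assume "x \<in> completion"
  then obtain X where X: "cseq X" "x = completion_of X" by (elim completionE)
  have "(\<lambda>n. Re (q (X n) (X n))) \<longlonglongrightarrow> Re (completion_ip x x)"
    unfolding X(2) using X(1) by (intro tendsto_Re completion_ip_tendsto)
  then show "0 \<le> Re (completion_ip x x)"
    by (rule LIMSEQ_le_const) (use q_nonneg cseq_V[OF X(1)] in auto)
qed

interpretation comp: semi_inner_space fun_scale completion completion_ip
  by (rule semi_inner_space_completion)

lemma completion_norm_tendsto:
  assumes X: "cseq X" shows "(\<lambda>n. nrm (X n)) \<longlonglongrightarrow> comp.nrm (completion_of X)"
  unfolding nrm_def comp.nrm_def by (intro tendsto_real_sqrt tendsto_Re completion_ip_tendsto X)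

lemma completion_norm_embed: "v \<in> V \<Longrightarrow> comp.nrm (embed v) = nrm v"
  by (simp add: comp.nrm_def nrm_def completion_ip_embed_embed)

lemma embed_diff: "u \<in> V \<Longrightarrow> v \<in> V \<Longrightarrow> embed u - embed v = embed (u - v)"
  unfolding embed_def by (rule completion_of_diff[symmetric]) (auto intro: cseq_const)

lemma embed_tendsto:
  assumes X: "cseq X"
  shows "(\<lambda>n. comp.nrm (embed (X n) - completion_of X)) \<longlonglongrightarrow> 0"
proof (rule LIMSEQ_I)
  fix e :: real assume e: "e > 0"
  then have "e / 2 > 0" by simp
  then obtain M where M: "\<And>m n. m \<ge> M \<Longrightarrow> n \<ge> M \<Longrightarrow> nrm (X m - X n) < e / 2" using cseqD[OF X] by blast
  show "\<exists>M. \<forall>n\<ge>M. norm (comp.nrm (embed (X n) - completion_of X) - 0) < e"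
  proof (intro exI[of _ M] allI impI)
    fix n assume n: "n \<ge> M"
    have *: "cseq (\<lambda>m. X n - X m)" by (intro cseq_diff cseq_const cseq_V X)
    have "embed (X n) - completion_of X = completion_of (\<lambda>m. X n - X m)"
      unfolding embed_def by (intro completion_of_diff[symmetric] cseq_const cseq_V X)
    moreover have "comp.nrm (completion_of (\<lambda>m. X n - X m)) \<le> e / 2"
      using M n by (intro LIMSEQ_le_const2[OF completion_norm_tendsto[OF *]]) (auto intro!: exI[of _ M] less_imp_le)
    moreover have "comp.nrm (completion_of (\<lambda>m. X n - X m)) \<ge> 0"
      using * by (intro comp.nrm_ge_0) (auto simp: completion_def)
    ultimately show "norm (comp.nrm (embed (X n) - completion_of X) - 0) < e" using e by simp
  qed
qed

lemma embed_dense: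
  assumes "f \<in> completion" "e > 0" obtains v where "v \<in> V" "comp.nrm (f - embed v) < e"
proof -
  obtain X where X: "cseq X" "f = completion_of X" using assms(1) by (rule completionE)
  have "\<exists>M. \<forall>n\<ge>M. norm (comp.nrm (embed (X n) - f) - 0) < e"
    using embed_tendsto[OF X(1)] X(2) assms(2) by (intro LIMSEQ_D) auto
  then obtain n where "norm (comp.nrm (embed (X n) - f) - 0) < e" by blast
  then have "comp.nrm (embed (X n) - f) < e" by simp
  then show ?thesis using that[of "X n"] comp.nrm_minus_commute[OF assms(1) embed_completion]
      cseq_V[OF X(1)] by simp
qed

text \<open>For completeness, the n-th member of a Cauchy sequence of functionals is replaced by an
  embedded vector \<open>v n\<close> at distance less than 1 / (n + 1). Then \<open>v\<close> is
  Cauchy in V, and its class is the limit.\<close>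

lemma complex_hilbert_space_completion: "complex_hilbert_space fun_scale completion completion_ip"
proof (unfold_locales)
  show "fs.subspace completion" by (rule comp.subV)
  fix x assume x: "x \<in> completion" "x \<noteq> 0"
  then obtain X where X: "cseq X" "x = completion_of X" by (elim completionE)
  have "comp.nrm x \<noteq> 0"
  proof
    assume "comp.nrm x = 0"
    then have "(\<lambda>n. nrm (X n - 0)) \<longlonglongrightarrow> 0" using completion_norm_tendsto[OF X(1)] X(2) by simp
    then have "completion_of X = completion_of (\<lambda>_. 0)"
      using completion_of_eq_iff[OF X(1) cseq_const[OF V_zero]] by simp
    moreover have "completion_of (\<lambda>_. 0) = 0"
      by (rule completion_of_eqI) (simp_all add: q_zero_right)
    ultimately show False using x(2) X(2) by simp
  qed
  then show "0 < Re (completion_ip x x)" using comp.q_nonneg[OF x(1)] by (simp add: comp.nrm_def)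
next
  fix X :: "nat \<Rightarrow> 'v \<Rightarrow> complex"
  assume X: "\<And>n. X n \<in> completion"
    and C: "\<forall>e>0. \<exists>M. \<forall>m\<ge>M. \<forall>n\<ge>M. sqrt (Re (completion_ip (X m - X n) (X m - X n))) < e"
  have "\<exists>v. v \<in> V \<and> comp.nrm (X n - embed v) < inverse (real (Suc n))" for n
    using embed_dense[OF X, of "inverse (real (Suc n))" n] by auto
  then obtain v where v: "\<And>n. v n \<in> V" "\<And>n. comp.nrm (X n - embed (v n)) < inverse (real (Suc n))"
    by metis
  have ev: "embed (v n) \<in> completion" for n by (intro embed_completion v)
  have "comp.cseq X" using X C by (simp add: comp.cseq_def comp.nrm_def)
  have lim0: "(\<lambda>n. comp.nrm (X n - embed (v n))) \<longlonglongrightarrow> 0"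
    by (intro tendsto_sandwich[OF _ _ tendsto_const LIMSEQ_inverse_real_of_nat] always_eventually allI
        less_imp_le[OF v(2)] comp.nrm_ge_0 comp.V_diff X ev)
  have "comp.cseq (\<lambda>n. X n - embed (v n))"
    by (rule comp.convergent_imp_cseq[where x=0]) (use lim0 comp.V_diff[OF X ev] comp.V_zero in auto)
  from comp.cseq_diff[OF \<open>comp.cseq X\<close> this] have "comp.cseq (\<lambda>n. embed (v n))" by simp
  then have cv: "cseq v"
    using v(1) unfolding cseq_def comp.cseq_def by (simp add: embed_diff completion_norm_embed V_diff)
  show "\<exists>x\<in>completion. (\<lambda>n. sqrt (Re (completion_ip (X n - x) (X n - x)))) \<longlonglongrightarrow> 0"
  proof (intro bexI)
    show f: "completion_of v \<in> completion" using cv by (auto simp: completion_def)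
    show "(\<lambda>n. sqrt (Re (completion_ip (X n - completion_of v) (X n - completion_of v)))) \<longlonglongrightarrow> 0"
      unfolding comp.nrm_def[symmetric]
    proof (rule tendsto_sandwich[OF _ _ tendsto_const])
      show "\<forall>\<^sub>F n in sequentially. comp.nrm (X n - completion_of v)
          \<le> comp.nrm (X n - embed (v n)) + comp.nrm (embed (v n) - completion_of v)"
        by (intro always_eventually allI comp.nrm_triangle_diff X ev f)
      show "(\<lambda>n. comp.nrm (X n - embed (v n)) + comp.nrm (embed (v n) - completion_of v)) \<longlonglongrightarrow> 0"
        using tendsto_add[OF lim0 embed_tendsto[OF cv]] by simp
    qed (intro always_eventually allI comp.nrm_ge_0 comp.V_diff X f)
  qed
qed (rule comp.q_add_right comp.q_scale_right comp.q_commute; assumption)+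

end

section \<open>Orthogonal complements and projection onto the closure of a subspace\<close>

context complex_hilbert_space
begin

sublocale semi_inner_space sc H ip
proof unfold_locales
  show "0 \<le> Re (ip x x)" if "x \<in> H" for x
  proof (cases "x = 0")
    case True
    then show ?thesis using ip_scale_right[OF that that, of 0] by simp
  qed (use ip_pos that in force)
qed (rule subspace_carrier ip_add_right ip_scale_right ip_commute; assumption)+

lemma nrm_eq_0: "x \<in> H \<Longrightarrow> nrm x = 0 \<Longrightarrow> x = 0"
  using ip_pos by (force simp: nrm_def)

lemma cseq_convergent: "cseq X \<Longrightarrow> \<exists>x\<in>H. (\<lambda>n. nrm (X n - x)) \<longlonglongrightarrow> 0"
  using complete[of X] unfolding cseq_def nrm_def by blast

definition orth :: "'h set \<Rightarrow> 'h set" where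
  "orth D = {x \<in> H. \<forall>d\<in>D. ip d x = 0}"

lemma orthD: "x \<in> orth D \<Longrightarrow> x \<in> H" "x \<in> orth D \<Longrightarrow> d \<in> D \<Longrightarrow> ip d x = 0"
  by (auto simp: orth_def)

lemma orth_subspace: "D \<subseteq> H \<Longrightarrow> subspace (orth D)"
  using V_zero V_add V_scale
  by (auto simp: subspace_def orth_def q_zero_right q_add_right q_scale_right subset_iff)

lemma hilbert_orth:
  assumes D: "D \<subseteq> H" shows "complex_hilbert_space sc (orth D) ip"
proof (unfold_locales)
  show "subspace (orth D)" by (rule orth_subspace[OF D])
  fix X :: "nat \<Rightarrow> 'h" assume X: "\<And>n. X n \<in> orth D" and
    "\<forall>e>0. \<exists>M. \<forall>m\<ge>M. \<forall>n\<ge>M. sqrt (Re (ip (X m - X n) (X m - X n))) < e"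
  then obtain x where x: "x \<in> H" "(\<lambda>n. nrm (X n - x)) \<longlonglongrightarrow> 0"
    using cseq_convergent[of X] orthD(1)[OF X] by (auto simp: cseq_def nrm_def)
  have "ip d x = 0" if d: "d \<in> D" for d
  proof -
    have "(\<lambda>n. ip d (X n)) \<longlonglongrightarrow> ip d x"
      using D d orthD(1)[OF X] x by (intro tendsto_q) (auto simp: nrm_zero)
    then show ?thesis using orthD(2)[OF X d] by (simp add: LIMSEQ_const_iff)
  qed
  then show "\<exists>x\<in>orth D. (\<lambda>n. sqrt (Re (ip (X n - x) (X n - x)))) \<longlonglongrightarrow> 0"
    using x by (auto simp: orth_def nrm_def)
qed (blast intro: ip_add_right ip_scale_right ip_commute ip_pos dest: orthD(1))+

text \<open>D need not be closed, and the minimizing sequence is part of the conclusion because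
  later arguments operate on its members. The parallelogram law makes it Cauchy, and
  \<open>cauchy_schwarz_deficit\<close> with the squared distance as \<open>\<delta>\<close> gives
  orthogonality.\<close>

lemma projection:
  assumes D: "subspace D" "D \<subseteq> H" and x: "x \<in> H"
  obtains X y where "\<And>n. X n \<in> D" "y \<in> H" "(\<lambda>n. nrm (X n - y)) \<longlonglongrightarrow> 0" "x - y \<in> orth D"
proof -
  define \<delta> where "\<delta> = (INF d\<in>D. (nrm (x - d))\<^sup>2)"
  have bdd: "bdd_below ((\<lambda>d. (nrm (x - d))\<^sup>2) ` D)" by (rule bdd_belowI[of _ 0]) auto
  have ne: "D \<noteq> {}" using subspace_0[OF D(1)] by auto
  have le: "\<delta> \<le> (nrm (x - d))\<^sup>2" if "d \<in> D" for d
    unfolding \<delta>_def by (rule cINF_lower[OF bdd that])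
  have "\<exists>d\<in>D. (nrm (x - d))\<^sup>2 < \<delta> + inverse (real (Suc n))" for n
    using cINF_less_iff[OF ne bdd, of "\<delta> + inverse (real (Suc n))"] unfolding \<delta>_def by simp
  then obtain X where X: "\<And>n. X n \<in> D" "\<And>n. (nrm (x - X n))\<^sup>2 < \<delta> + inverse (real (Suc n))" by metis
  have XH: "X n \<in> H" for n using X D by blast
  have par: "(nrm (X m - X n))\<^sup>2 \<le> 2 * inverse (real (Suc m)) + 2 * inverse (real (Suc n))" for m n
  proof -
    \<comment> \<open>The midpoint \<open>?h\<close> lies in D, so \<open>?a + ?b\<close>, which is
      twice x - \<open>?h\<close>, has squared norm at least four times
      \<open>\<delta>\<close>.\<close>
    let ?a = "x - X m" and ?b = "x - X n" and ?h = "sc (1/2) (X m + X n)"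
    have a: "?a \<in> H" "?b \<in> H" using V_diff x XH by auto
    have "?h \<in> D" using D X subspace_add subspace_scale by blast
    have h: "sc 2 (x - ?h) = ?a + ?b"
      using scale_left_distrib[of 1 1 x] by (simp add: scale_right_diff_distrib)
    have "(nrm (?a + ?b))\<^sup>2 = 4 * (nrm (x - ?h))\<^sup>2"
      using nrm_scale[of "x - ?h" 2] x XH unfolding h[symmetric]
      by (simp add: V_diff V_scale V_add power_mult_distrib)
    moreover have "(nrm (X m - X n))\<^sup>2 = (nrm (?a - ?b))\<^sup>2"
      using nrm_minus_commute[OF XH XH, of m n] by (simp add: algebra_simps)
    moreover have "(nrm (?a + ?b))\<^sup>2 + (nrm (?a - ?b))\<^sup>2 = 2 * (nrm ?a)\<^sup>2 + 2 * (nrm ?b)\<^sup>2"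
      unfolding nrm_add_sq[OF a] nrm_diff_sq[OF a] by simp
    ultimately show ?thesis using X(2)[of m] X(2)[of n] le[OF \<open>?h \<in> D\<close>] by linarith
  qed
  have "cseq X"
    unfolding cseq_def
  proof (intro conjI allI impI XH)
    fix e :: real assume e: "e > 0"
    obtain M where M: "inverse (real (Suc M)) < e\<^sup>2 / 4" using reals_Archimedean[of "e\<^sup>2 / 4"] e by auto
    show "\<exists>M. \<forall>m\<ge>M. \<forall>n\<ge>M. nrm (X m - X n) < e"
    proof (intro exI[of _ M] allI impI)
      fix m n assume mn: "m \<ge> M" "n \<ge> M"
      have "inverse (real (Suc k)) < e\<^sup>2 / 4" if "k \<ge> M" for k
        using that by (intro order_le_less_trans[OF _ M] le_imp_inverse_le) auto
      from this[OF mn(1)] this[OF mn(2)] have "(nrm (X m - X n))\<^sup>2 < e\<^sup>2"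
        using par[of m n] by linarith
      then show "nrm (X m - X n) < e" using e by (simp add: power2_less_imp_less)
    qed
  qed
  then obtain y where y: "y \<in> H" "(\<lambda>n. nrm (X n - y)) \<longlonglongrightarrow> 0" using cseq_convergent by blast
  have "ip d (x - y) = 0" if d: "d \<in> D" for d
  proof -
    have dH: "d \<in> H" using d D by blast
    have "(\<lambda>n. ip d (x - X n)) \<longlonglongrightarrow> ip d (x - y)"
    proof (intro tendsto_q)
      have "x - X n - (x - y) = y - X n" for n by simp
      then show "(\<lambda>n. nrm (x - X n - (x - y))) \<longlonglongrightarrow> 0"
        using y nrm_minus_commute[OF y(1) XH] by simp
    qed (use dH x y XH V_diff nrm_zero in auto)
    moreover have "(\<lambda>n. ip d (x - X n)) \<longlonglongrightarrow> 0"
    proof (rule Lim_null_comparison)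
      show "\<forall>\<^sub>F n in sequentially. norm (ip d (x - X n)) \<le> sqrt (inverse (real (Suc n)) * (nrm d)\<^sup>2)"
      proof (intro always_eventually allI)
        fix n
        \<comment> \<open>Subtracting a multiple of d from x - X n amounts to another choice of a
          point of D, so the squared norm stays above \<open>\<delta>\<close>.\<close>
        have "(cmod (ip d (x - X n)))\<^sup>2 \<le> ((nrm (x - X n))\<^sup>2 - \<delta>) * (nrm d)\<^sup>2"
        proof (rule cauchy_schwarz_deficit)
          fix c
          have "X n + sc c d \<in> D" using X d D subspace_add subspace_scale by blast
          then show "\<delta> \<le> (nrm (x - X n - sc c d))\<^sup>2" using le by (metis diff_diff_add)
        qed (use dH x XH V_diff in auto)
        also have "\<dots> \<le> inverse (real (Suc n)) * (nrm d)\<^sup>2"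
          using X(2)[of n] by (intro mult_right_mono) auto
        finally show "norm (ip d (x - X n)) \<le> sqrt (inverse (real (Suc n)) * (nrm d)\<^sup>2)"
          by (simp add: real_le_rsqrt)
      qed
      have "(\<lambda>n. sqrt (inverse (real (Suc n)) * (nrm d)\<^sup>2)) \<longlonglongrightarrow> sqrt (0 * (nrm d)\<^sup>2)"
        by (intro tendsto_intros LIMSEQ_inverse_real_of_nat)
      then show "(\<lambda>n. sqrt (inverse (real (Suc n)) * (nrm d)\<^sup>2)) \<longlonglongrightarrow> 0" by simp
    qed
    ultimately show ?thesis using LIMSEQ_unique by blast
  qed
  then have "x - y \<in> orth D" using x y V_diff by (auto simp: orth_def)
  then show ?thesis using that X(1) y by blast
qed

end

section \<open>The GNS construction for a generating functional\<close>

locale generating_functional_on = hopf_pol +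
  fixes L
  assumes generating: "generating_functional P \<epsilon> L"
begin

lemma L_lin: "clinear_on P scaleC (*) L"
  and L_pos: "a \<in> P \<Longrightarrow> \<epsilon> a = 0 \<Longrightarrow> L (adj a * a) \<in> \<real>\<^sub>\<ge>\<^sub>0"
  and L_adj: "a \<in> P \<Longrightarrow> L (adj a) = cnj (L a)"
  and L_one: "L 1 = 0"
  using generating unfolding generating_functional_def by blast+

sublocale L: clinear_map_on scaleC "(*)" P L
  by unfold_locales (use subP L_lin in auto)

lemmas L_add = clinear_on_add[OF L_lin]
  and L_scale = clinear_on_scale[OF L_lin]

definition "K1 = {a \<in> P. \<epsilon> a = 0}"

definition "q a b = L (adj a * b)"

lemma K1D: "a \<in> K1 \<Longrightarrow> a \<in> P" "a \<in> K1 \<Longrightarrow> \<epsilon> a = 0"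
  by (auto simp: K1_def)

lemma subspace_K1: "cs.subspace K1"
  by (auto simp: cs.subspace_def K1_def zero_P add_P scale_P counit.zero counit_add counit_scale)

lemma K1_mult: "a \<in> P \<Longrightarrow> b \<in> K1 \<Longrightarrow> a * b \<in> K1" "a \<in> K1 \<Longrightarrow> b \<in> P \<Longrightarrow> a * b \<in> K1"
  by (auto simp: K1_def mult_P counit_mult)

lemma K1_adj: "a \<in> K1 \<Longrightarrow> adj a \<in> K1"
  by (auto simp: K1_def adj_P counit_adj)

sublocale K: semi_inner_space scaleC K1 q
proof unfold_locales
  show "cs.subspace K1" by (rule subspace_K1)
  fix x y assume x: "x \<in> K1" and y: "y \<in> K1"
  note P = K1D(1)[OF x] K1D(1)[OF y]
  show "q x (y + z) = q x y + q x z" if "z \<in> K1" for z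
    using P K1D(1)[OF that] by (simp add: q_def distrib_left L_add mult_P adj_P)
  show "q x (c *\<^sub>C y) = c * q x y" for c
    using P by (simp add: q_def scaleC_mult_right L_scale mult_P adj_P)
  show "q y x = cnj (q x y)"
    using L_adj[of "adj x * y"] P by (simp add: q_def adj_mult adj_adj mult_P adj_P)
next
  fix x assume "x \<in> K1"
  then show "0 \<le> Re (q x x)"
    using L_pos[of x] by (auto simp: K1_def q_def nonneg_Reals_def)
qed

abbreviation "HH \<equiv> K.completion"
abbreviation "ip \<equiv> K.completion_ip"

sublocale H: complex_hilbert_space fun_scale HH ip
  by (rule K.complex_hilbert_space_completion)

text \<open>The columns of u are isometric: summed over k, the squared norms of
  \<open>u k j * x\<close> give that of x. So every coefficient acts as a contraction, and
  coefficients span Pol.\<close>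

lemma left_mult_bounded:
  assumes "a \<in> P" shows "\<exists>C. \<forall>x\<in>K1. K.nrm (a * x) \<le> C * K.nrm x"
  using assms
proof (induction rule: P_induct)
  case zero
  show ?case by (auto simp: K.nrm_zero intro!: exI[of _ 0])
next
  case (add a b)
  then obtain C D where *: "\<forall>x\<in>K1. K.nrm (a * x) \<le> C * K.nrm x" "\<forall>x\<in>K1. K.nrm (b * x) \<le> D * K.nrm x"
    by blast
  have "K.nrm ((a + b) * x) \<le> (C + D) * K.nrm x" if "x \<in> K1" for x
    using K.nrm_triangle[OF K1_mult(1)[OF add(1) that] K1_mult(1)[OF add(2) that]] * that
    by (fastforce simp: distrib_right)
  then show ?case by blast
next
  case (scale c a)
  then obtain C where *: "\<forall>x\<in>K1. K.nrm (a * x) \<le> C * K.nrm x" by blast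
  have "K.nrm ((c *\<^sub>C a) * x) \<le> (cmod c * C) * K.nrm x" if "x \<in> K1" for x
    using K.nrm_scale[OF K1_mult(1)[OF scale(1) that], of c] * that
    by (simp add: scaleC_mult_left mult.assoc mult_left_mono)
  then show ?case by blast
next
  case (coef n u i j)
  have "K.nrm (u i j * x) \<le> 1 * K.nrm x" if x: "x \<in> K1" for x
  proof -
    have uP: "u k j \<in> P" if "k < n" for k using urep_coef_P[OF coef(1) that coef(3)] .
    have "(K.nrm (u i j * x))\<^sup>2 \<le> (\<Sum>k<n. (K.nrm (u k j * x))\<^sup>2)"
      using coef(2) by (intro member_le_sum[of i "{..<n}" "\<lambda>k. (K.nrm (u k j * x))\<^sup>2"]) auto
    also have "\<dots> = (\<Sum>k<n. Re (L (adj x * (adj (u k j) * u k j) * x)))"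
      using x by (intro sum.cong refl) (simp add: K.nrm_sq K1_mult uP q_def adj_mult mult.assoc)
    also have "\<dots> = Re (L (\<Sum>k<n. adj x * (adj (u k j) * u k j) * x))"
      using K1D(1)[OF x] by (subst L.sum) (auto simp: mult_P adj_P uP)
    also have "(\<Sum>k<n. adj x * (adj (u k j) * u k j) * x) = adj x * x"
      using urep_unitary(2)[OF coef(1) coef(3) coef(3)]
      by (simp add: sum_distrib_left[symmetric] sum_distrib_right[symmetric])
    also have "Re (L (adj x * x)) = (K.nrm x)\<^sup>2" using K.nrm_sq[OF x] by (simp add: q_def)
    finally have "(K.nrm (u i j * x))\<^sup>2 \<le> (K.nrm x)\<^sup>2" .
    then have "K.nrm (u i j * x) \<le> K.nrm x" by (rule power2_le_imp_le) (rule K.nrm_ge_0[OF x])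
    then show ?thesis by simp
  qed
  then show ?case by blast
qed

text \<open>A vector f has the value <b, f> at b, so left multiplication by a moves over as adj a.
  This form is independent of the sequence that represents f.\<close>

definition "lact a f = (\<lambda>b. if b \<in> K1 then f (adj a * b) else 0)"

text \<open>Only K_1 is embedded, whereas a cocycle lives on all of Pol and vanishes at 1: a
  \<mapsto> a - \<epsilon>(a) 1 projects Pol onto K_1 along the unit.\<close>

definition "eta a = K.embed (a - \<epsilon> a *\<^sub>C 1)"

lemma cseq_left_mult:
  assumes a: "a \<in> P" and X: "K.cseq X" shows "K.cseq (\<lambda>n. a * X n)"
proof -
  obtain C where C: "\<And>x. x \<in> K1 \<Longrightarrow> K.nrm (a * x) \<le> C * K.nrm x" using left_mult_bounded[OF a] by blast
  show ?thesis
  proof (rule K.cseq_lipschitz[OF X])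
    show "K.nrm (a * X m - a * X n) \<le> C * K.nrm (X m - X n)" for m n
      using C[OF K.V_diff[OF K.cseq_V[OF X] K.cseq_V[OF X]]] by (simp add: right_diff_distrib)
  qed (intro K1_mult a K.cseq_V X)
qed

lemma lact_completion_of:
  assumes a: "a \<in> P" and X: "K.cseq X"
  shows "lact a (K.completion_of X) = K.completion_of (\<lambda>n. a * X n)"
proof (rule K.completion_of_eqI[symmetric])
  fix b assume b: "b \<in> K1"
  have "(\<lambda>n. q (adj a * b) (X n)) \<longlonglongrightarrow> K.completion_of X (adj a * b)"
    by (intro K.completion_of_tendsto X K1_mult adj_P a b)
  then show "(\<lambda>n. q b (a * X n)) \<longlonglongrightarrow> lact a (K.completion_of X) b"
    using b by (simp add: lact_def q_def adj_mult adj_adj mult.assoc)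
qed (simp add: lact_def)

lemma lact_embed: "a \<in> P \<Longrightarrow> v \<in> K1 \<Longrightarrow> lact a (K.embed v) = K.embed (a * v)"
  unfolding K.embed_def by (rule lact_completion_of) (auto intro: K.cseq_const)

lemma lact_HH: "a \<in> P \<Longrightarrow> f \<in> HH \<Longrightarrow> lact a f \<in> HH"
  by (elim K.completionE) (auto simp: lact_completion_of K.completion_def cseq_left_mult)

lemma star_rep: "star_rep_on P fun_scale HH ip lact"
  unfolding star_rep_on_def bounded_operator_on_def
proof (intro conjI ballI)
  fix a assume a: "a \<in> P"
  show "lact a ` HH \<subseteq> HH" using lact_HH[OF a] by blast
  show "clinear_on HH fun_scale fun_scale (lact a)"
    by (rule clinear_onI) (auto simp: lact_def fun_scale_def fun_eq_iff)
  obtain C where C: "\<And>x. x \<in> K1 \<Longrightarrow> K.nrm (a * x) \<le> C * K.nrm x" using left_mult_bounded[OF a] by blast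
  have "H.nrm (lact a f) \<le> C * H.nrm f" if "f \<in> HH" for f
  proof -
    obtain X where X: "K.cseq X" "f = K.completion_of X" using \<open>f \<in> HH\<close> by (rule K.completionE)
    have "(\<lambda>n. C * K.nrm (X n)) \<longlonglongrightarrow> C * H.nrm f"
      unfolding X(2) by (intro tendsto_mult tendsto_const K.completion_norm_tendsto X)
    moreover have "(\<lambda>n. K.nrm (a * X n)) \<longlonglongrightarrow> H.nrm (lact a f)"
      unfolding X(2) lact_completion_of[OF a X(1)] by (intro K.completion_norm_tendsto cseq_left_mult a X)
    ultimately show ?thesis
      using LIMSEQ_le C K.cseq_V[OF X(1)] by meson
  qed
  then show "\<exists>C. \<forall>f\<in>HH. sqrt (Re (ip (lact a f) (lact a f))) \<le> C * sqrt (Re (ip f f))"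
    unfolding H.nrm_def by blast
  fix f g assume f: "f \<in> HH" and g: "g \<in> HH"
  show "ip (lact (adj a) f) g = ip f (lact a g)"
  proof -
    obtain X where X: "K.cseq X" "f = K.completion_of X" using f by (rule K.completionE)
    obtain Y where Y: "K.cseq Y" "g = K.completion_of Y" using g by (rule K.completionE)
    have "(\<lambda>n. q (X n) (a * Y n)) \<longlonglongrightarrow> ip f (lact a g)"
      unfolding X(2) Y(2) lact_completion_of[OF a Y(1)]
      by (intro K.completion_ip_tendsto cseq_left_mult X Y a)
    then have "(\<lambda>n. q (adj a * X n) (Y n)) \<longlonglongrightarrow> ip f (lact a g)"
      by (simp add: q_def adj_mult adj_adj mult.assoc)
    then show ?thesis
      unfolding X(2) Y(2) lact_completion_of[OF adj_P[OF a] X(1)]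
      by (intro K.completion_ip_eqI cseq_left_mult X Y adj_P a)
  qed
next
  fix f assume f: "f \<in> HH"
  then obtain X where X: "K.cseq X" "f = K.completion_of X" by (rule K.completionE)
  note pX = lact_completion_of[OF _ X(1)]
  show "clinear_on P scaleC fun_scale (\<lambda>a. lact a f)"
    by (rule clinear_onI)
      (simp_all add: X(2) pX add_P scale_P distrib_right scaleC_mult_left
        K.completion_of_add K.completion_of_scale cseq_left_mult X)
  show "lact (a * b) f = lact a (lact b f)" if "a \<in> P" "b \<in> P" for a b
    using that by (simp add: X(2) pX mult_P lact_completion_of cseq_left_mult X mult.assoc)
  show "lact 1 f = f" by (simp add: X(2) pX one_P)
qed

lemma center_K1: "a \<in> P \<Longrightarrow> a - \<epsilon> a *\<^sub>C 1 \<in> K1"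
  by (simp add: K1_def diff_P scale_P one_P counit.diff counit_scale counit_one)

lemma eta_K1: "a \<in> K1 \<Longrightarrow> eta a = K.embed a"
  by (simp add: eta_def K1_def)

lemma eta_linear: "clinear_on P scaleC fun_scale eta"
proof (rule clinear_onI)
  fix a b assume "a \<in> P" "b \<in> P"
  then show "eta (a + b) = eta a + eta b"
    using clinear_on_add[OF K.embed_linear center_K1[of a] center_K1[of b]]
    by (simp add: eta_def counit_add scaleC_add_left algebra_simps)
next
  fix c a assume "a \<in> P"
  then show "eta (c *\<^sub>C a) = fun_scale c (eta a)"
    using clinear_on_scale[OF K.embed_linear center_K1[of a]]
    by (simp add: eta_def counit_scale cs.scale_right_diff_distrib scaleC_scaleC)
qed

lemma cocycle_eta: "cocycle P \<epsilon> fun_scale HH ip lact eta"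
  unfolding cocycle_def
proof (intro conjI ballI allI impI H.complex_hilbert_space_axioms star_rep eta_linear)
  show "eta ` P \<subseteq> HH" by (auto simp: eta_def center_K1 K.embed_completion)
next
  fix x and e :: real assume "x \<in> HH" "0 < e"
  then obtain v where v: "v \<in> K1" "H.nrm (x - K.embed v) < e" by (rule K.embed_dense)
  then have "v \<in> P" "H.nrm (x - eta v) < e" using K1D(1) by (auto simp: eta_K1)
  then show "\<exists>a\<in>P. sqrt (Re (ip (x - eta a) (x - eta a))) < e"
    unfolding H.nrm_def by blast
next
  fix a b assume a: "a \<in> P" and b: "b \<in> P"
  have "eta (a * b) = K.embed (a * (b - \<epsilon> b *\<^sub>C 1) + \<epsilon> b *\<^sub>C (a - \<epsilon> a *\<^sub>C 1))"
    using a b unfolding eta_def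
    by (simp add: counit_mult right_diff_distrib scaleC_mult_right cs.scale_right_diff_distrib
        scaleC_scaleC mult.commute)
  also have "\<dots> = K.embed (a * (b - \<epsilon> b *\<^sub>C 1)) + fun_scale (\<epsilon> b) (eta a)"
    using a b by (simp add: clinear_on_add[OF K.embed_linear] clinear_on_scale[OF K.embed_linear]
        eta_def K1_mult center_K1 K.V_scale)
  finally show "eta (a * b) = lact a (eta b) + fun_scale (\<epsilon> b) (eta a)"
    using a b by (simp add: eta_def lact_embed center_K1)
qed

lemma L_mult:
  assumes a: "a \<in> P" and b: "b \<in> P"
  shows "L (a * b) = \<epsilon> a * L b + L a * \<epsilon> b + ip (eta (adj a)) (eta b)"
proof -
  have "ip (eta (adj a)) (eta b) = L ((a - \<epsilon> a *\<^sub>C 1) * (b - \<epsilon> b *\<^sub>C 1))"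
    using K.completion_ip_embed_embed[OF center_K1[OF adj_P[OF a]] center_K1[OF b]] a
    by (simp add: eta_def q_def adj_diff adj_adj adj_scaleC counit_adj)
  also have "(a - \<epsilon> a *\<^sub>C 1) * (b - \<epsilon> b *\<^sub>C 1) = (a * b - \<epsilon> a *\<^sub>C b) - (\<epsilon> b *\<^sub>C a - (\<epsilon> a * \<epsilon> b) *\<^sub>C 1)"
    by (simp add: left_diff_distrib right_diff_distrib scaleC_mult_left scaleC_mult_right scaleC_scaleC
        cs.scale_right_diff_distrib)
  also have "L \<dots> = L (a * b) - \<epsilon> a * L b - L a * \<epsilon> b"
    using a b by (simp add: L.diff L_scale mult_P scale_P diff_P one_P L_one mult.commute)
  finally show ?thesis by simp
qed

end

section \<open>Orthogonal parts of a cocycle\<close>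

context complex_hilbert_space
begin

lemma orth_unique:
  assumes D: "subspace D" "D \<subseteq> H" and "y \<in> orth D" "z \<in> orth D" "x - y \<in> D" "x - z \<in> D"
  shows "y = z"
proof -
  have "(x - z) - (x - y) \<in> D" by (intro subspace_diff D assms)
  then have d: "y - z \<in> D" by simp
  have "y - z \<in> orth D" by (intro subspace_diff orth_subspace D assms)
  then have "ip (y - z) (y - z) = 0" using d orthD(2) by blast
  then have "y - z = 0" using d D(2) by (intro nrm_eq_0) (auto simp: nrm_def)
  then show ?thesis by simp
qed

lemma nrm_le_nrm_sub_orth:
  assumes "D \<subseteq> H" "y \<in> orth D" "d \<in> D" shows "nrm y \<le> nrm (y - d)"
proof (rule power2_le_imp_le)
  have "Re (ip y d) = 0" using ip_commute[of d y] orthD(2)[OF assms(2,3)] orthD(1)[OF assms(2)] assms(1,3) by auto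
  then show "(nrm y)\<^sup>2 \<le> (nrm (y - d))\<^sup>2"
    using nrm_diff_sq[of y d] orthD(1)[OF assms(2)] assms(1,3) by auto
  show "0 \<le> nrm (y - d)" using orthD(1)[OF assms(2)] assms(1,3) by (intro nrm_ge_0 V_diff) auto
qed

end

context hopf_pol
begin

text \<open>Each identity for \<open>\<eta>'\<close> follows from uniqueness of the component
  orthogonal to D, and invariance of D under all adj a makes the complement invariant too. The lemma
  is used with D equal to either summand, so both parts of the cocycle come from it.\<close>

lemma cocycle_on_orth:
  assumes c: "cocycle P \<epsilon> sc H ip \<rho> \<eta>"
    and D: "module.subspace sc D" "D \<subseteq> H" "\<And>a x. a \<in> P \<Longrightarrow> x \<in> D \<Longrightarrow> \<rho> a x \<in> D"
    and \<eta>': "\<And>a. a \<in> P \<Longrightarrow> \<eta>' a \<in> complex_hilbert_space.orth H ip D" "\<And>a. a \<in> P \<Longrightarrow> \<eta> a - \<eta>' a \<in> D"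
  shows "cocycle P \<epsilon> sc (complex_hilbert_space.orth H ip D) ip \<rho> \<eta>'"
proof -
  interpret complex_hilbert_space sc H ip using c by (simp add: cocycle_def)
  have sr: "star_rep_on P sc H ip \<rho>" and \<eta>H: "\<And>a. a \<in> P \<Longrightarrow> \<eta> a \<in> H" and \<eta>l: "clinear_on P scaleC sc \<eta>"
    and \<eta>d: "\<And>x e. x \<in> H \<Longrightarrow> e > 0 \<Longrightarrow> \<exists>a\<in>P. nrm (x - \<eta> a) < e"
    and \<eta>m: "\<And>a b. a \<in> P \<Longrightarrow> b \<in> P \<Longrightarrow> \<eta> (a * b) = \<rho> a (\<eta> b) + sc (\<epsilon> b) (\<eta> a)"
    using c unfolding cocycle_def nrm_def by blast+
  have \<rho>H: "\<rho> a x \<in> H" if "a \<in> P" "x \<in> H" for a x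
    using sr that unfolding star_rep_on_def bounded_operator_on_def by blast
  have \<rho>l: "clinear_on H sc sc (\<rho> a)" if "a \<in> P" for a
    using sr that unfolding star_rep_on_def bounded_operator_on_def by blast
  have \<rho>adj: "ip (\<rho> (adj a) x) y = ip x (\<rho> a y)" if "a \<in> P" "x \<in> H" "y \<in> H" for a x y
    using sr that unfolding star_rep_on_def by blast
  have \<rho>o: "\<rho> a x \<in> orth D" if "a \<in> P" "x \<in> orth D" for a x
    unfolding orth_def
  proof (intro CollectI conjI ballI)
    show "\<rho> a x \<in> H" using that orthD(1) \<rho>H by blast
    fix d assume d: "d \<in> D"
    have "ip (\<rho> (adj a) d) x = 0" using D(3)[OF adj_P[OF that(1)] d] orthD(2)[OF that(2)] by blast
    then show "ip d (\<rho> a x) = 0" using \<rho>adj[of a d x] that d D(2) orthD(1) by auto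
  qed
  have sub_o: "subspace (orth D)" by (rule orth_subspace[OF D(2)])
  have oH: "orth D \<subseteq> H" using orthD(1) by blast
  note unique = orth_unique[OF D(1,2)]
  show ?thesis
    unfolding cocycle_def
  proof (intro conjI)
    show "complex_hilbert_space sc (orth D) ip" by (rule hilbert_orth[OF D(2)])
    show "star_rep_on P sc (orth D) ip \<rho>"
      unfolding star_rep_on_def
    proof (intro conjI ballI)
      fix a assume a: "a \<in> P"
      obtain C where "\<forall>x\<in>H. sqrt (Re (ip (\<rho> a x) (\<rho> a x))) \<le> C * sqrt (Re (ip x x))"
        using sr a unfolding star_rep_on_def bounded_operator_on_def by blast
      then show "bounded_operator_on sc (orth D) ip (\<rho> a)"
        unfolding bounded_operator_on_def
        using \<rho>o[OF a] clinear_on_subset[OF \<rho>l[OF a] oH] oH by blast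
    qed (use sr oH in \<open>unfold star_rep_on_def, blast+\<close>)
    show "\<eta>' ` P \<subseteq> orth D" using \<eta>'(1) by blast
    show "clinear_on P scaleC sc \<eta>'"
    proof (rule clinear_onI)
      fix a b assume a: "a \<in> P" and b: "b \<in> P"
      show "\<eta>' (a + b) = \<eta>' a + \<eta>' b"
      proof (rule unique)
        show "\<eta>' (a + b) \<in> orth D" "\<eta> (a + b) - \<eta>' (a + b) \<in> D" using \<eta>' add_P[OF a b] by blast+
        show "\<eta>' a + \<eta>' b \<in> orth D" by (intro subspace_add sub_o \<eta>' a b)
        have "(\<eta> a - \<eta>' a) + (\<eta> b - \<eta>' b) \<in> D" by (intro subspace_add D \<eta>' a b)
        then show "\<eta> (a + b) - (\<eta>' a + \<eta>' b) \<in> D"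
          by (simp add: clinear_on_add[OF \<eta>l a b] algebra_simps)
      qed
    next
      fix k a assume a: "a \<in> P"
      show "\<eta>' (k *\<^sub>C a) = sc k (\<eta>' a)"
      proof (rule unique)
        show "\<eta>' (k *\<^sub>C a) \<in> orth D" "\<eta> (k *\<^sub>C a) - \<eta>' (k *\<^sub>C a) \<in> D" using \<eta>' scale_P[OF a] by blast+
        show "sc k (\<eta>' a) \<in> orth D" by (intro subspace_scale sub_o \<eta>' a)
        have "sc k (\<eta> a - \<eta>' a) \<in> D" by (intro subspace_scale D \<eta>' a)
        then show "\<eta> (k *\<^sub>C a) - sc k (\<eta>' a) \<in> D"
          by (simp add: clinear_on_scale[OF \<eta>l a] scale_right_diff_distrib)
      qed
    qed
    show "\<forall>x\<in>orth D. \<forall>e>0. \<exists>a\<in>P. sqrt (Re (ip (x - \<eta>' a) (x - \<eta>' a))) < e"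
      unfolding nrm_def[symmetric]
    proof (intro ballI allI impI)
      fix x and e :: real assume x: "x \<in> orth D" and e: "e > 0"
      then obtain a where a: "a \<in> P" "nrm (x - \<eta> a) < e" using \<eta>d orthD(1) by blast
      \<comment> \<open>Here x - \<open>\<eta>' a\<close> is orthogonal to D and the subtracted
        vector lies in D; their difference is x - \<open>\<eta> a\<close>. So density of the range
        is inherited.\<close>
      have "nrm (x - \<eta>' a) \<le> nrm ((x - \<eta>' a) - (\<eta> a - \<eta>' a))"
        by (intro nrm_le_nrm_sub_orth[OF D(2)] subspace_diff sub_o x \<eta>' a)
      then have "nrm (x - \<eta>' a) < e" using a(2) by simp
      then show "\<exists>a\<in>P. nrm (x - \<eta>' a) < e" using a(1) by blast
    qed
    show "\<forall>a\<in>P. \<forall>b\<in>P. \<eta>' (a * b) = \<rho> a (\<eta>' b) + sc (\<epsilon> b) (\<eta>' a)"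
    proof (intro ballI)
      fix a b assume a: "a \<in> P" and b: "b \<in> P"
      show "\<eta>' (a * b) = \<rho> a (\<eta>' b) + sc (\<epsilon> b) (\<eta>' a)"
      proof (rule unique)
        show "\<eta>' (a * b) \<in> orth D" "\<eta> (a * b) - \<eta>' (a * b) \<in> D" using \<eta>' mult_P[OF a b] by blast+
        show "\<rho> a (\<eta>' b) + sc (\<epsilon> b) (\<eta>' a) \<in> orth D"
          by (intro subspace_add subspace_scale sub_o \<rho>o \<eta>' a b)
        interpret r: clinear_map_on sc sc H "\<rho> a"
          by unfold_locales (use subspace_carrier \<rho>l[OF a] in auto)
        have "\<rho> a (\<eta> b - \<eta>' b) + sc (\<epsilon> b) (\<eta> a - \<eta>' a) \<in> D"
          by (intro subspace_add subspace_scale D \<eta>' a b)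
        moreover have "\<rho> a (\<eta> b - \<eta>' b) = \<rho> a (\<eta> b) - \<rho> a (\<eta>' b)"
          using \<eta>H[OF b] \<eta>'(1)[OF b] oH by (intro r.diff) auto
        ultimately show "\<eta> (a * b) - (\<rho> a (\<eta>' b) + sc (\<epsilon> b) (\<eta>' a)) \<in> D"
          by (simp add: \<eta>m[OF a b] scale_right_diff_distrib algebra_simps)
      qed
    qed
  qed
qed

lemma cocycle_one: assumes "cocycle P \<epsilon> sc H ip \<rho> \<eta>" shows "\<eta> 1 = 0"
proof -
  interpret complex_hilbert_space sc H ip using assms by (simp add: cocycle_def)
  have "\<eta> 1 \<in> H" using assms one_P unfolding cocycle_def by blast
  then have "\<rho> 1 (\<eta> 1) = \<eta> 1" using assms unfolding cocycle_def star_rep_on_def by blast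
  moreover have "\<eta> (1 * 1) = \<rho> 1 (\<eta> 1) + sc (\<epsilon> 1) (\<eta> 1)"
    using assms one_P unfolding cocycle_def by blast
  ultimately show ?thesis by (simp add: counit_one)
qed

lemma generating_functional_of_cocycle:
  assumes c: "cocycle P \<epsilon> sc H ip \<rho> \<eta>" and lin: "clinear_on P scaleC (*) M"
    and adj: "\<And>a. a \<in> P \<Longrightarrow> M (adj a) = cnj (M a)"
    and mult: "\<And>a b. a \<in> P \<Longrightarrow> b \<in> P \<Longrightarrow> M (a * b) = \<epsilon> a * M b + M a * \<epsilon> b + ip (\<eta> (adj a)) (\<eta> b)"
  shows "generating_functional P \<epsilon> M"
proof -
  interpret complex_hilbert_space sc H ip using c by (simp add: cocycle_def)
  have \<eta>H: "\<eta> a \<in> H" if "a \<in> P" for a using c that unfolding cocycle_def by blast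
  have "M (adj a * a) \<in> \<real>\<^sub>\<ge>\<^sub>0" if "a \<in> P" "\<epsilon> a = 0" for a
  proof -
    have "M (adj a * a) = complex_of_real ((nrm (\<eta> a))\<^sup>2)"
      using mult[OF adj_P[OF that(1)] that(1)] that q_self[OF \<eta>H[OF that(1)]]
      by (simp add: counit_adj adj_adj)
    then show ?thesis by (simp only: nonneg_Reals_of_real_iff zero_le_power2)
  qed
  moreover have "M 1 = 0"
    using mult[OF one_P one_P] cocycle_one[OF c] q_zero_right[OF V_zero] by (simp add: counit_one)
  ultimately show ?thesis using lin adj unfolding generating_functional_def by blast
qed

lemma cbilinear_sum:
  assumes f: "cbilinear_on (*) P f" and "\<And>i. i \<in> I \<Longrightarrow> x i \<in> P" "\<And>j. j \<in> J \<Longrightarrow> y j \<in> P"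
  shows "f (\<Sum>i\<in>I. c i *\<^sub>C x i) (\<Sum>j\<in>J. d j *\<^sub>C y j) = (\<Sum>i\<in>I. \<Sum>j\<in>J. c i * d j * f (x i) (y j))"
proof -
  have l: "clinear_map_on scaleC (*) P (\<lambda>x. f x z)" "clinear_map_on scaleC (*) P (f z)" if "z \<in> P" for z
    using f that subP unfolding cbilinear_on_def
    by (simp_all add: clinear_map_on_def clinear_map_on_axioms_def vector_space_scaleC vector_space_times)
  have yP: "(\<Sum>j\<in>J. d j *\<^sub>C y j) \<in> P" using assms by (intro sum_P scale_P)
  have "f (\<Sum>i\<in>I. c i *\<^sub>C x i) (\<Sum>j\<in>J. d j *\<^sub>C y j) = (\<Sum>i\<in>I. f (c i *\<^sub>C x i) (\<Sum>j\<in>J. d j *\<^sub>C y j))"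
    by (rule clinear_map_on.sum[OF l(1)[OF yP]]) (use assms scale_P in auto)
  also have "\<dots> = (\<Sum>i\<in>I. c i * f (x i) (\<Sum>j\<in>J. d j *\<^sub>C y j))"
    using assms(2) by (intro sum.cong refl clinear_on_scale[OF clinear_map_on.lin[OF l(1)[OF yP]]]) auto
  also have "\<dots> = (\<Sum>i\<in>I. \<Sum>j\<in>J. c i * d j * f (x i) (y j))"
  proof (intro sum.cong refl)
    fix i assume i: "i \<in> I"
    note li = l(2)[OF assms(2)[OF i]]
    have "f (x i) (\<Sum>j\<in>J. d j *\<^sub>C y j) = (\<Sum>j\<in>J. f (x i) (d j *\<^sub>C y j))"
      by (rule clinear_map_on.sum[OF li]) (use assms scale_P in auto)
    also have "\<dots> = (\<Sum>j\<in>J. d j * f (x i) (y j))"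
      using assms(3) by (intro sum.cong refl clinear_on_scale[OF clinear_map_on.lin[OF li]]) auto
    finally have e: "f (x i) (\<Sum>j\<in>J. d j *\<^sub>C y j) = (\<Sum>j\<in>J. d j * f (x i) (y j))" .
    show "c i * f (x i) (\<Sum>j\<in>J. d j *\<^sub>C y j) = (\<Sum>j\<in>J. c i * d j * f (x i) (y j))"
      unfolding e by (simp only: sum_distrib_left mult.assoc)
  qed
  finally show ?thesis .
qed

lemma comultE:
  assumes "a \<in> P"
  obtains n :: nat and u v where "\<And>i. i < n \<Longrightarrow> u i \<in> P" "\<And>i. i < n \<Longrightarrow> v i \<in> P"
    "\<Delta> a = (\<Sum>i<n. t (u i) (v i))" "a = (\<Sum>i<n. \<epsilon> (u i) *\<^sub>C v i)" "a = (\<Sum>i<n. \<epsilon> (v i) *\<^sub>C u i)"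
proof -
  obtain n :: nat and u v where *: "\<And>i. i < n \<Longrightarrow> u i \<in> P" "\<And>i. i < n \<Longrightarrow> v i \<in> P"
    "\<Delta> a = (\<Sum>i<n. t (u i) (v i))"
    using alg_tensorE[OF comult_P[OF assms]] by blast
  have b: "cbilinear_on scaleC P (\<lambda>x y. \<epsilon> y *\<^sub>C x)"
    using bilinear_counit by (auto simp: cbilinear_on_def)
  have "a = (\<Sum>i<n. \<epsilon> (u i) *\<^sub>C v i)"
    using counit_left[OF assms] tensor_lift_sum_nat[OF vector_space_scaleC bilinear_counit, of n u v] *
    by simp
  moreover have "a = (\<Sum>i<n. \<epsilon> (v i) *\<^sub>C u i)"
    using counit_right[OF assms] tensor_lift_sum_nat[OF vector_space_scaleC b, of n u v] *
    by simp
  ultimately show ?thesis using that * by blast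
qed

text \<open>Every symmetric bi-derivation at the counit is a 2-coboundary.\<close>

lemma symmetric_biderivation_coboundary:
  assumes f: "cbilinear_on (*) P f"
    and der: "\<And>x y z. x \<in> P \<Longrightarrow> y \<in> P \<Longrightarrow> z \<in> P \<Longrightarrow> f (x * y) z = \<epsilon> x * f y z + \<epsilon> y * f x z"
    and sym: "\<And>x y. x \<in> P \<Longrightarrow> y \<in> P \<Longrightarrow> f x y = f y x"
    and a: "a \<in> P" and b: "b \<in> P"
  shows "tensor_lift t P P f (\<Delta> (a * b)) = \<epsilon> a * tensor_lift t P P f (\<Delta> b)
    + tensor_lift t P P f (\<Delta> a) * \<epsilon> b + 2 * f a b"
proof -
  note lift = tensor_lift_sum[OF vector_space_times f]
  obtain n :: nat and x y where x: "\<And>i. i < n \<Longrightarrow> x i \<in> P" "\<And>i. i < n \<Longrightarrow> y i \<in> P"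
    "\<Delta> a = (\<Sum>i<n. t (x i) (y i))" and a1: "a = (\<Sum>i<n. \<epsilon> (x i) *\<^sub>C y i)" and a2: "a = (\<Sum>i<n. \<epsilon> (y i) *\<^sub>C x i)"
    using comultE[OF a] by blast
  obtain m :: nat and z w where z: "\<And>i. i < m \<Longrightarrow> z i \<in> P" "\<And>i. i < m \<Longrightarrow> w i \<in> P"
    "\<Delta> b = (\<Sum>i<m. t (z i) (w i))" and b1: "b = (\<Sum>i<m. \<epsilon> (z i) *\<^sub>C w i)" and b2: "b = (\<Sum>i<m. \<epsilon> (w i) *\<^sub>C z i)"
    using comultE[OF b] by blast
  have "\<epsilon> a = (\<Sum>i<n. \<epsilon> (\<epsilon> (x i) *\<^sub>C y i))"
    by (subst a1) (rule counit.sum, use x scale_P in auto)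
  then have \<epsilon>a: "\<epsilon> a = (\<Sum>i<n. \<epsilon> (x i) * \<epsilon> (y i))" using x by (simp add: counit_scale)
  have "\<epsilon> b = (\<Sum>i<m. \<epsilon> (\<epsilon> (z i) *\<^sub>C w i))"
    by (subst b1) (rule counit.sum, use z scale_P in auto)
  then have \<epsilon>b: "\<epsilon> b = (\<Sum>i<m. \<epsilon> (z i) * \<epsilon> (w i))" using z by (simp add: counit_scale)
  have la: "tensor_lift t P P f (\<Delta> a) = (\<Sum>i<n. f (x i) (y i))"
    unfolding x(3) by (rule lift) (use x in auto)
  have lb: "tensor_lift t P P f (\<Delta> b) = (\<Sum>i<m. f (z i) (w i))"
    unfolding z(3) by (rule lift) (use z in auto)
  have der2: "f z (x * y) = \<epsilon> x * f z y + \<epsilon> y * f z x" if "x \<in> P" "y \<in> P" "z \<in> P" for x y z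
    using der[OF that] sym that mult_P by simp
  have "\<Delta> (a * b) = (\<Sum>p\<in>{..<n} \<times> {..<m}. t (x (fst p) * z (snd p)) (y (fst p) * w (snd p)))"
    unfolding comult_mult x(3) z(3) sum_product
    by (simp add: tensor_mult sum.cartesian_product case_prod_beta)
  then have "tensor_lift t P P f (\<Delta> (a * b)) =
      (\<Sum>p\<in>{..<n} \<times> {..<m}. f (x (fst p) * z (snd p)) (y (fst p) * w (snd p)))"
    by (simp only:) (rule lift, use x z mult_P in auto)
  also have "\<dots> = (\<Sum>i<n. \<Sum>j<m. f (x i * z j) (y i * w j))"
    by (simp add: sum.cartesian_product case_prod_beta)
  \<comment> \<open>The derivation rule in both variables gives four terms; symmetry has put the
    last one into the order y, z.\<close>
  also have "\<dots> = (\<Sum>i<n. \<Sum>j<m. (\<epsilon> (x i) * \<epsilon> (y i)) * f (z j) (w j) + f (x i) (y i) * (\<epsilon> (z j) * \<epsilon> (w j))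
      + \<epsilon> (y i) * \<epsilon> (z j) * f (x i) (w j) + \<epsilon> (x i) * \<epsilon> (w j) * f (y i) (z j))"
  proof (intro sum.cong refl)
    fix i j assume "i \<in> {..<n}" "j \<in> {..<m}"
    then have P: "x i \<in> P" "y i \<in> P" "z j \<in> P" "w j \<in> P" using x z by auto
    show "f (x i * z j) (y i * w j) = (\<epsilon> (x i) * \<epsilon> (y i)) * f (z j) (w j) + f (x i) (y i) * (\<epsilon> (z j) * \<epsilon> (w j))
      + \<epsilon> (y i) * \<epsilon> (z j) * f (x i) (w j) + \<epsilon> (x i) * \<epsilon> (w j) * f (y i) (z j)"
      unfolding der[OF P(1,3) mult_P[OF P(2,4)]] der2[OF P(2,4,3)] der2[OF P(2,4,1)] sym[OF P(3,2)]
      by (simp only: distrib_left mult_ac add_ac)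
  qed
  also have "\<dots> = \<epsilon> a * tensor_lift t P P f (\<Delta> b) + tensor_lift t P P f (\<Delta> a) * \<epsilon> b
      + (\<Sum>i<n. \<Sum>j<m. \<epsilon> (y i) * \<epsilon> (z j) * f (x i) (w j)) + (\<Sum>i<n. \<Sum>j<m. \<epsilon> (x i) * \<epsilon> (w j) * f (y i) (z j))"
    unfolding la lb \<epsilon>a \<epsilon>b sum_product by (simp add: sum.distrib)
  \<comment> \<open>Each cross term contracts one leg of either coproduct by the counit, which
    recovers a and b themselves.\<close>
  also have "(\<Sum>i<n. \<Sum>j<m. \<epsilon> (y i) * \<epsilon> (z j) * f (x i) (w j)) = f a b"
    by (subst a2, subst b1) (rule cbilinear_sum[OF f, symmetric], use x z in auto)
  also have "(\<Sum>i<n. \<Sum>j<m. \<epsilon> (x i) * \<epsilon> (w j) * f (y i) (z j)) = f a b"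
    by (subst a1, subst b2) (rule cbilinear_sum[OF f, symmetric], use x z in auto)
  finally show ?thesis by simp
qed

end

section \<open>The Gaussian and the purely non-Gaussian component\<close>

context generating_functional_on
begin

definition "K2 = cspan {x * y | x y. x \<in> K1 \<and> y \<in> K1}"

lemma K2_K1: "K2 \<subseteq> K1"
  unfolding K2_def by (rule cs.span_minimal) (auto simp: subspace_K1 K1_mult K1D)

lemma subspace_K2: "cs.subspace K2"
  unfolding K2_def by (rule cs.subspace_span)

lemma K1_mult_K2: "x \<in> K1 \<Longrightarrow> y \<in> K1 \<Longrightarrow> x * y \<in> K2"
  unfolding K2_def by (rule cs.span_base) blast

lemma K2_induct:
  assumes "k \<in> K2" "cs.subspace W" "\<And>x y. x \<in> K1 \<Longrightarrow> y \<in> K1 \<Longrightarrow> x * y \<in> W"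
  shows "k \<in> W"
proof -
  have "K2 \<subseteq> W" unfolding K2_def by (rule cs.span_minimal) (use assms in auto)
  then show ?thesis using assms(1) by blast
qed

sublocale embed: clinear_map_on scaleC fun_scale K1 K.embed
  by unfold_locales (use subspace_K1 K.embed_linear in auto)

text \<open>These are the vectors on which \<open>lact\<close> is given by the counit
  (\<open>lact_GG\<close>, \<open>GG_if_invariant\<close>): since <\<eta>(x y), g> = <\<eta>(y), adj
  x acting on g> for x and y in K_1, orthogonality to all such products says that K_1 annihilates
  g.\<close>

definition "GG = H.orth (K.embed ` K2)"
definition "RR = H.orth GG"

lemma embed_K2_HH: "K.embed ` K2 \<subseteq> HH"
  using K2_K1 K.embed_completion by auto

lemma GG_HH: "GG \<subseteq> HH" and RR_HH: "RR \<subseteq> HH"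
  by (auto simp: GG_def RR_def H.orth_def)

lemma subspace_GG: "fs.subspace GG" and subspace_RR: "fs.subspace RR"
  unfolding GG_def RR_def using H.orth_subspace embed_K2_HH GG_HH[unfolded GG_def] by blast+

lemma ip_embed: "a \<in> K1 \<Longrightarrow> x \<in> HH \<Longrightarrow> ip (K.embed a) x = x a"
  by (elim K.completionE) (simp add: K.completion_ip_embed)

lemma GG_iff: "x \<in> GG \<longleftrightarrow> x \<in> HH \<and> (\<forall>k\<in>K2. x k = 0)"
proof -
  have "ip (K.embed k) x = x k" if "k \<in> K2" "x \<in> HH" for k
    using that K2_K1 ip_embed by blast
  then show ?thesis unfolding GG_def H.orth_def by auto
qed

lemma HH_add: "x \<in> HH \<Longrightarrow> a \<in> K1 \<Longrightarrow> b \<in> K1 \<Longrightarrow> x (a + b) = x a + x b"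
  using H.q_add_left[of "K.embed a" "K.embed b" x] K.embed_completion
  by (simp add: ip_embed K.V_add clinear_on_add[OF K.embed_linear, symmetric])

lemma HH_scale: "x \<in> HH \<Longrightarrow> a \<in> K1 \<Longrightarrow> x (c *\<^sub>C a) = cnj c * x a"
  using H.q_scale_left[of "K.embed a" x c] K.embed_completion
  by (simp add: ip_embed K.V_scale clinear_on_scale[OF K.embed_linear, symmetric])

lemma HH_outside: "x \<in> HH \<Longrightarrow> a \<notin> K1 \<Longrightarrow> x a = 0"
  by (elim K.completionE) (simp add: K.completion_of_outside)

lemma lact_GG:
  assumes x: "x \<in> GG" and a: "a \<in> P" shows "lact a x = fun_scale (\<epsilon> a) x"
proof (rule ext)
  fix b
  have xH: "x \<in> HH" using x GG_HH by blast
  show "lact a x b = fun_scale (\<epsilon> a) x b"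
  proof (cases "b \<in> K1")
    case True
    let ?a = "adj a - cnj (\<epsilon> a) *\<^sub>C 1"
    have "?a \<in> K1" using center_K1[OF adj_P[OF a]] a by (simp add: counit_adj)
    then have k: "?a * b \<in> K2" using True by (rule K1_mult_K2)
    have "adj a * b = ?a * b + cnj (\<epsilon> a) *\<^sub>C b" by (simp add: left_diff_distrib scaleC_mult_left)
    then have "x (adj a * b) = x (?a * b) + x (cnj (\<epsilon> a) *\<^sub>C b)"
      using HH_add[OF xH, of "?a * b" "cnj (\<epsilon> a) *\<^sub>C b"] k K2_K1 True K.V_scale by auto
    then show ?thesis
      using x k True HH_scale[OF xH True] by (simp add: GG_iff lact_def fun_scale_def)
  next
    case False
    then show ?thesis using HH_outside[OF xH] by (simp add: lact_def fun_scale_def)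
  qed
qed

lemma GG_if_invariant:
  assumes x: "x \<in> HH" and inv: "\<And>a. a \<in> P \<Longrightarrow> lact a x = fun_scale (\<epsilon> a) x"
  shows "x \<in> GG"
proof -
  have "k \<in> {k \<in> K1. x k = 0}" if "k \<in> K2" for k
    using that
  proof (rule K2_induct)
    have "x 0 = 0" using HH_scale[OF x K.V_zero, of 0] by simp
    then show "cs.subspace {k \<in> K1. x k = 0}"
      by (auto simp: cs.subspace_def K.V_zero K.V_add K.V_scale HH_add[OF x] HH_scale[OF x])
    fix u w assume u: "u \<in> K1" and w: "w \<in> K1"
    have "x (u * w) = lact (adj u) x w" using w by (simp add: lact_def adj_adj)
    also have "\<dots> = 0" using inv[OF adj_P[OF K1D(1)[OF u]]] u by (simp add: fun_scale_def K1_def counit_adj)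
    finally show "u * w \<in> {k \<in> K1. x k = 0}" using u w K1_mult(2) K1D(1) by blast
  qed
  then show ?thesis using x by (simp add: GG_iff)
qed

lemma RR_I:
  assumes X: "K.cseq X" "\<And>n. X n \<in> K2" shows "K.completion_of X \<in> RR"
  unfolding RR_def H.orth_def
proof (intro CollectI conjI ballI)
  show H: "K.completion_of X \<in> HH" using X(1) by (auto simp: K.completion_def)
  fix g assume g: "g \<in> GG"
  have "(\<lambda>n. ip g (K.embed (X n))) \<longlonglongrightarrow> ip g (K.completion_of X)"
    using g GG_HH X K2_K1 K.embed_completion H K.embed_tendsto[OF X(1)]
    by (intro H.tendsto_q) (auto simp: H.nrm_zero)
  moreover have "ip g (K.embed (X n)) = 0" for n
    using g X(2)[of n] H.orthD[of g "K.embed ` K2"] H.ip_commute[of "K.embed (X n)" g] embed_K2_HH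
    unfolding GG_def by auto
  ultimately show "ip g (K.completion_of X) = 0" by (simp add: LIMSEQ_const_iff)
qed

text \<open>The approximating vectors are lifted to K2, where they remain Cauchy because the
  embedding preserves norms. The lift matters because \<sigma> acts on elements of the algebra and
  may not extend to the Hilbert space.\<close>

lemma projection_RR:
  assumes x: "x \<in> HH"
  obtains X where "K.cseq X" "\<And>n. X n \<in> K2" "x - K.completion_of X \<in> GG"
proof -
  have "fs.subspace (K.embed ` K2)"
    by (rule embed.image_subspace[OF subspace_K2 K2_K1])
  then obtain E y where E: "\<And>n. E n \<in> K.embed ` K2" "y \<in> HH" "(\<lambda>n. H.nrm (E n - y)) \<longlonglongrightarrow> 0"
    "x - y \<in> H.orth (K.embed ` K2)"
    using H.projection[OF _ embed_K2_HH x] by blast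
  have "\<exists>k. k \<in> K2 \<and> E n = K.embed k" for n using E(1) by blast
  then obtain X where X: "\<And>n. X n \<in> K2" "\<And>n. E n = K.embed (X n)" by metis
  have XK: "X n \<in> K1" for n using X(1) K2_K1 by blast
  have "H.cseq E"
    by (rule H.convergent_imp_cseq[OF _ E(2,3)]) (use E(1) embed_K2_HH in blast)
  then have cX: "K.cseq X"
    using XK unfolding K.cseq_def H.cseq_def X(2) by (simp add: K.embed_diff K.completion_norm_embed K.V_diff)
  have cH: "K.completion_of X \<in> HH" using cX by (auto simp: K.completion_def)
  have EH: "E n \<in> HH" for n using E(1) embed_K2_HH by blast
  have "H.nrm (y - K.completion_of X) \<le> 0"
  proof (rule LIMSEQ_le_const)
    show "(\<lambda>n. H.nrm (E n - y) + H.nrm (K.embed (X n) - K.completion_of X)) \<longlonglongrightarrow> 0"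
      using tendsto_add[OF E(3) K.embed_tendsto[OF cX]] by simp
    have "H.nrm (y - K.completion_of X) \<le> H.nrm (E n - y) + H.nrm (K.embed (X n) - K.completion_of X)" for n
      using H.nrm_triangle_diff[OF E(2) EH cH, of n] H.nrm_minus_commute[OF E(2) EH, of n] X(2) by simp
    then show "\<exists>N. \<forall>n\<ge>N. H.nrm (y - K.completion_of X) \<le> H.nrm (E n - y) + H.nrm (K.embed (X n) - K.completion_of X)"
      by blast
  qed
  then have "H.nrm (y - K.completion_of X) = 0" using H.nrm_ge_0[OF H.V_diff[OF E(2) cH]] by simp
  then have "y = K.completion_of X" using H.nrm_eq_0[OF H.V_diff[OF E(2) cH]] by simp
  then show ?thesis using that cX X(1) E(4) unfolding GG_def by blast
qed

lemma orth_RR: "H.orth RR = GG"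
proof
  show "GG \<subseteq> H.orth RR"
  proof
    fix g assume g: "g \<in> GG"
    have "ip r g = 0" if "r \<in> RR" for r
      using that g H.orthD[of r GG] H.ip_commute[of g r] GG_HH unfolding RR_def by auto
    then show "g \<in> H.orth RR" using g GG_HH by (auto simp: H.orth_def)
  qed
  show "H.orth RR \<subseteq> GG"
  proof
    fix x assume x: "x \<in> H.orth RR"
    then have xH: "x \<in> HH" by (rule H.orthD)
    then obtain X where X: "K.cseq X" "\<And>n. X n \<in> K2" "x - K.completion_of X \<in> GG"
      using projection_RR by blast
    have r: "K.completion_of X \<in> RR" by (rule RR_I[OF X(1,2)])
    have "x = x - K.completion_of X"
    proof (rule H.orth_unique[OF subspace_RR RR_HH x])
      show "x - K.completion_of X \<in> H.orth RR" using X(3) \<open>GG \<subseteq> H.orth RR\<close> by blast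
      show "x - x \<in> RR" using fs.subspace_0[OF subspace_RR] by simp
      show "x - (x - K.completion_of X) \<in> RR" using r by simp
    qed
    then show "x \<in> GG" using X(3) by simp
  qed
qed

lemma lact_RR: assumes "a \<in> P" "x \<in> RR" shows "lact a x \<in> RR"
  unfolding RR_def H.orth_def
proof (intro CollectI conjI ballI)
  have xH: "x \<in> HH" using assms(2) RR_HH by blast
  then show "lact a x \<in> HH" by (rule lact_HH[OF assms(1)])
  fix g assume g: "g \<in> GG"
  have "ip g (lact a x) = ip (lact (adj a) g) x"
    using star_rep assms(1) g xH GG_HH unfolding star_rep_on_def by (metis subsetD)
  also have "\<dots> = cnj (\<epsilon> (adj a)) * ip g x"
    using lact_GG[OF g adj_P[OF assms(1)]] g xH GG_HH by (auto intro: H.q_scale_left)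
  also have "\<dots> = 0" using H.orthD(2)[of x GG g] assms(2) g by (simp add: RR_def)
  finally show "ip g (lact a x) = 0" .
qed

definition "etaR a = (SOME y. y \<in> RR \<and> eta a - y \<in> GG)"
definition "etaG a = eta a - etaR a"

lemma eta_HH: "a \<in> P \<Longrightarrow> eta a \<in> HH"
  by (simp add: eta_def K.embed_completion center_K1)

lemma etaR_RR: "a \<in> P \<Longrightarrow> etaR a \<in> RR" and etaG_GG: "a \<in> P \<Longrightarrow> etaG a \<in> GG"
proof -
  assume a: "a \<in> P"
  obtain X where X: "K.cseq X" "\<And>n. X n \<in> K2" "eta a - K.completion_of X \<in> GG"
    using projection_RR[OF eta_HH[OF a]] by blast
  then have "\<exists>y. y \<in> RR \<and> eta a - y \<in> GG" using RR_I by blast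
  from someI_ex[OF this] show "etaR a \<in> RR" "etaG a \<in> GG" by (auto simp: etaR_def etaG_def)
qed

lemma etaR_eqI: "a \<in> P \<Longrightarrow> y \<in> RR \<Longrightarrow> eta a - y \<in> GG \<Longrightarrow> etaR a = y"
  using H.orth_unique[OF subspace_GG GG_HH, of "etaR a" y "eta a"] etaR_RR etaG_GG
  by (simp add: RR_def etaG_def)

lemma ip_RR_GG: "r \<in> RR \<Longrightarrow> g \<in> GG \<Longrightarrow> ip r g = 0" "r \<in> RR \<Longrightarrow> g \<in> GG \<Longrightarrow> ip g r = 0"
  using orth_RR H.orthD(2)[of g RR r] H.orthD(2)[of r GG g] by (auto simp: RR_def)

lemma cocycle_etaG: "cocycle P \<epsilon> fun_scale GG ip lact etaG"
proof -
  have "cocycle P \<epsilon> fun_scale (H.orth RR) ip lact etaG"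
    by (rule cocycle_on_orth[OF cocycle_eta subspace_RR RR_HH])
      (use lact_RR etaG_GG etaR_RR in \<open>auto simp: orth_RR etaG_def\<close>)
  then show ?thesis by (simp add: orth_RR)
qed

lemma cocycle_etaR: "cocycle P \<epsilon> fun_scale RR ip lact etaR"
  unfolding RR_def
proof (rule cocycle_on_orth[OF cocycle_eta subspace_GG GG_HH])
  show "lact a x \<in> GG" if "a \<in> P" "x \<in> GG" for a x
    using lact_GG[OF that(2,1)] fs.subspace_scale[OF subspace_GG that(2)] by simp
qed (use etaR_RR etaG_GG in \<open>auto simp: RR_def etaG_def\<close>)

lemma etaG_linear: "clinear_on P scaleC fun_scale etaG"
  using cocycle_etaG by (simp add: cocycle_def)

sublocale etaG: clinear_map_on scaleC fun_scale P etaG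
  by unfold_locales (use subP etaG_linear in auto)

lemmas etaG_add = clinear_on_add[OF etaG_linear]
  and etaG_scale = clinear_on_scale[OF etaG_linear]

lemma etaG_mult: "a \<in> P \<Longrightarrow> b \<in> P \<Longrightarrow> etaG (a * b) = fun_scale (\<epsilon> a) (etaG b) + fun_scale (\<epsilon> b) (etaG a)"
  using cocycle_etaG lact_GG[OF etaG_GG] by (simp add: cocycle_def)

lemma etaG_one: "etaG 1 = 0"
  by (rule cocycle_one[OF cocycle_etaG])

lemma etaG_HH: "a \<in> P \<Longrightarrow> etaG a \<in> HH"
  using etaG_GG GG_HH by blast

definition "cG a b = ip (etaG (adj a)) (etaG b)"

lemma bilinear_cG: "cbilinear_on (*) P cG"
  unfolding cbilinear_on_def cG_def
  by (intro conjI ballI clinear_onI)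
    (simp_all add: adj_add adj_scaleC etaG_add etaG_scale adj_P H.ip_add_right H.ip_scale_right
      H.q_add_left H.q_scale_left etaG_HH H.V_scale)

lemma cG_mult_left:
  assumes "x \<in> P" "y \<in> P" "z \<in> P" shows "cG (x * y) z = \<epsilon> x * cG y z + \<epsilon> y * cG x z"
  using assms
  by (simp add: cG_def adj_mult etaG_mult adj_P H.q_add_left H.q_scale_left etaG_HH H.V_scale counit_adj)

lemma cG_adj: "x \<in> P \<Longrightarrow> y \<in> P \<Longrightarrow> cG (adj x) (adj y) = cnj (cG y x)"
  using H.ip_commute[of "etaG (adj y)" "etaG x"] by (simp add: cG_def adj_adj adj_P etaG_HH)

text \<open>Orthogonality removes the mixed inner products, so once \<open>LG\<close> has coboundary
  \<open>cG\<close>, the difference \<open>LR\<close> automatically satisfies the identity for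
  \<open>etaR\<close>.\<close>

lemma decomposition_of_symmetric:
  assumes sym: "\<And>a b. a \<in> P \<Longrightarrow> b \<in> P \<Longrightarrow> cG a b = cG b a"
  shows "\<exists>L\<^sub>G L\<^sub>R. generating_functional P \<epsilon> L\<^sub>G \<and> generating_functional P \<epsilon> L\<^sub>R \<and>
    (\<forall>a\<in>P. L a = L\<^sub>G a + L\<^sub>R a) \<and> has_gaussian_cocycle P \<epsilon> L\<^sub>G \<and> has_purely_non_gaussian_cocycle P \<epsilon> L\<^sub>R"
proof -
  define \<Lambda> where "\<Lambda> a = tensor_lift t P P cG (\<Delta> a)" for a
  define LG where "LG a = \<Lambda> a / 2" for a
  define LR where "LR a = L a - LG a" for a
  have \<Lambda>_lin: "clinear_on P scaleC (*) \<Lambda>"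
    unfolding \<Lambda>_def by (rule tensor_lift_comult_linear[OF vector_space_times bilinear_cG])
  have LG_lin: "clinear_on P scaleC (*) LG"
    by (rule clinear_onI)
      (simp_all add: LG_def clinear_on_add[OF \<Lambda>_lin] clinear_on_scale[OF \<Lambda>_lin] add_divide_distrib)
  have LR_lin: "clinear_on P scaleC (*) LR"
    by (rule clinear_onI)
      (simp_all add: LR_def clinear_on_add[OF LG_lin] clinear_on_scale[OF LG_lin] L_add L_scale algebra_simps)
  have LG_mult: "LG (a * b) = \<epsilon> a * LG b + LG a * \<epsilon> b + ip (etaG (adj a)) (etaG b)"
    if "a \<in> P" "b \<in> P" for a b
  proof -
    have "\<Lambda> (a * b) = \<epsilon> a * \<Lambda> b + \<Lambda> a * \<epsilon> b + 2 * cG a b"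
      unfolding \<Lambda>_def
      by (rule symmetric_biderivation_coboundary[OF bilinear_cG _ _ that]) (fact cG_mult_left sym)+
    then show ?thesis by (simp add: LG_def cG_def add_divide_distrib)
  qed
  have LG_adj: "LG (adj a) = cnj (LG a)" if a: "a \<in> P" for a
  proof -
    obtain n :: nat and x y where x: "\<And>i. i < n \<Longrightarrow> x i \<in> P" "\<And>i. i < n \<Longrightarrow> y i \<in> P"
      "\<Delta> a = (\<Sum>i<n. t (x i) (y i))"
      using comultE[OF a] by blast
    have "\<Delta> (adj a) = (\<Sum>i<n. t (adj (x i)) (adj (y i)))"
      by (simp add: comult_adj x(3) adj_sum tensor_adj)
    then have "\<Lambda> (adj a) = (\<Sum>i<n. cG (adj (x i)) (adj (y i)))"
      unfolding \<Lambda>_def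
      by (simp only:) (rule tensor_lift_sum[OF vector_space_times bilinear_cG], use x adj_P in auto)
    also have "\<dots> = (\<Sum>i<n. cnj (cG (x i) (y i)))"
    proof (intro sum.cong refl)
      fix i assume "i \<in> {..<n}"
      then have "x i \<in> P" "y i \<in> P" using x by auto
      \<comment> \<open>Symmetry enters a second time: \<open>cG_adj\<close> exchanges the
        arguments, and without undoing this \<open>LG\<close> would not be seen to be
        hermitian.\<close>
      then show "cG (adj (x i)) (adj (y i)) = cnj (cG (x i) (y i))" using cG_adj sym by metis
    qed
    also have "\<dots> = cnj (\<Lambda> a)"
      unfolding \<Lambda>_def x(3)
      by (subst tensor_lift_sum[OF vector_space_times bilinear_cG]) (use x in auto)
    finally show ?thesis by (simp add: LG_def)
  qed
  have LR_mult: "LR (a * b) = \<epsilon> a * LR b + LR a * \<epsilon> b + ip (etaR (adj a)) (etaR b)"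
    if a: "a \<in> P" and b: "b \<in> P" for a b
  proof -
    have e: "eta c = etaG c + etaR c" for c by (simp add: etaG_def)
    have G: "etaG (adj a) \<in> GG" "etaG b \<in> GG" and R: "etaR (adj a) \<in> RR" "etaR b \<in> RR"
      using a b adj_P etaG_GG etaR_RR by auto
    then have "etaG (adj a) \<in> HH" "etaG b \<in> HH" "etaR (adj a) \<in> HH" "etaR b \<in> HH"
      using GG_HH RR_HH by auto
    then have "ip (eta (adj a)) (eta b) = ip (etaG (adj a)) (etaG b) + ip (etaR (adj a)) (etaR b)"
      unfolding e using ip_RR_GG(1)[OF R(1) G(2)] ip_RR_GG(2)[OF R(2) G(1)]
      by (simp add: H.q_add_left H.ip_add_right H.V_add)
    then show ?thesis using L_mult[OF a b] LG_mult[OF a b] by (simp add: LR_def algebra_simps)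
  qed
  have "LR (adj a) = cnj (LR a)" if "a \<in> P" for a
    using that by (simp add: LR_def L_adj LG_adj)
  then have "generating_functional P \<epsilon> LR"
    using generating_functional_of_cocycle[OF cocycle_etaR LR_lin] LR_mult by blast
  moreover have "generating_functional P \<epsilon> LG"
    using generating_functional_of_cocycle[OF cocycle_etaG LG_lin] LG_adj LG_mult by blast
  moreover have "has_gaussian_cocycle P \<epsilon> LG"
    unfolding has_gaussian_cocycle_def
  proof (intro exI conjI)
    show "associated_cocycle P \<epsilon> LG fun_scale GG ip lact etaG"
      unfolding associated_cocycle_def using cocycle_etaG LG_mult by blast
    show "gaussian P \<epsilon> fun_scale etaG"
      unfolding gaussian_def using etaG_mult by blast
  qed
  moreover have "has_purely_non_gaussian_cocycle P \<epsilon> LR"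
    unfolding has_purely_non_gaussian_cocycle_def
  proof (intro exI conjI)
    show "associated_cocycle P \<epsilon> LR fun_scale RR ip lact etaR"
      unfolding associated_cocycle_def using cocycle_etaR LR_mult by blast
    show "purely_non_gaussian P \<epsilon> fun_scale RR lact"
      unfolding purely_non_gaussian_def
    proof (intro equalityI subsetI)
      fix x assume "x \<in> {x \<in> RR. \<forall>a\<in>P. lact a x - fun_scale (\<epsilon> a) x = 0}"
      then have x: "x \<in> RR" "\<And>a. a \<in> P \<Longrightarrow> lact a x = fun_scale (\<epsilon> a) x" by auto
      \<comment> \<open>An invariant vector of RR lies in GG as well and is thus orthogonal to
        itself.\<close>
      then have "x \<in> GG" using GG_if_invariant RR_HH by blast
      then have "ip x x = 0" using x(1) ip_RR_GG by blast
      then show "x \<in> {0}" using H.nrm_eq_0[of x] x(1) RR_HH by (auto simp: H.nrm_def)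
    next
      fix x :: "'a \<Rightarrow> complex" assume "x \<in> {0}"
      then show "x \<in> {x \<in> RR. \<forall>a\<in>P. lact a x - fun_scale (\<epsilon> a) x = 0}"
      proof -
        have "lact a (0 :: 'a \<Rightarrow> complex) = 0" for a by (auto simp: lact_def fun_eq_iff)
        then show ?thesis using fs.subspace_0[OF subspace_RR] \<open>x \<in> {0}\<close> by simp
      qed
    qed
  qed
  moreover have "\<forall>a\<in>P. L a = LG a + LR a" by (simp add: LR_def)
  ultimately show ?thesis by blast
qed

end

section \<open>Invariance of the Gaussian part\<close>

lemma span_mult:
  assumes x: "x \<in> cspan A" and y: "y \<in> cspan B"
  shows "x * y \<in> cspan {a * b | a b. a \<in> A \<and> b \<in> B}" (is "_ \<in> ?W")
proof -
  have 1: "a * y \<in> ?W" if a: "a \<in> A" for a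
  proof -
    have "cspan B \<subseteq> {y. a * y \<in> ?W}"
    proof (rule cs.span_minimal)
      show "B \<subseteq> {y. a * y \<in> ?W}" using a by (auto intro!: cs.span_base)
      show "cs.subspace {y. a * y \<in> ?W}"
        by (auto simp: cs.subspace_def cs.span_zero cs.span_add cs.span_scale distrib_left scaleC_mult_right)
    qed
    then show ?thesis using y by blast
  qed
  have "cspan A \<subseteq> {x. x * y \<in> ?W}"
  proof (rule cs.span_minimal)
    show "A \<subseteq> {x. x * y \<in> ?W}" using 1 by blast
    show "cs.subspace {x. x * y \<in> ?W}"
      by (auto simp: cs.subspace_def cs.span_zero cs.span_add cs.span_scale distrib_right scaleC_mult_left)
  qed
  then show ?thesis using x by blast
qed

locale invariant_generating_functional =
  admissible_hopf t P \<Delta> \<epsilon> S \<alpha> + generating_functional_on t P \<Delta> \<epsilon> S L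
  for t :: "'a::cstar_algebra \<Rightarrow> 'a \<Rightarrow> 'b::cstar_algebra" and P \<Delta> \<epsilon> S \<alpha> L +
  assumes invariant: "a \<in> P \<Longrightarrow> L (\<sigma> a) = L a"
begin

lemma sigma_K1: "a \<in> K1 \<Longrightarrow> \<sigma> a \<in> K1"
  by (simp add: K1_def sigma_P counit_sigma)

lemma sigma_K2: "k \<in> K2 \<Longrightarrow> \<sigma> k \<in> K2"
proof -
  assume "k \<in> K2"
  then have "k \<in> {k \<in> P. \<sigma> k \<in> K2}"
  proof (rule K2_induct)
    show "cs.subspace {k \<in> P. \<sigma> k \<in> K2}"
      using cs.subspace_0[OF subspace_K2] cs.subspace_add[OF subspace_K2] cs.subspace_scale[OF subspace_K2]
      by (auto simp: cs.subspace_def zero_P add_P scale_P sigma.zero sigma_add sigma_scale)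
    show "x * y \<in> {k \<in> P. \<sigma> k \<in> K2}" if "x \<in> K1" "y \<in> K1" for x y
      using that K1_mult_K2 sigma_K1 by (simp add: sigma_mult mult_P K1D)
  qed
  then show ?thesis by simp
qed

lemma adj_K2: "k \<in> K2 \<Longrightarrow> adj k \<in> K2"
proof -
  assume "k \<in> K2"
  then have "k \<in> {k. adj k \<in> K2}"
  proof (rule K2_induct)
    show "cs.subspace {k. adj k \<in> K2}"
      using cs.subspace_0[OF subspace_K2] cs.subspace_add[OF subspace_K2] cs.subspace_scale[OF subspace_K2]
      by (auto simp: cs.subspace_def adj_add adj_scaleC)
    show "x * y \<in> {k. adj k \<in> K2}" if "x \<in> K1" "y \<in> K1" for x y
      using that K1_mult_K2 K1_adj by (simp add: adj_mult)
  qed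
  then show ?thesis by simp
qed

text \<open>Invariance is applied to adj a * b, whose factors \<sigma> interchanges.\<close>

lemma q_sigma: "a \<in> K1 \<Longrightarrow> b \<in> K1 \<Longrightarrow> q (adj (\<sigma> b)) (\<sigma> (adj a)) = q a b"
  using invariant[of "adj a * b"] by (simp add: q_def adj_adj sigma_mult adj_P mult_P K1D)

text \<open>Replacing a by \<sigma>(\<sigma> a) in \<open>q_sigma\<close> and using the involution
  property. It exhibits the square of \<sigma> as J* J for the antilinear J a = adj (\<sigma>
  a).\<close>

lemma q_adj_sigma: "a \<in> K1 \<Longrightarrow> b \<in> K1 \<Longrightarrow> q (adj (\<sigma> b)) (adj (\<sigma> a)) = q (\<sigma> (\<sigma> a)) b"
  using q_sigma[of "\<sigma> (\<sigma> a)" b] by (simp add: sigma_K1 sigma_adj_sigma sigma_P K1D)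

lemma q_sigma_sigma: "a \<in> K1 \<Longrightarrow> b \<in> K1 \<Longrightarrow> q (\<sigma> (\<sigma> a)) b = q a (\<sigma> (\<sigma> b))"
  using q_adj_sigma[of a b] q_adj_sigma[of b a] K.q_commute[of "adj (\<sigma> a)" "adj (\<sigma> b)"]
    K.q_commute[of "\<sigma> (\<sigma> b)" a]
  by (simp add: sigma_K1 K1_adj)

text \<open>The identity plus a positive operator: it is bounded below, and its norm also controls
  adj (\<sigma> a), which no multiple of the norm of a need do.\<close>

definition "\<tau> a = a + \<sigma> (\<sigma> a)"

lemma tau_K1: "a \<in> K1 \<Longrightarrow> \<tau> a \<in> K1"
  by (simp add: \<tau>_def K.V_add sigma_K1)

lemma tau_diff: "a \<in> P \<Longrightarrow> b \<in> P \<Longrightarrow> \<tau> (a - b) = \<tau> a - \<tau> b"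
  by (simp add: \<tau>_def sigma.diff sigma_P)

lemma q_tau: "a \<in> K1 \<Longrightarrow> b \<in> K1 \<Longrightarrow> q (\<tau> a) b = q a (\<tau> b)"
  by (simp add: \<tau>_def K.q_add_left K.q_add_right sigma_K1 q_sigma_sigma)

text \<open>The left side is <a, \<tau> a>, because the square of \<sigma> contributes the squared
  norm of adj (\<sigma> a); Cauchy-Schwarz bounds it. The next two estimates are read off from this
  one.\<close>

lemma nrm_tau_ge:
  assumes a: "a \<in> K1" shows "(K.nrm a)\<^sup>2 + (K.nrm (adj (\<sigma> a)))\<^sup>2 \<le> K.nrm a * K.nrm (\<tau> a)"
proof -
  have "Re (q a (\<tau> a)) = (K.nrm a)\<^sup>2 + (K.nrm (adj (\<sigma> a)))\<^sup>2"
    using a q_adj_sigma[OF a a] q_sigma_sigma[OF a a]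
    by (simp add: \<tau>_def K.q_add_right sigma_K1 K.nrm_sq K1_adj)
  moreover have "Re (q a (\<tau> a)) \<le> K.nrm a * K.nrm (\<tau> a)"
    using K.cauchy_schwarz[OF a tau_K1[OF a]] complex_Re_le_cmod order_trans by blast
  ultimately show ?thesis by simp
qed

lemma nrm_le_tau: assumes a: "a \<in> K1" shows "K.nrm a \<le> K.nrm (\<tau> a)"
proof (rule ccontr)
  assume *: "\<not> K.nrm a \<le> K.nrm (\<tau> a)"
  then have "K.nrm a > 0" using K.nrm_ge_0[OF tau_K1[OF a]] by linarith
  then have "K.nrm a * K.nrm (\<tau> a) < K.nrm a * K.nrm a" using * by simp
  also have "\<dots> \<le> (K.nrm a)\<^sup>2 + (K.nrm (adj (\<sigma> a)))\<^sup>2" by (simp add: power2_eq_square)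
  finally show False using nrm_tau_ge[OF a] by simp
qed

lemma nrm_adj_sigma_le: assumes a: "a \<in> K1" shows "K.nrm (adj (\<sigma> a)) \<le> K.nrm (\<tau> a)"
proof (rule power2_le_imp_le)
  have "(K.nrm (adj (\<sigma> a)))\<^sup>2 \<le> K.nrm a * K.nrm (\<tau> a)" using nrm_tau_ge[OF a] by (smt (verit) zero_le_power2)
  also have "\<dots> \<le> K.nrm (\<tau> a) * K.nrm (\<tau> a)"
    by (intro mult_right_mono nrm_le_tau K.nrm_ge_0 tau_K1 a)
  finally show "(K.nrm (adj (\<sigma> a)))\<^sup>2 \<le> (K.nrm (\<tau> a))\<^sup>2" by (simp add: power2_eq_square)
  show "0 \<le> K.nrm (\<tau> a)" by (intro K.nrm_ge_0 tau_K1 a)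
qed

text \<open>Modulo null vectors \<open>\<tau>\<close> is invertible on finite-dimensional subspaces invariant under \<open>\<sigma>\<^sup>2\<close>:
  \<open>\<sigma>\<^sup>2\<close> is a positive operator there.\<close>

lemma tau_surjective_finite_dim:
  assumes E: "cs.subspace E" "E \<subseteq> K1" "E \<subseteq> cspan F" "finite F"
    and inv: "\<And>x. x \<in> E \<Longrightarrow> \<sigma> (\<sigma> x) \<in> E" and k: "k \<in> E"
  shows "\<exists>w\<in>E. K.embed (\<tau> w) = K.embed k"
proof -
  \<comment> \<open>The embedding may have a kernel, so \<open>\<tau>\<close> is not transported
    along it directly. By symmetry, the square of \<sigma> acts on functionals as precomposition, a
    formula that is linear on all functions.\<close>
  define f :: "('a \<Rightarrow> complex) \<Rightarrow> 'a \<Rightarrow> complex"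
    where "f g = (\<lambda>a. if a \<in> K1 then g a + g (\<sigma> (\<sigma> a)) else 0)" for g
  have f_embed: "f (K.embed w) = K.embed (\<tau> w)" if w: "w \<in> K1" for w
  proof (rule ext)
    fix a show "f (K.embed w) a = K.embed (\<tau> w) a"
      using w by (cases "a \<in> K1")
        (simp_all add: f_def K.embed_apply K.embed_outside tau_K1 sigma_K1 \<tau>_def K.q_add_right K.V_add q_sigma_sigma)
  qed
  have tauE: "\<tau> w \<in> E" if "w \<in> E" for w
    unfolding \<tau>_def by (intro cs.subspace_add E inv that)
  obtain B where B: "B \<subseteq> E" "cindependent B" "E \<subseteq> cspan B"
    by (rule cs.maximal_independent_subset)
  have finB: "finite B" using cs.independent_span_bound[OF E(4) B(2)] B(1) E(3) by blast
  have "K.embed ` E \<subseteq> f ` K.embed ` E"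
  proof (rule fs.injective_imp_surjective_on_subspace)
    show "fs.subspace (K.embed ` E)" by (rule embed.image_subspace[OF E(1,2)])
    show "K.embed ` E \<subseteq> fs.span (K.embed ` B)"
    proof clarify
      fix x assume "x \<in> E"
      then have "x \<in> cspan B" using B(3) by blast
      then show "K.embed x \<in> fs.span (K.embed ` B)"
        by (rule embed.span_mem) (use B(1) E(2) in \<open>auto intro: fs.span_base\<close>)
    qed
    show "finite (K.embed ` B)" using finB by simp
    show "Vector_Spaces.linear fun_scale fun_scale f"
      unfolding Vector_Spaces.linear_iff
      by (auto simp: fs.vector_space_axioms f_def fun_scale_def fun_eq_iff algebra_simps)
    show "f ` K.embed ` E \<subseteq> K.embed ` E"
      using f_embed tauE E(2) by auto
    show "x = 0" if x: "x \<in> K.embed ` E" "f x = 0" for x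
    proof -
      obtain w where w: "w \<in> E" "x = K.embed w" using x(1) by blast
      then have wK: "w \<in> K1" using E(2) by blast
      have "K.embed (\<tau> w) = 0" using x(2) f_embed[OF wK] w(2) by simp
      then have "K.nrm (\<tau> w) = 0" using K.completion_norm_embed[OF tau_K1[OF wK]] H.nrm_zero by simp
      then have "H.nrm x = 0"
        using nrm_le_tau[OF wK] K.nrm_ge_0[OF wK] K.completion_norm_embed[OF wK] w(2) by simp
      then show ?thesis using H.nrm_eq_0 K.embed_completion[OF wK] w(2) by blast
    qed
  qed
  then have "K.embed k \<in> f ` K.embed ` E" using k by blast
  then obtain w where w: "w \<in> E" "K.embed k = f (K.embed w)" by blast
  then have "K.embed (\<tau> w) = K.embed k" using f_embed[of w] E(2) by auto
  then show ?thesis using w(1) by blast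
qed

text \<open>Finitely many factors occur in k, and a direct sum accommodates them all. The resulting
  span is finite-dimensional and, as the square of \<sigma> is multiplicative and preserves
  coefficient spaces and K_1, invariant.\<close>

lemma K2_in_coefs:
  assumes "k \<in> K2"
  obtains n u where "urep n u"
    "k \<in> cspan {x * y | x y. x \<in> cspan (coefs n u) \<inter> K1 \<and> y \<in> cspan (coefs n u) \<inter> K1}"
proof -
  define W where "W n u = cspan {x * y | x y. x \<in> cspan (coefs n u) \<inter> K1 \<and> y \<in> cspan (coefs n u) \<inter> K1}" for n u
  have mono: "W n u \<subseteq> W m v" if "coefs n u \<subseteq> coefs m v" for n u m v
    unfolding W_def using cs.span_mono[OF that] by (intro cs.span_mono) blast
  have "k \<in> {k. \<exists>n u. urep n u \<and> k \<in> W n u}"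
    using assms
  proof (rule K2_induct)
    show "cs.subspace {k. \<exists>n u. urep n u \<and> k \<in> W n u}"
      unfolding cs.subspace_def
    proof (intro conjI ballI allI)
      obtain n u where "urep n u" using finite_subset_in_coefs[of "{}"] by blast
      then show "0 \<in> {k. \<exists>n u. urep n u \<and> k \<in> W n u}" unfolding W_def by (auto intro: cs.span_zero)
      show "c *\<^sub>C x \<in> {k. \<exists>n u. urep n u \<and> k \<in> W n u}" if "x \<in> {k. \<exists>n u. urep n u \<and> k \<in> W n u}" for c x
        using that unfolding W_def by (auto intro: cs.span_scale)
      fix x y assume "x \<in> {k. \<exists>n u. urep n u \<and> k \<in> W n u}" "y \<in> {k. \<exists>n u. urep n u \<and> k \<in> W n u}"
      then obtain n u m v where *: "urep n u" "x \<in> W n u" "urep m v" "y \<in> W m v" by blast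
      then have "x \<in> W (n + m) (dsum n u v)" "y \<in> W (n + m) (dsum n u v)"
        using mono[OF coefs_dsum(1)[of n u m v]] mono[OF coefs_dsum(2)[of m v n u]] by auto
      then have "x + y \<in> W (n + m) (dsum n u v)" unfolding W_def by (rule cs.span_add)
      then show "x + y \<in> {k. \<exists>n u. urep n u \<and> k \<in> W n u}" using urep_dsum[OF *(1,3)] by blast
    qed
    fix x y assume xy: "x \<in> K1" "y \<in> K1"
    then have "finite {x, y}" "{x, y} \<subseteq> P" using K1D by auto
    then obtain n u where "urep n u" "{x, y} \<subseteq> cspan (coefs n u)" by (rule finite_subset_in_coefs)
    moreover from this have "x * y \<in> W n u" unfolding W_def using xy by (intro cs.span_base) blast
    ultimately show "x * y \<in> {k. \<exists>n u. urep n u \<and> k \<in> W n u}" by blast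
  qed
  then show ?thesis using that unfolding W_def by blast
qed

text \<open>The equation is solved inside the finite-dimensional span \<open>?E\<close> of products
  from one coefficient space; since \<open>?E\<close> lies in K2, so does the solution.\<close>

lemma tau_surjective_K2:
  assumes "k \<in> K2" shows "\<exists>w\<in>K2. K.embed (\<tau> w) = K.embed k"
proof -
  obtain n u where u: "urep n u" and
    k: "k \<in> cspan {x * y | x y. x \<in> cspan (coefs n u) \<inter> K1 \<and> y \<in> cspan (coefs n u) \<inter> K1}" (is "_ \<in> ?E")
    using K2_in_coefs[OF assms] by blast
  let ?G = "{x * y | x y. x \<in> cspan (coefs n u) \<inter> K1 \<and> y \<in> cspan (coefs n u) \<inter> K1}"
  let ?F = "{a * b | a b. a \<in> coefs n u \<and> b \<in> coefs n u}"
  have EK2: "?E \<subseteq> K2" unfolding K2_def by (rule cs.span_mono) blast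
  have "\<exists>w\<in>?E. K.embed (\<tau> w) = K.embed k"
  proof (rule tau_surjective_finite_dim)
    show "cs.subspace ?E" by (rule cs.subspace_span)
    show "?E \<subseteq> K1" using EK2 K2_K1 by blast
    show "?E \<subseteq> cspan ?F"
      by (rule cs.span_minimal) (use span_mult in \<open>auto intro: cs.subspace_span\<close>)
    have "?F = (\<lambda>(a, b). a * b) ` (coefs n u \<times> coefs n u)" by auto
    then show "finite ?F" by (simp add: finite_coefs)
    show "k \<in> ?E" by (rule k)
    fix x assume x: "x \<in> ?E"
    interpret s2: clinear_map_on scaleC scaleC P "\<lambda>a. \<sigma> (\<sigma> a)"
    proof unfold_locales
      show "clinear_on P scaleC scaleC (\<lambda>a. \<sigma> (\<sigma> a))"
        by (rule clinear_onI) (simp_all add: sigma_add sigma_scale sigma_P)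
    qed (rule subP)
    show "\<sigma> (\<sigma> x) \<in> ?E"
    proof (rule s2.span_mem[OF x])
      show "?G \<subseteq> P" using K1D(1) mult_P by auto
      fix b assume "b \<in> ?G"
      then obtain x y where b: "b = x * y" "x \<in> cspan (coefs n u)" "x \<in> K1" "y \<in> cspan (coefs n u)" "y \<in> K1" by blast
      then have "\<sigma> (\<sigma> b) = \<sigma> (\<sigma> x) * \<sigma> (\<sigma> y)" by (simp add: sigma_mult sigma_P K1D)
      then show "\<sigma> (\<sigma> b) \<in> ?E"
        using b sigma_sigma_coef_span[OF u] sigma_K1 by (intro cs.span_base) blast
    qed (rule cs.subspace_span)
  qed
  then show ?thesis using EK2 by blast
qed

text \<open>The antilinear involution \<open>b \<mapsto> adj (\<sigma> b)\<close> is in general unbounded on \<open>K1\<close>. Approximations \<open>w n\<close>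
  from \<open>K2\<close> for which even \<open>\<tau> (w n)\<close> converges control both \<open>w n\<close> and \<open>adj (\<sigma> (w n))\<close>.\<close>

lemma ip_etaR_sigma:
  assumes a: "a \<in> K1" and b: "b \<in> K1"
  shows "ip (etaR (adj (\<sigma> b))) (eta (\<sigma> (adj a))) = ip (eta a) (etaR b)"
proof -
  \<comment> \<open>Approximants are taken for \<tau> b; those of b will be the \<open>w n\<close>
    that \<tau> sends to them modulo null vectors.\<close>
  define b' where "b' = \<tau> b"
  have b': "b' \<in> K1" unfolding b'_def by (rule tau_K1[OF b])
  obtain X where X: "K.cseq X" "\<And>n. X n \<in> K2" "K.embed b' - K.completion_of X \<in> GG"
    using projection_RR[OF K.embed_completion[OF b']] by blast
  have "\<exists>w. w \<in> K2 \<and> K.embed (\<tau> w) = K.embed (X n)" for n using tau_surjective_K2[OF X(2)] by blast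
  then obtain w where w: "\<And>n. w n \<in> K2" "\<And>n. K.embed (\<tau> (w n)) = K.embed (X n)" by metis
  have wK: "w n \<in> K1" for n using w(1) K2_K1 by blast
  have wP: "w n \<in> P" for n using wK K1D by blast
  have XK: "X n \<in> K1" for n using X(2) K2_K1 by blast
  have tau_w: "K.nrm (\<tau> (w m - w n)) = K.nrm (X m - X n)" for m n
  proof -
    have "K.embed (\<tau> (w m - w n)) = K.embed (X m - X n)"
      using w(2) by (simp add: tau_diff wP K.embed_diff[symmetric] tau_K1 wK XK)
    then show ?thesis
      using K.completion_norm_embed[OF tau_K1[OF K.V_diff[OF wK wK]], of m n]
        K.completion_norm_embed[OF K.V_diff[OF XK XK], of m n] by simp
  qed
  have cw: "K.cseq w"
    by (rule K.cseq_lipschitz[OF X(1) wK, where K=1])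
      (use nrm_le_tau[OF K.V_diff[OF wK wK]] tau_w in simp)
  have cRw: "K.cseq (\<lambda>n. adj (\<sigma> (w n)))"
  proof (rule K.cseq_lipschitz[OF X(1), where K=1])
    show "adj (\<sigma> (w n)) \<in> K1" for n by (intro K1_adj sigma_K1 wK)
    show "K.nrm (adj (\<sigma> (w m)) - adj (\<sigma> (w n))) \<le> 1 * K.nrm (X m - X n)" for m n
      using nrm_adj_sigma_le[OF K.V_diff[OF wK wK], of m n] tau_w[of m n]
      by (simp add: sigma.diff wP adj_diff)
  qed
  have cd: "K.cseq (\<lambda>n. b - w n)" by (intro K.cseq_diff K.cseq_const b cw)
  have Rb: "adj (\<sigma> b) \<in> K1" by (intro K1_adj sigma_K1 b)
  have cRd: "K.cseq (\<lambda>n. adj (\<sigma> b) - adj (\<sigma> (w n)))" by (intro K.cseq_diff K.cseq_const cRw Rb)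
  have g_eq: "K.embed b - K.completion_of w = K.completion_of (\<lambda>n. b - w n)"
    unfolding K.embed_def by (intro K.completion_of_diff[symmetric] K.cseq_const b cw)
  have h_eq: "K.embed (adj (\<sigma> b)) - K.completion_of (\<lambda>n. adj (\<sigma> (w n)))
      = K.completion_of (\<lambda>n. adj (\<sigma> b) - adj (\<sigma> (w n)))"
    unfolding K.embed_def by (intro K.completion_of_diff[symmetric] K.cseq_const Rb cRw)
  have g: "K.completion_of (\<lambda>n. b - w n) \<in> GG"
    unfolding GG_iff
  proof (intro conjI ballI)
    show "K.completion_of (\<lambda>n. b - w n) \<in> HH" using cd by (auto simp: K.completion_def)
    fix k assume k: "k \<in> K2"
    then have kK: "k \<in> K1" using K2_K1 by blast
    \<comment> \<open>With k written as \<tau> v, symmetry moves \<tau> onto b - w n and turns it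
      into b' - X n. As v is again in K2, the limit is orthogonal to it.\<close>
    obtain v where v: "v \<in> K2" "K.embed (\<tau> v) = K.embed k" using tau_surjective_K2[OF k] by blast
    then have vK: "v \<in> K1" using K2_K1 by blast
    have "q k (b - w n) = q v (b' - X n)" for n
    proof -
      have d: "b - w n \<in> K1" by (intro K.V_diff b wK)
      have "q k (b - w n) = ip (K.embed (\<tau> v)) (K.embed (b - w n))"
        using v(2) K.completion_ip_embed_embed[OF kK d] by simp
      also have "\<dots> = q v (\<tau> (b - w n))"
        using K.completion_ip_embed_embed[OF tau_K1[OF vK] d] q_tau[OF vK d] by simp
      also have "\<dots> = ip (K.embed v) (K.embed b') - ip (K.embed v) (K.embed (\<tau> (w n)))"
        using vK b wK by (simp add: tau_diff K1D K.q_diff_right tau_K1 K.completion_ip_embed_embed b'_def)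
      also have "\<dots> = q v b' - q v (X n)"
        unfolding w(2) using vK b' XK by (simp add: K.completion_ip_embed_embed)
      also have "\<dots> = q v (b' - X n)" using vK b' XK by (simp add: K.q_diff_right)
      finally show ?thesis .
    qed
    moreover have "(\<lambda>n. q v (b' - X n)) \<longlonglongrightarrow> 0"
    proof -
      have "K.completion_of (\<lambda>n. b' - X n) = K.embed b' - K.completion_of X"
        unfolding K.embed_def by (intro K.completion_of_diff K.cseq_const b' X)
      then have "K.completion_of (\<lambda>n. b' - X n) v = 0" using X(3) v(1) by (simp only: GG_iff)
      then show ?thesis
        using K.completion_of_tendsto[OF K.cseq_diff[OF K.cseq_const[OF b'] X(1)] vK] by simp
    qed
    ultimately have "(\<lambda>n. q k (b - w n)) \<longlonglongrightarrow> 0" by simp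
    then show "K.completion_of (\<lambda>n. b - w n) k = 0"
      using K.completion_of_tendsto[OF cd kK] LIMSEQ_unique by blast
  qed
  have h: "K.completion_of (\<lambda>n. adj (\<sigma> b) - adj (\<sigma> (w n))) \<in> GG"
    unfolding GG_iff
  proof (intro conjI ballI)
    show "K.completion_of (\<lambda>n. adj (\<sigma> b) - adj (\<sigma> (w n))) \<in> HH" using cRd by (auto simp: K.completion_def)
    fix k assume k: "k \<in> K2"
    then have kK: "k \<in> K1" using K2_K1 by blast
    \<comment> \<open>Chosen so that k = \<sigma> (adj k'): in this form \<open>q_sigma\<close>
      brings the inner product back, up to conjugation, to b - w n. The element k' stays in
      K2.\<close>
    define k' where "k' = \<sigma> (adj k)"
    have k': "k' \<in> K2" unfolding k'_def by (intro sigma_K2 adj_K2 k)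
    then have k'K: "k' \<in> K1" using K2_K1 by blast
    have k_eq: "k = \<sigma> (adj k')" unfolding k'_def using kK by (simp add: sigma_adj_sigma adj_P K1D adj_adj)
    have "q k (adj (\<sigma> b) - adj (\<sigma> (w n))) = cnj (q k' (b - w n))" for n
    proof -
      have d: "b - w n \<in> K1" by (intro K.V_diff b wK)
      have R: "adj (\<sigma> b) - adj (\<sigma> (w n)) = adj (\<sigma> (b - w n))" using b wP K1D by (simp add: sigma.diff adj_diff)
      have "q (adj (\<sigma> (b - w n))) k = q k' (b - w n)" unfolding k_eq by (rule q_sigma[OF k'K d])
      then show ?thesis unfolding R using K.q_commute[of "adj (\<sigma> (b - w n))" k] kK K1_adj sigma_K1 d by simp
    qed
    moreover have "(\<lambda>n. cnj (q k' (b - w n))) \<longlonglongrightarrow> cnj 0"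
      using K.completion_of_tendsto[OF cd k'K] g k' by (intro tendsto_cnj) (simp add: GG_iff)
    ultimately have "(\<lambda>n. q k (adj (\<sigma> b) - adj (\<sigma> (w n)))) \<longlonglongrightarrow> 0" by simp
    then show "K.completion_of (\<lambda>n. adj (\<sigma> b) - adj (\<sigma> (w n))) k = 0"
      using K.completion_of_tendsto[OF cRd kK] LIMSEQ_unique by blast
  qed
  have r: "etaR b = K.completion_of w"
    by (rule etaR_eqI) (use g g_eq b K1D eta_K1[OF b] RR_I[OF cw w(1)] in auto)
  have "adj (\<sigma> (w n)) \<in> K2" for n by (intro adj_K2 sigma_K2 w)
  then have r': "etaR (adj (\<sigma> b)) = K.completion_of (\<lambda>n. adj (\<sigma> (w n)))"
    by (intro etaR_eqI) (use h h_eq Rb K1D eta_K1[OF Rb] RR_I[OF cRw] in auto)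
  have a': "\<sigma> (adj a) \<in> K1" by (intro sigma_K1 K1_adj a)
  \<comment> \<open>For each \<open>w n\<close> the identity is \<open>q_sigma\<close>; both sides
    have limits because \<open>w\<close> and its image under b \<mapsto> adj (\<sigma> b) are
    Cauchy.\<close>
  have "(\<lambda>n. q (adj (\<sigma> (w n))) (\<sigma> (adj a))) \<longlonglongrightarrow> ip (eta a) (etaR b)"
    unfolding r eta_K1[OF a] K.embed_def q_sigma[OF a wK]
    by (rule K.completion_ip_tendsto[OF K.cseq_const[OF a] cw])
  then show ?thesis
    unfolding r' eta_K1[OF a'] K.embed_def
    by (intro K.completion_ip_eqI cRw K.cseq_const a')
qed

lemma ip_eta_split: "a \<in> P \<Longrightarrow> b \<in> P \<Longrightarrow> ip (etaR a) (eta b) = ip (etaR a) (etaR b)"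
    "a \<in> P \<Longrightarrow> b \<in> P \<Longrightarrow> ip (eta a) (etaR b) = ip (etaR a) (etaR b)"
    "a \<in> P \<Longrightarrow> b \<in> P \<Longrightarrow> ip (eta a) (eta b) = ip (etaG a) (etaG b) + ip (etaR a) (etaR b)"
proof -
  assume a: "a \<in> P" and b: "b \<in> P"
  have e: "eta c = etaG c + etaR c" for c by (simp add: etaG_def)
  note G = etaG_GG[OF a] etaG_GG[OF b] and R = etaR_RR[OF a] etaR_RR[OF b]
  have "etaG a \<in> HH" "etaG b \<in> HH" "etaR a \<in> HH" "etaR b \<in> HH"
    using G R GG_HH RR_HH by auto
  then show "ip (etaR a) (eta b) = ip (etaR a) (etaR b)" "ip (eta a) (etaR b) = ip (etaR a) (etaR b)"
    "ip (eta a) (eta b) = ip (etaG a) (etaG b) + ip (etaR a) (etaR b)"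
    unfolding e using ip_RR_GG(1)[OF R(1) G(2)] ip_RR_GG(2)[OF R(2) G(1)]
    by (simp_all add: H.q_add_left H.ip_add_right H.V_add)
qed

text \<open>The full inner product is preserved by \<open>q_sigma\<close> and its RR part by
  \<open>ip_etaR_sigma\<close>; the Gaussian part is their difference.\<close>

lemma cG_sigma_K1:
  assumes a: "a \<in> K1" and b: "b \<in> K1" shows "cG (\<sigma> b) (\<sigma> a) = cG a b"
proof -
  let ?a = "adj a"
  have P: "?a \<in> P" "b \<in> P" "adj (\<sigma> b) \<in> P" "\<sigma> a \<in> P"
    using a b K1D adj_P sigma_P by auto
  have aK: "?a \<in> K1" by (rule K1_adj[OF a])
  have "ip (etaR (adj (\<sigma> b))) (etaR (\<sigma> a)) = ip (etaR ?a) (etaR b)"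
    using ip_etaR_sigma[OF aK b] ip_eta_split(1)[OF P(3,4)] ip_eta_split(2)[OF P(1,2)] by (simp add: adj_adj)
  moreover have "ip (eta (adj (\<sigma> b))) (eta (\<sigma> a)) = ip (eta ?a) (eta b)"
    using q_sigma[OF aK b] a b aK
    by (simp add: eta_K1 sigma_K1 K1_adj K.completion_ip_embed_embed adj_adj)
  ultimately show ?thesis
    using ip_eta_split(3)[OF P(3,4)] ip_eta_split(3)[OF P(1,2)] by (simp add: cG_def)
qed

section \<open>From invariance under the antipode composed with the bijection to symmetry\<close>

lemma sigma_one: "\<sigma> 1 = 1"
proof -
  have P: "adj (\<sigma> 1) \<in> P" by (intro adj_P sigma_P one_P)
  have "\<sigma> (adj (\<sigma> 1) * 1) = \<sigma> 1 * \<sigma> (adj (\<sigma> 1))" by (rule sigma_mult[OF P one_P])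
  then show ?thesis by (simp add: sigma_adj_sigma one_P)
qed

lemma etaG_center: "a \<in> P \<Longrightarrow> etaG (a - \<epsilon> a *\<^sub>C 1) = etaG a"
  by (simp add: etaG.diff scale_P one_P etaG_scale etaG_one)

text \<open>\<open>etaG\<close> vanishes at 1, and \<sigma> preserves both 1 and the counit, so all
  arguments may be moved into K_1.\<close>

lemma cG_sigma:
  assumes a: "a \<in> P" and b: "b \<in> P" shows "cG (\<sigma> b) (\<sigma> a) = cG a b"
proof -
  let ?c = "\<lambda>a. a - \<epsilon> a *\<^sub>C 1"
  have s: "\<sigma> (?c x) = ?c (\<sigma> x)" if "x \<in> P" for x
    using that by (simp add: sigma.diff sigma_scale scale_P one_P sigma_one counit_sigma)
  have ad: "adj (?c x) = ?c (adj x)" if "x \<in> P" for x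
    using that by (simp add: adj_diff adj_scaleC counit_adj)
  have c: "cG (?c x) (?c y) = cG x y" if "x \<in> P" "y \<in> P" for x y
    using that unfolding cG_def ad[OF that(1)] by (simp add: etaG_center adj_P)
  show ?thesis
    using cG_sigma_K1[OF center_K1[OF a] center_K1[OF b]] a b by (simp only: s c sigma_P)
qed

text \<open>Apply \<open>etaG\<close>, a derivation at the counit, to the entries of u u* = 1. As
  the counit of u is the identity matrix, what remains is the sum of the values at u i j and at adj
  (u j i) = S (u i j).\<close>

lemma etaG_antipode: "a \<in> P \<Longrightarrow> etaG (S a) = - etaG a"
proof (induction rule: P_induct)
  case (coef n u i j)
  have uP: "u k l \<in> P" if "k < n" "l < n" for k l using urep_coef_P[OF coef(1) that] .
  have "(\<Sum>k<n. etaG (u i k * adj (u j k))) = etaG (\<Sum>k<n. u i k * adj (u j k))"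
    using coef uP by (intro etaG.sum[symmetric]) (auto intro: mult_P adj_P)
  also have "\<dots> = 0"
    using urep_unitary(1)[OF coef] by (cases "i = j") (simp_all add: etaG_one etaG.zero)
  also have "(\<Sum>k<n. etaG (u i k * adj (u j k)))
      = (\<Sum>k<n. fun_scale (of_bool (i = k)) (etaG (adj (u j k))) + fun_scale (of_bool (j = k)) (etaG (u i k)))"
  proof (intro sum.cong refl)
    fix k assume "k \<in> {..<n}"
    then have k: "k < n" by simp
    have "\<epsilon> (adj (u j k)) = of_bool (j = k)"
      using counit_adj[OF uP[OF coef(3) k]] counit_coef[OF coef(1,3) k] by simp
    then show "etaG (u i k * adj (u j k))
        = fun_scale (of_bool (i = k)) (etaG (adj (u j k))) + fun_scale (of_bool (j = k)) (etaG (u i k))"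
      using etaG_mult[OF uP[OF coef(2) k] adj_P[OF uP[OF coef(3) k]]] counit_coef[OF coef(1,2) k] by simp
  qed
  also have "\<dots> = etaG (adj (u j i)) + etaG (u i j)"
    using coef by (simp add: sum.distrib of_bool_def if_distrib[of "\<lambda>c. fun_scale c _"] cong: if_cong)
  finally have "etaG (adj (u j i)) = - etaG (u i j)" by (rule eq_neg_iff_add_eq_0[THEN iffD2])
  then show ?case by (simp only: antipode_coef[OF coef])
next
  case (scale c x)
  then show ?case by (simp only: antipode_scale etaG_scale antipode_P fs.scale_minus_right)
qed (simp_all add: antipode.zero antipode_add antipode_P etaG.zero etaG_add)

lemma etaG_adj_antipode: "a \<in> P \<Longrightarrow> etaG (adj (S a)) = - etaG (adj a)"
  using etaG_antipode[of "adj (S a)"] by (simp add: antipode_adj_antipode adj_P antipode_P)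

text \<open>The antipode contributes one sign in each argument, and the two signs cancel.\<close>

lemma cG_alpha:
  assumes a: "a \<in> P" and b: "b \<in> P" shows "cG (\<alpha> b) (\<alpha> a) = cG a b"
proof -
  have "cG (\<sigma> b) (\<sigma> a) = ip (- etaG (adj (\<alpha> b))) (- etaG (\<alpha> a))"
    using a b by (simp add: cG_def \<sigma>_def etaG_antipode etaG_adj_antipode alpha_P)
  also have "\<dots> = cG (\<alpha> b) (\<alpha> a)"
    using H.q_scale_left[of "etaG (adj (\<alpha> b))" "- etaG (\<alpha> a)" "-1"] H.q_scale_right[of "etaG (adj (\<alpha> b))" "etaG (\<alpha> a)" "-1"]
      H.V_scale[of "etaG (\<alpha> a)" "-1"] etaG_HH[of "\<alpha> a"] etaG_HH[of "adj (\<alpha> b)"] a b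
    by (simp add: cG_def alpha_P adj_P)
  finally show ?thesis using cG_sigma[OF a b] by simp
qed

lemma cG_symmetric:
  assumes a: "a \<in> P" and b: "b \<in> P" shows "cG a b = cG b a"
proof -
  define \<omega> where "\<omega> x y = cG x y - cG y x" for x y
  have bil: "cbilinear_on (*) P \<omega>"
  proof -
    have l: "clinear_on P scaleC (*) (\<lambda>x. cG x z)" "clinear_on P scaleC (*) (cG z)" if "z \<in> P" for z
      using bilinear_cG that by (auto simp: cbilinear_on_def)
    show ?thesis
      unfolding cbilinear_on_def \<omega>_def
      by (intro conjI ballI clinear_onI)
        (simp_all add: clinear_on_add[OF l(1)] clinear_on_add[OF l(2)] clinear_on_scale[OF l(1)]
          clinear_on_scale[OF l(2)] right_diff_distrib)
  qed
  note lift = tensor_lift_sum[OF vector_space_times bil]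
  have "t a b \<in> alg_tensor t P P" unfolding alg_tensor_def using a b by (intro cs.span_base) blast
  \<comment> \<open>A preimage under the map of condition (v). On z and on its image under the
    tensor square of \<alpha> the lift of \<open>\<omega>\<close> takes opposite values, so it
    vanishes on their sum.\<close>
  then obtain z where z: "z \<in> alg_tensor t P P" "t a b = z + tensor_lift t P P (\<lambda>x y. t (\<alpha> x) (\<alpha> y)) z"
    using alpha_bij2 unfolding bij_betw_def by blast
  obtain n :: nat and x y where xy: "\<And>i. i < n \<Longrightarrow> x i \<in> P" "\<And>i. i < n \<Longrightarrow> y i \<in> P" "z = (\<Sum>i<n. t (x i) (y i))"
    using alg_tensorE[OF z(1)] by blast
  have az: "tensor_lift t P P (\<lambda>x y. t (\<alpha> x) (\<alpha> y)) z = (\<Sum>i<n. t (\<alpha> (x i)) (\<alpha> (y i)))"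
    unfolding xy(3) by (rule tensor_lift_sum[OF vector_space_scaleC bilinear_alpha]) (use xy in auto)
  have azT: "(\<Sum>i<n. t (\<alpha> (x i)) (\<alpha> (y i))) \<in> alg_tensor t P P"
    unfolding alg_tensor_def by (rule cs.span_sum, rule cs.span_base) (use xy alpha_P in blast)
  have "\<omega> a b = tensor_lift t P P \<omega> (t a b)"
    by (rule tensor_lift_simple[OF vector_space_times bil a b, symmetric])
  also have "\<dots> = tensor_lift t P P \<omega> z + tensor_lift t P P \<omega> (\<Sum>i<n. t (\<alpha> (x i)) (\<alpha> (y i)))"
    unfolding z(2) az by (rule clinear_on_add[OF tensor_lift_linear[OF vector_space_times bil] z(1) azT])
  also have "tensor_lift t P P \<omega> z = (\<Sum>i<n. \<omega> (x i) (y i))"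
    unfolding xy(3) by (rule lift) (use xy in auto)
  also have "tensor_lift t P P \<omega> (\<Sum>i<n. t (\<alpha> (x i)) (\<alpha> (y i))) = (\<Sum>i<n. \<omega> (\<alpha> (x i)) (\<alpha> (y i)))"
    by (rule lift) (use xy alpha_P in auto)
  also have "(\<Sum>i<n. \<omega> (\<alpha> (x i)) (\<alpha> (y i))) = (\<Sum>i<n. - \<omega> (x i) (y i))"
    using xy cG_alpha by (intro sum.cong refl) (simp add: \<omega>_def)
  finally have "\<omega> a b = 0" by (simp only: sum_negf add.right_inverse)
  then show ?thesis by (simp add: \<omega>_def)
qed

end

theorem theorem3p4:
  fixes t :: "'a::cstar_algebra \<Rightarrow> 'a \<Rightarrow> 'b::cstar_algebra"
    and tl :: "'b \<Rightarrow> 'a \<Rightarrow> 'c::cstar_algebra"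
    and tr :: "'a \<Rightarrow> 'b \<Rightarrow> 'c"
    and \<Delta> :: "'a \<Rightarrow> 'b"
    and \<epsilon> :: "'a \<Rightarrow> complex"
    and S \<alpha> :: "'a \<Rightarrow> 'a"
    and L :: "'a \<Rightarrow> complex"
  assumes "compact_quantum_group t tl tr \<Delta>"
    and "hopf_star_algebra_on t \<Delta> (Pol t \<Delta>) \<epsilon> S"
    and "admissible_bijection t \<Delta> (Pol t \<Delta>) \<alpha>"
    and "generating_functional (Pol t \<Delta>) \<epsilon> L"
    and "\<forall>a\<in>Pol t \<Delta>. L ((S \<circ> \<alpha>) a) = L a"
  shows "\<exists>L\<^sub>G L\<^sub>R :: 'a \<Rightarrow> complex.
    generating_functional (Pol t \<Delta>) \<epsilon> L\<^sub>G \<and> generating_functional (Pol t \<Delta>) \<epsilon> L\<^sub>R \<and>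
    (\<forall>a\<in>Pol t \<Delta>. L a = L\<^sub>G a + L\<^sub>R a) \<and>
    has_gaussian_cocycle (Pol t \<Delta>) \<epsilon> L\<^sub>G \<and>
    has_purely_non_gaussian_cocycle (Pol t \<Delta>) \<epsilon> L\<^sub>R"
proof -
  interpret cqg: compact_quantum_group t tl tr \<Delta> by fact
  interpret admissible_hopf t "Pol t \<Delta>" \<Delta> \<epsilon> S \<alpha>
    by unfold_locales (use assms cqg.star_hom_comult in \<open>auto simp: hopf_star_algebra_on_def\<close>)
  interpret invariant_generating_functional t "Pol t \<Delta>" \<Delta> \<epsilon> S \<alpha> L
    by unfold_locales (use assms in \<open>auto simp: \<sigma>_def\<close>)
  show ?thesis by (rule decomposition_of_symmetric) (rule cG_symmetric)
qed

end
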